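(* For objects with $\mu_*=\mu_0$ (i.e. $\mu_r=1$), the coefficients $$\mathfrak D_{kj}^{\beta\delta}:=-\mathrm i\nu\alpha^{3+|\beta|+|\delta|}\,\boldsymbol e_k\cdot\int_B\boldsymbol\xi\times\Big(\boldsymbol\xi^\beta(\boldsymbol\theta_j^{(0),\delta}+\boldsymbol\theta_j^{(1),\delta})\Big)\,\mathrm d\boldsymbol\xi$$ (for multi-indices $\beta,\delta$ and $k,j\in\{1,2,3\}$) satisfy \begin{align*} \mathfrak D_{kj}^{\beta\delta}=-\alpha^{3+|\beta|+|\delta|}\Big(&\int_B\frac{\mathrm i}{\nu}\nabla\times\mu_r^{-1}\nabla\times\boldsymbol\theta_k^{(1),\beta}\cdot\nabla\times\mu_r^{-1}\nabla\times\overline{\boldsymbol\theta_j^{(1),\delta}}\,\mathrm d\boldsymbol\xi\\ &-\int_{B\cup B^c}\tilde\mu_r^{-1}\nabla\times\boldsymbol\theta_k^{(1),\beta}\cdot\nabla\times\overline{\boldsymbol\theta_j^{(1),\delta}}\,\mathrm d\boldsymbol\xi\Big), \end{align*} and can be written in the form $\mathfrak D_{kj}^{\beta\delta}=\mathfrak R_{kj}^{\beta\delta}+\mathrm i\,\mathfrak I_{kj}^{\beta\delta}$, where \begin{align*} \mathfrak R_{kj}^{\beta\delta}=\operatorname{Re}(\mathfrak D_{kj}^{\beta\delta})&=\alpha^{3+|\beta|+|\delta|}\int_{B\cup B^c}\tilde\mu_r^{-1}\nabla\times\boldsymbol\theta_k^{(1),\beta}\cdot\nabla\times\overline{\boldsymbol\theta_j^{(1),\delta}}\,\mathrm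 d\boldsymbol\xi,\\ \mathfrak I_{kj}^{\beta\delta}=\operatorname{Im}(\mathfrak D_{kj}^{\beta\delta})&=-\alpha^{3+|\beta|+|\delta|}\int_B\frac1\nu\nabla\times\mu_r^{-1}\nabla\times\boldsymbol\theta_k^{(1),\beta}\cdot\nabla\times\mu_r^{-1}\nabla\times\overline{\boldsymbol\theta_j^{(1),\delta}}\,\mathrm d\boldsymbol\xi, \end{align*} and the overbar denotes the complex conjugate.
   Context: $B\subset\mathbb R^3$ is a bounded object, $\Gamma=\partial B$, $B^c=\mathbb R^3\setminus\overline B$, $\boldsymbol n$ the unit normal on $\Gamma$, $[\cdot]_\Gamma=\cdot|_+-\cdot|_-$ the jump across $\Gamma$ ($+$ outside, $-$ inside). $\alpha>0$ is a size parameter, $\nu=\omega\sigma_*\mu_0\alpha^2>0$ (with frequency $\omega$, conductivity $\sigma_*$), $\mu_r=\mu_*/\mu_0$ is the object's constant relative permeability, and $\tilde\mu_r=\mu_r$ in $B$, $\tilde\mu_r=1$ in $B^c$. $\boldsymbol e_k$ are the standard basis vectors; multi-indices $\delta=(\delta_1,\delta_2,\delta_3)$ have $|\delta|=\delta_1+\delta_2+\delta_3$, $\boldsymbol\xi^\delta=\xi_1^{\delta_1}\xi_2^{\delta_2}\xi_3^{\delta_3}$. All derivatives are with respect to $\boldsymbol\xi$. The fields $\boldsymbol\theta_j^{(1),\delta}$ and $\boldsymbol\theta_j^{(0),\delta}$ satisfy the transmission problems \begin{align*} \nabla\times\mu_r^{-1}\nabla\times\boldsymbol\theta_j^{(1),\delta}-\mathrm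 i\nu(\boldsymbol\theta_j^{(1),\delta}+\boldsymbol\theta_j^{(0),\delta})&=\boldsymbol0&&\text{in }B,\\ \nabla\cdot\boldsymbol\theta_j^{(1),\delta}=0,\qquad\nabla\times\nabla\times\boldsymbol\theta_j^{(1),\delta}&=\boldsymbol0&&\text{in }B^c,\\ [\boldsymbol n\times\boldsymbol\theta_j^{(1),\delta}]_\Gamma=\boldsymbol0,\qquad[\boldsymbol n\times\tilde\mu_r^{-1}\nabla\times\boldsymbol\theta_j^{(1),\delta}]_\Gamma&=\boldsymbol0&&\text{on }\Gamma,\\ \int_\Gamma\boldsymbol n\cdot\boldsymbol\theta_j^{(1),\delta}\,\mathrm d\boldsymbol\xi=0,\qquad\boldsymbol\theta_j^{(1),\delta}&=O(|\boldsymbol\xi|^{-1})&&\text{as }|\boldsymbol\xi|\to\infty, \end{align*} and \begin{align*} \nabla\times\mu_r^{-1}\nabla\times\boldsymbol\theta_j^{(0),\delta}&=\boldsymbol0&&\text{in }B,\\ \nabla\cdot\boldsymbol\theta_j^{(0),\delta}=0,\qquad\nabla\times\nabla\times\boldsymbol\theta_j^{(0),\delta}&=\boldsymbol0&&\text{in }B^c,\\ [\boldsymbol n\times\boldsymbol\theta_j^{(0),\delta}]_\Gamma=\boldsymbol0,\qquad[\boldsymbol n\times\tilde\mu_r^{-1}\nabla\times\boldsymbol\theta_j^{(0),\delta}]_\Gamma&=\boldsymbol0&&\text{on }\Gamma,\\ \int_\Gamma\boldsymbol n\cdot\boldsymbol\theta_j^{(0),\delta}\,\mathrm d\boldsymbol\xi=0,\qquad\boldsymbol\theta_j^{(0),\delta}-\boldsymbol\xi^\delta\boldsymbol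 e_j\times\boldsymbol\xi&=O(|\boldsymbol\xi|^{-1})&&\text{as }|\boldsymbol\xi|\to\infty, \end{align*} respectively. When $\mu_*=\mu_0$ the paper takes $\boldsymbol\theta_j^{(0),\delta}=\boldsymbol\xi^\delta\boldsymbol e_j\times\boldsymbol\xi$, which is real valued. *)

theory Defs
  imports "HOL-Analysis.Analysis" "HOL-Library.Landau_Symbols"
begin

type_synonym vec_field = "real^3 \<Rightarrow> complex^3"

definition cvec :: "real^3 \<Rightarrow> complex^3" where
  "cvec v = (\<chi> i. complex_of_real (v $ i))"

definition cnj_vec :: "complex^3 \<Rightarrow> complex^3" where
  "cnj_vec v = (\<chi> i. cnj (v $ i))"

text \<open>The dot product of complex vectors is bilinear, not sesquilinear: complex conjugates are
  always written out.  The library's inner product on \<^typ>\<open>complex^3\<close> is real valued.\<close>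

definition cdot :: "complex^3 \<Rightarrow> complex^3 \<Rightarrow> complex" where
  "cdot a b = (\<Sum>i\<in>UNIV. a $ i * b $ i)"

definition ccross :: "complex^3 \<Rightarrow> complex^3 \<Rightarrow> complex^3" where
  "ccross a b = vector [a $ 2 * b $ 3 - a $ 3 * b $ 2,
                        a $ 3 * b $ 1 - a $ 1 * b $ 3,
                        a $ 1 * b $ 2 - a $ 2 * b $ 1]"

definition mi_order :: "nat^3 \<Rightarrow> nat" where
  "mi_order d = (\<Sum>i\<in>UNIV. d $ i)"

definition monomial :: "nat^3 \<Rightarrow> real^3 \<Rightarrow> real" where
  "monomial d x = (\<Prod>i\<in>UNIV. (x $ i) ^ (d $ i))"

definition pd :: "3 \<Rightarrow> (real^3 \<Rightarrow> 'a::real_normed_vector) \<Rightarrow> real^3 \<Rightarrow> 'a" where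
  "pd i f x = frechet_derivative f (at x) (axis i 1)"

definition grad :: "(real^3 \<Rightarrow> real) \<Rightarrow> real^3 \<Rightarrow> real^3" where
  "grad f x = (\<chi> i. pd i f x)"

definition curl :: "vec_field \<Rightarrow> vec_field" where
  "curl F x = vector [pd 2 F x $ 3 - pd 3 F x $ 2,
                      pd 3 F x $ 1 - pd 1 F x $ 3,
                      pd 1 F x $ 2 - pd 2 F x $ 1]"

definition divergence :: "vec_field \<Rightarrow> real^3 \<Rightarrow> complex" where
  "divergence F x = (\<Sum>i\<in>UNIV. pd i F x $ i)"

text \<open>\<open>C1_on\<close> and \<open>C2_on\<close> are meant for open sets \<open>S\<close>.\<close>

definition C1_on :: "(real^3) set \<Rightarrow> (real^3 \<Rightarrow> 'a::real_normed_vector) \<Rightarrow> bool" where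
  "C1_on S f \<longleftrightarrow> (\<forall>x\<in>S. f differentiable at x) \<and> (\<forall>i. continuous_on S (pd i f))"

definition C2_on :: "(real^3) set \<Rightarrow> (real^3 \<Rightarrow> 'a::real_normed_vector) \<Rightarrow> bool" where
  "C2_on S f \<longleftrightarrow> C1_on S f \<and> (\<forall>i. C1_on S (pd i f))"

definition exterior :: "(real^3) set \<Rightarrow> (real^3) set" where
  "exterior B = - closure B"

text \<open>The boundary of \<open>B\<close> is of class \<open>C\<^sup>1\<close>, \<open>B\<close> lies locally on one side of it, and \<open>n\<close> is the
  unit normal pointing out of \<open>B\<close>: near each boundary point, \<open>B\<close> is the set where a \<open>C\<^sup>1\<close> function
  with nonvanishing gradient is negative, and \<open>n\<close> is the normalised gradient.\<close>

definition C1_boundary_with_normal :: "(real^3) set \<Rightarrow> (real^3 \<Rightarrow> real^3) \<Rightarrow> bool" where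
  "C1_boundary_with_normal B n \<longleftrightarrow>
     (\<forall>x\<in>frontier B. \<exists>U \<rho>. open U \<and> x \<in> U \<and> C1_on U \<rho> \<and> (\<forall>y\<in>U. grad \<rho> y \<noteq> 0) \<and>
        B \<inter> U = {y\<in>U. \<rho> y < 0} \<and>
        (\<forall>y\<in>frontier B \<inter> U. n y = grad \<rho> y /\<^sub>R norm (grad \<rho> y)))"

definition trace_in :: "(real^3) set \<Rightarrow> vec_field \<Rightarrow> vec_field" where
  "trace_in B F x = Lim (at x within B) F"

definition trace_out :: "(real^3) set \<Rightarrow> vec_field \<Rightarrow> vec_field" where
  "trace_out B F x = Lim (at x within exterior B) F"

definition jump :: "(real^3) set \<Rightarrow> vec_field \<Rightarrow> vec_field" where
  "jump B F x = trace_out B F x - trace_in B F x"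

text \<open>One-sided limits at every boundary point, that is, continuous extendability to the
  boundary from the inside and from the outside.\<close>

definition has_traces :: "(real^3) set \<Rightarrow> vec_field \<Rightarrow> bool" where
  "has_traces B F \<longleftrightarrow>
     (\<forall>x\<in>frontier B. (\<exists>l. (F \<longlongrightarrow> l) (at x within B)) \<and>
                      (\<exists>l. (F \<longlongrightarrow> l) (at x within exterior B)))"

text \<open>Surface measure is two-dimensional Hausdorff measure, normalised to agree with area (a disc
  of diameter \<open>d\<close> has area \<open>\<pi> d\<^sup>2 / 4\<close>).  \<open>hausdorff2\<close> is a metric outer measure, hence countably
  additive on the Borel sets, so \<open>surface_measure\<close> takes the values of \<open>hausdorff2\<close> there.\<close>

definition hausdorff2_pre :: "real \<Rightarrow> (real^3) set \<Rightarrow> ennreal" where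
  "hausdorff2_pre e A =
     (INF C\<in>{C :: nat \<Rightarrow> (real^3) set. A \<subseteq> (\<Union>i. C i) \<and> (\<forall>i. bounded (C i) \<and> diameter (C i) \<le> e)}.
        \<Sum>i. ennreal (pi / 4 * (diameter (C i))\<^sup>2))"

definition hausdorff2 :: "(real^3) set \<Rightarrow> ennreal" where
  "hausdorff2 A = (SUP e\<in>{0<..}. hausdorff2_pre e A)"

definition surface_measure :: "(real^3) measure" where
  "surface_measure = measure_of UNIV (sets borel) hausdorff2"

definition mu_tilde :: "(real^3) set \<Rightarrow> real \<Rightarrow> real^3 \<Rightarrow> real" where
  "mu_tilde B \<mu>r x = (if x \<in> B then \<mu>r else 1)"

text \<open>Classical solutions of the transmission problem for \<open>\<theta>\<^sup>(\<^sup>1\<^sup>)\<close> with source \<open>\<theta>0\<close>.  The normal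
  component may jump across the boundary; the flux condition concerns the exterior trace (it
  excludes the exterior fields that are gradients of the capacitary potential).  For the interior
  trace the flux is already determined by the equation in \<open>B\<close>.\<close>

definition theta1_problem ::
  "(real^3) set \<Rightarrow> (real^3 \<Rightarrow> real^3) \<Rightarrow> real \<Rightarrow> real \<Rightarrow> vec_field \<Rightarrow> vec_field \<Rightarrow> bool" where
  "theta1_problem B n \<mu>r \<nu> \<theta>0 \<theta> \<longleftrightarrow>
     C2_on B \<theta> \<and> C2_on (exterior B) \<theta> \<and> has_traces B \<theta> \<and> has_traces B (curl \<theta>) \<and>
     (\<forall>x\<in>B. curl (\<lambda>y. inverse \<mu>r *\<^sub>R curl \<theta> y) x
              - (\<i> * complex_of_real \<nu>) *s (\<theta> x + \<theta>0 x) = 0) \<and>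
     (\<forall>x\<in>exterior B. divergence \<theta> x = 0 \<and> curl (curl \<theta>) x = 0) \<and>
     (\<forall>x\<in>frontier B. jump B (\<lambda>y. ccross (cvec (n x)) (\<theta> y)) x = 0) \<and>
     (\<forall>x\<in>frontier B.
        jump B (\<lambda>y. ccross (cvec (n x)) (inverse (mu_tilde B \<mu>r y) *\<^sub>R curl \<theta> y)) x = 0) \<and>
     (LINT x:frontier B|surface_measure. cdot (cvec (n x)) (trace_out B \<theta> x)) = 0 \<and>
     (\<lambda>x. norm (\<theta> x)) \<in> O[at_infinity](\<lambda>x. 1 / norm x)"

definition D_coeff ::
  "(real^3) set \<Rightarrow> real \<Rightarrow> real \<Rightarrow> (nat^3 \<Rightarrow> 3 \<Rightarrow> vec_field) \<Rightarrow> (nat^3 \<Rightarrow> 3 \<Rightarrow> vec_field) \<Rightarrow>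
     nat^3 \<Rightarrow> nat^3 \<Rightarrow> 3 \<Rightarrow> 3 \<Rightarrow> complex" where
  "D_coeff B \<nu> \<alpha> \<theta>0 \<theta>1 \<beta> \<delta> k j =
     - \<i> * complex_of_real \<nu> * complex_of_real (\<alpha> ^ (3 + mi_order \<beta> + mi_order \<delta>)) *
     cdot (cvec (axis k 1))
       (LINT x:B|lborel. ccross (cvec x) (monomial \<beta> x *\<^sub>R (\<theta>0 \<delta> j x + \<theta>1 \<delta> j x)))"

end

theory Submission
  imports Defs
begin

text \<open>For \<open>\<mu>\<^sub>r = 1\<close> write \<open>u, v\<close> for the two solutions and \<open>u0, v0\<close> for their real sources. In \<open>B\<close>
  the source can be eliminated, \<open>u0 = - u - (\<i>/\<nu>) curl curl u\<close>, and Green's identity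
  \<open>\<integral> curl a \<sqdot> curl b = \<integral>\<^sub>B a \<sqdot> curl curl b\<close>, applied to \<open>a, b\<close> among \<open>u, v\<close> and their conjugates, turns
  \<open>- \<integral>\<^sub>B u0 \<sqdot> curl curl v\<close> into \<open>P - (\<i>/\<nu>) Q\<close>, where \<open>P\<close> and \<open>Q\<close> are the integrals of the two
  bilinear expressions, and also into the same expression with \<open>P, Q\<close> conjugated. Hence \<open>P\<close> and \<open>Q\<close> are real.

  Green's identity is proved without surface integrals: the field \<open>a \<times> curl b\<close> is continuous up to
  \<open>\<partial>B\<close> from both sides with a continuous normal component, so that its distributional divergence has
  no singular part on \<open>\<partial>B\<close>; this is tested with cutoffs that vanish near \<open>\<partial>B\<close>. At infinity, decay
  \<open>O(1/|x|)\<close> of the fields suffices, because an energy estimate yields square integrability of the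
  curls.\<close>

subsection \<open>Partial derivatives and \<open>C1\<close> functions\<close>

text \<open>Only tangential components match across the boundary, and no decay of
  \<open>curl \<theta>\<close> is assumed; both facts shape the proof. The normal component of
  \<open>a \<times> curl b\<close> is a scalar triple product, which depends on tangential traces
  alone, so it is continuous although both factors may jump. At infinity the cutoff is a square: its
  gradient is at most a multiple of sqrt(cutoff) / (1 + |x|), so with the decay of \<open>a\<close>
  the truncation error is at most a multiple of sqrt(cutoff) |curl b| / (1 + |x|)^2. The energy
  absorbs sqrt(cutoff) |curl b|, and (1 + |x|)^-4 is integrable in dimension three. The two
  evaluations come from a symmetry: Green's identity without conjugates makes the integral of
  \<open>u0 \<sqdot> curl curl v\<close> symmetric in the two solutions. Hence either
  \<open>u0\<close> can be eliminated through the conjugate of \<open>u\<close>, or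
  \<open>v0\<close> through that of \<open>v\<close>; a conjugate field carries the same source
  because the sources are real. As \<i>/\<nu> is purely imaginary, equating the results separates
  \<open>P\<close> from \<open>Q\<close>.\<close>

lemma pd_has_derivative:
  assumes "(f has_derivative f') (at x)"
  shows "pd i f x = f' (axis i 1)"
  using frechet_derivative_at[OF assms] by (simp add: pd_def)

lemma pd_transform:
  assumes "open S" "x \<in> S" "\<And>y. y \<in> S \<Longrightarrow> f y = g y" "f differentiable at x"
  shows "g differentiable at x" "pd i g x = pd i f x"
proof -
  obtain f' where f': "(f has_derivative f') (at x)"
    using assms(4) by (auto simp: differentiable_def)
  then have "(g has_derivative f') (at x)"
    using assms has_derivative_transform_within_open by blast
  with f' show "g differentiable at x" "pd i g x = pd i f x"
    by (auto simp: differentiable_def pd_has_derivative)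
qed

lemma C1_onD:
  assumes "C1_on S f"
  shows "x \<in> S \<Longrightarrow> f differentiable at x" "continuous_on S (pd i f)" "continuous_on S f"
  using assms by (auto simp: C1_on_def intro!: continuous_at_imp_continuous_on
      differentiable_imp_continuous_within)

lemma C1_on_subset: "C1_on S f \<Longrightarrow> T \<subseteq> S \<Longrightarrow> C1_on T f"
  unfolding C1_on_def by (meson continuous_on_subset subsetD)

lemma C1_on_cong:
  assumes "open S" "C1_on S f" "\<And>x. x \<in> S \<Longrightarrow> f x = g x"
  shows "C1_on S g"
proof -
  have "continuous_on S (pd i g)" for i
    using C1_onD(2)[OF assms(2)] pd_transform(2)[OF assms(1) _ assms(3) C1_onD(1)[OF assms(2)]]
    by (metis (no_types, lifting) continuous_on_cong)
  moreover have "\<forall>x\<in>S. g differentiable at x"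
    using pd_transform(1)[OF assms(1) _ assms(3) C1_onD(1)[OF assms(2)]] by blast
  ultimately show ?thesis by (auto simp: C1_on_def)
qed

lemma C1_on_Un: "open S \<Longrightarrow> open T \<Longrightarrow> C1_on S f \<Longrightarrow> C1_on T f \<Longrightarrow> C1_on (S \<union> T) f"
  unfolding C1_on_def by (auto intro: continuous_on_open_Un)

lemma C1_on_pdI:
  assumes "\<And>x. x \<in> S \<Longrightarrow> (f has_derivative f' x) (at x)"
    and "\<And>i. continuous_on S (\<lambda>x. f' x (axis i 1))"
  shows "C1_on S f"
proof -
  have "continuous_on S (pd i f)" for i
    using assms(2)[of i] pd_has_derivative[OF assms(1)]
    by (metis (no_types, lifting) continuous_on_cong)
  then show ?thesis using assms(1) by (auto simp: C1_on_def differentiable_def)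
qed

lemma pd_const [simp]: "pd i (\<lambda>x. c) y = 0"
  by (rule pd_has_derivative[of _ "\<lambda>_. 0", THEN trans]) auto

lemma C1_on_const: "C1_on S (\<lambda>x. c)"
  by (rule C1_on_pdI[of _ _ "\<lambda>_ _. 0"]) auto

lemma C1_on_bounded_linear:
  assumes "bounded_linear f" shows "C1_on S f"
  by (rule C1_on_pdI[of _ _ "\<lambda>_. f"]) (auto intro: bounded_linear_imp_has_derivative assms)

lemma pd_works:
  assumes "f differentiable at x"
  shows "(f has_derivative frechet_derivative f (at x)) (at x)"
  using assms frechet_derivative_works by blast

lemma pd_add:
  assumes "f differentiable at x" "g differentiable at x"
  shows "pd i (\<lambda>x. f x + g x) x = pd i f x + pd i g x"
  by (rule trans[OF pd_has_derivative[OF has_derivative_add[OF assms[THEN pd_works]]]])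
    (simp add: pd_def)

lemma C1_on_add:
  assumes "C1_on S f" "C1_on S g" shows "C1_on S (\<lambda>x. f x + g x)"
  by (rule C1_on_pdI[OF has_derivative_add[OF C1_onD(1)[THEN pd_works] C1_onD(1)[THEN pd_works]]])
    (use assms in \<open>auto simp: C1_on_def pd_def[abs_def] intro!: continuous_intros\<close>)

lemma pd_bounded_linear:
  assumes "bounded_linear L" "f differentiable at x"
  shows "pd i (\<lambda>x. L (f x)) x = L (pd i f x)"
  by (rule trans[OF pd_has_derivative[OF bounded_linear.has_derivative[OF assms(1) pd_works[OF assms(2)]]]])
    (simp add: pd_def)

lemma C1_on_compose_bounded_linear:
  assumes "bounded_linear L" "C1_on S f" shows "C1_on S (\<lambda>x. L (f x))"
proof -
  interpret bounded_linear L by fact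
  show ?thesis
    by (rule C1_on_pdI[OF has_derivative[OF C1_onD(1)[THEN pd_works]]])
      (use assms in \<open>auto simp: C1_on_def pd_def[abs_def] intro!: continuous_on\<close>)
qed

lemma pd_scaleR:
  assumes "f differentiable at x" "g differentiable at x"
  shows "pd i (\<lambda>x. f x *\<^sub>R g x) x = f x *\<^sub>R pd i g x + pd i f x *\<^sub>R g x"
  by (rule trans[OF pd_has_derivative[OF has_derivative_scaleR[OF assms[THEN pd_works]]]])
    (simp add: pd_def)

lemma C1_on_scaleR:
  assumes "C1_on S f" "C1_on S g" shows "C1_on S (\<lambda>x. f x *\<^sub>R g x)"
  by (rule C1_on_pdI[OF has_derivative_scaleR[OF C1_onD(1)[THEN pd_works] C1_onD(1)[THEN pd_works]]])
    (use assms C1_onD(3)[OF assms(1)] C1_onD(3)[OF assms(2)] in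
      \<open>auto simp: C1_on_def pd_def[abs_def] intro!: continuous_intros\<close>)

lemma pd_mult:
  fixes f g :: "real^3 \<Rightarrow> 'a::real_normed_algebra"
  assumes "f differentiable at x" "g differentiable at x"
  shows "pd i (\<lambda>x. f x * g x) x = f x * pd i g x + pd i f x * g x"
  by (rule trans[OF pd_has_derivative[OF has_derivative_mult[OF assms[THEN pd_works]]]])
    (simp add: pd_def)

lemma C1_on_mult:
  fixes f g :: "real^3 \<Rightarrow> 'a::real_normed_algebra"
  assumes "C1_on S f" "C1_on S g" shows "C1_on S (\<lambda>x. f x * g x)"
  by (rule C1_on_pdI[OF has_derivative_mult[OF C1_onD(1)[THEN pd_works] C1_onD(1)[THEN pd_works]]])
    (use assms C1_onD(3)[OF assms(1)] C1_onD(3)[OF assms(2)] in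
      \<open>auto simp: C1_on_def pd_def[abs_def] intro!: continuous_intros\<close>)

lemma C1_on_minus: "C1_on S f \<Longrightarrow> C1_on S (\<lambda>x. - f x)"
  by (rule C1_on_compose_bounded_linear) (auto intro: bounded_linear_minus bounded_linear_ident)

lemma C1_on_diff: "C1_on S f \<Longrightarrow> C1_on S g \<Longrightarrow> C1_on S (\<lambda>x. f x - g x)"
  using C1_on_add[of S f "\<lambda>x. - g x"] by (simp add: C1_on_minus)

lemma pd_diff:
  assumes "f differentiable at x" "g differentiable at x"
  shows "pd i (\<lambda>x. f x - g x) x = pd i f x - pd i g x"
  by (rule trans[OF pd_has_derivative[OF has_derivative_diff[OF assms[THEN pd_works]]]])
    (simp add: pd_def)

lemma C1_on_sum:
  "(\<And>j. j \<in> A \<Longrightarrow> C1_on S (f j)) \<Longrightarrow> C1_on S (\<lambda>x. \<Sum>j\<in>A. f j x)"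
  by (induction A rule: infinite_finite_induct) (auto intro: C1_on_const C1_on_add)

lemma pd_component: "F differentiable at x \<Longrightarrow> pd i (\<lambda>y. F y $ j) x = pd i F x $ j"
  by (rule pd_bounded_linear) (rule bounded_linear_vec_nth)

lemma C1_on_component: "C1_on S F \<Longrightarrow> C1_on S (\<lambda>x. F x $ j)"
  by (rule C1_on_compose_bounded_linear[OF bounded_linear_vec_nth])

lemma pd_compose_real:
  fixes \<rho> :: "real^3 \<Rightarrow> real"
  assumes "(\<kappa> has_real_derivative d) (at (\<rho> x))" "\<rho> differentiable at x"
  shows "pd i (\<lambda>x. \<kappa> (\<rho> x)) x = d * pd i \<rho> x"
proof -
  have "((\<lambda>x. \<kappa> (\<rho> x)) has_derivative (\<lambda>h. d * frechet_derivative \<rho> (at x) h)) (at x)"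
    using diff_chain_at[OF pd_works[OF assms(2)], of \<kappa> "(*) d"] assms(1)
    by (simp add: has_field_derivative_def o_def)
  from pd_has_derivative[OF this] show ?thesis by (simp add: pd_def)
qed

lemma C1_on_compose_real:
  fixes \<rho> :: "real^3 \<Rightarrow> real"
  assumes "\<And>t. t \<in> T \<Longrightarrow> (\<kappa> has_real_derivative \<kappa>' t) (at t)" "continuous_on T \<kappa>'" "C1_on S \<rho>"
    "\<rho> ` S \<subseteq> T"
  shows "C1_on S (\<lambda>x. \<kappa> (\<rho> x))"
proof (rule C1_on_pdI)
  fix x assume "x \<in> S"
  then show "((\<lambda>x. \<kappa> (\<rho> x)) has_derivative (\<lambda>h. \<kappa>' (\<rho> x) * frechet_derivative \<rho> (at x) h)) (at x)"
    using diff_chain_at[OF pd_works[OF C1_onD(1)[OF assms(3)]], of x \<kappa> "(*) (\<kappa>' (\<rho> x))"] assms(1,4)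
    by (auto simp: has_field_derivative_def o_def)
next
  show "continuous_on S (\<lambda>x. \<kappa>' (\<rho> x) * frechet_derivative \<rho> (at x) (axis i 1))" for i
    using assms C1_onD(2,3)[OF assms(3)]
    by (auto intro!: continuous_intros continuous_on_compose2[OF assms(2)] simp flip: pd_def)
qed

text \<open>Stone-Weierstrass will replace a density that is only continuous by a polynomial; this
  makes the replacement available for integration by parts.\<close>

lemma C1_on_polynomial_function:
  fixes P :: "real^3 \<Rightarrow> 'a::euclidean_space"
  assumes "polynomial_function P"
  shows "C1_on S P"
proof -
  have real: "C1_on S p" if "real_polynomial_function p" for p :: "real^3 \<Rightarrow> real"
    using that
    by induction (auto intro: C1_on_bounded_linear C1_on_const C1_on_add C1_on_mult)
  have "C1_on S (\<lambda>x. P x \<bullet> b)" for b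
    using assms bounded_linear_inner_left unfolding polynomial_function_def
    by (intro real) (auto simp: o_def)
  then have "C1_on S (\<lambda>x. \<Sum>b\<in>Basis. (P x \<bullet> b) *\<^sub>R b)"
    by (intro C1_on_sum C1_on_scaleR C1_on_const)
  then show ?thesis by (simp add: euclidean_representation)
qed

text \<open>\<open>U\<close> and the complement of \<open>K\<close> are open and cover the space,
  and the extension is C1 on each of them.\<close>

lemma C1_on_extend_zero:
  assumes "open U" "compact K" "K \<subseteq> U" "C1_on U f" "\<And>x. x \<in> U - K \<Longrightarrow> f x = 0"
  shows "C1_on UNIV (\<lambda>x. if x \<in> U then f x else 0)"
proof -
  let ?g = "\<lambda>x. if x \<in> U then f x else 0"
  have "C1_on U ?g" by (rule C1_on_cong[OF assms(1,4)]) auto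
  moreover have "C1_on (- K) ?g"
    by (rule C1_on_cong[OF _ C1_on_const[of _ 0]])
      (use assms compact_imp_closed in \<open>auto simp: open_Compl\<close>)
  ultimately have "C1_on (U \<union> - K) ?g"
    using assms compact_imp_closed by (intro C1_on_Un) (auto simp: open_Compl)
  moreover have "U \<union> - K = UNIV" using assms(3) by auto
  ultimately show ?thesis by simp
qed

subsection \<open>Integrals of partial derivatives of compactly supported functions\<close>

lemma bounded_on_compact_continuous:
  assumes "compact K" "continuous_on K f"
  obtains M where "\<And>x. x \<in> K \<Longrightarrow> norm (f x) \<le> M" "M \<ge> (0::real)"
proof -
  obtain M where "M > 0" "\<forall>y\<in>f ` K. norm y \<le> M"
    using compact_imp_bounded[OF compact_continuous_image[OF assms(2,1)]] bounded_pos by metis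
  then show ?thesis by (intro that[of M]) auto
qed

lemma vector_differentiable_bound_le:
  fixes g :: "real \<Rightarrow> 'a::real_normed_vector"
  assumes "\<And>s. (g has_vector_derivative g' s) (at s)" "\<And>s. norm (g' s) \<le> M"
  shows "norm (g b - g a) \<le> norm (b - a) * M"
proof -
  have "norm (g b - g a) \<le> M * norm (b - a)"
    by (rule differentiable_bound[of UNIV g "\<lambda>s h. h *\<^sub>R g' s"])
      (use assms in \<open>auto simp: has_vector_derivative_def intro!: onorm_le mult_left_mono
         simp: mult.commute[of M]\<close>)
  then show ?thesis by (simp add: mult.commute)
qed

text \<open>Mean value inequality along a coordinate line; it bounds difference quotients uniformly
  in the step.\<close>

lemma norm_line_diff_le:
  assumes "C1_on UNIV f" "\<And>x. norm (pd i f x) \<le> M" "t \<ge> 0"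
  shows "norm (f (x + t *\<^sub>R axis i 1) - f x) \<le> M * t"
proof -
  let ?g = "\<lambda>s. f (x + s *\<^sub>R axis i 1)"
  have "(?g has_derivative (\<lambda>h. frechet_derivative f (at (x + s *\<^sub>R axis i 1)) (h *\<^sub>R axis i 1))) (at s)" for s
    by (rule diff_chain_at[of "\<lambda>s. x + s *\<^sub>R axis i 1" _ s f, unfolded o_def])
      (auto intro!: derivative_eq_intros pd_works C1_onD(1)[OF assms(1)])
  moreover have "frechet_derivative f (at y) (h *\<^sub>R axis i 1) = h *\<^sub>R pd i f y" for h y
    using linear_scale[OF linear_frechet_derivative[OF C1_onD(1)[OF assms(1)]]] by (simp add: pd_def)
  ultimately have "(?g has_vector_derivative pd i f (x + s *\<^sub>R axis i 1)) (at s)" for s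
    by (simp add: has_vector_derivative_def)
  then have "norm (?g t - ?g 0) \<le> norm (t - 0) * M"
    by (intro vector_differentiable_bound_le) (use assms in auto)
  then show ?thesis using assms(3) by (simp add: mult.commute)
qed

lemma lborel_integral_translate:
  fixes f :: "'a::euclidean_space \<Rightarrow> 'b::{banach, second_countable_topology}"
  assumes "f \<in> borel_measurable borel"
  shows "(LINT x|lborel. f (x + a)) = (LINT x|lborel. f x)"
    "integrable lborel f \<Longrightarrow> integrable lborel (\<lambda>x. f (x + a))"
proof -
  have "integral\<^sup>L (distr lborel borel ((+) a)) f = (LINT x|lborel. f (a + x))"
    by (rule integral_distr) (use assms in auto)
  then show "(LINT x|lborel. f (x + a)) = (LINT x|lborel. f x)"
    by (simp add: lborel_distr_plus add.commute)
  show "integrable lborel (\<lambda>x. f (x + a))" if "integrable lborel f"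
    using integrable_distr_eq[of "(+) a" lborel borel f] that assms
    by (simp add: lborel_distr_plus add.commute)
qed

lemma scale_norm_divide:
  fixes y d :: "'a::real_normed_vector"
  assumes "h \<noteq> 0"
  shows "norm (y - h *\<^sub>R d) / \<bar>h\<bar> = norm (y /\<^sub>R h - d)"
proof -
  have "y /\<^sub>R h - d = inverse h *\<^sub>R (y - h *\<^sub>R d)"
    using assms by (simp add: scaleR_diff_right)
  then show ?thesis by (simp add: divide_inverse mult.commute)
qed

text \<open>By translation invariance the difference quotients have integral zero; dominated convergence
  transfers this to the partial derivative without Fubini.\<close>

lemma integral_pd_compact_support:
  fixes f :: "real^3 \<Rightarrow> 'a::{banach, second_countable_topology}"
  assumes f: "C1_on UNIV f" and K: "compact K" "\<And>x. x \<notin> K \<Longrightarrow> f x = 0"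
  shows "has_bochner_integral lborel (pd i f) 0"
proof -
  have pd0: "pd i f x = 0" if "x \<notin> K" for x
    using pd_transform(2)[of "- K" x "\<lambda>_. 0" f i] K that compact_imp_closed
    by (auto simp: open_Compl)
  obtain M where M: "\<And>x. x \<in> K \<Longrightarrow> norm (pd i f x) \<le> M" "M \<ge> 0"
    using bounded_on_compact_continuous[OF K(1) continuous_on_subset[OF C1_onD(2)[OF f, of i]]]
    by (metis top_greatest)
  have M': "norm (pd i f x) \<le> M" for x using M pd0[of x] by (cases "x \<in> K") auto
  obtain C where C: "\<And>x. x \<in> K \<Longrightarrow> norm x \<le> C" "C > 0"
    using compact_imp_bounded[OF K(1)] bounded_pos by metis
  define e :: "real^3" where "e = axis i 1"
  define s where "s n x = real (Suc n) *\<^sub>R (f (x + (1 / real (Suc n)) *\<^sub>R e) - f x)" for n x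
  have [measurable]: "f \<in> borel_measurable borel" "pd i f \<in> borel_measurable borel"
    using C1_onD(2,3)[OF f] by (auto intro: borel_measurable_continuous_onI)
  have "indicator K x *\<^sub>R f x = f x" for x using K(2)[of x] by (cases "x \<in> K") auto
  then have fint: "integrable lborel f"
    using borel_integrable_compact[OF K(1) continuous_on_subset[OF C1_onD(3)[OF f]]] by simp
  have lim: "(\<lambda>n. s n x) \<longlonglongrightarrow> pd i f x" for x
  proof -
    have D: "(f has_derivative frechet_derivative f (at x)) (at x)"
      by (intro pd_works C1_onD(1)[OF f]) auto
    have "((\<lambda>t. f (x + t *\<^sub>R e)) has_derivative (\<lambda>h. frechet_derivative f (at (x + 0 *\<^sub>R e)) (h *\<^sub>R e))) (at 0)"
      by (rule diff_chain_at[of "\<lambda>s. x + s *\<^sub>R e" _ 0 f, unfolded o_def])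
        (use D in \<open>auto intro!: derivative_eq_intros\<close>)
    then have *: "((\<lambda>t. f (x + t *\<^sub>R e)) has_vector_derivative pd i f x) (at 0)"
      using linear_scale[OF linear_frechet_derivative[OF C1_onD(1)[OF f]]]
      by (simp add: pd_def has_vector_derivative_def e_def)
    have *: "((\<lambda>h. (f (x + h *\<^sub>R e) - f x) /\<^sub>R h) \<longlongrightarrow> pd i f x) (at 0)"
    proof -
      have "((\<lambda>h. norm (f (x + h *\<^sub>R e) - f x - h *\<^sub>R pd i f x) / norm h) \<longlongrightarrow> 0) (at 0)"
        using * by (simp add: has_vector_derivative_def has_derivative_at)
      moreover have "\<forall>\<^sub>F h in at 0. norm (f (x + h *\<^sub>R e) - f x - h *\<^sub>R pd i f x) / norm h =
          norm ((f (x + h *\<^sub>R e) - f x) /\<^sub>R h - pd i f x)"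
        by (auto simp: eventually_at_filter scale_norm_divide)
      ultimately have "((\<lambda>h. norm ((f (x + h *\<^sub>R e) - f x) /\<^sub>R h - pd i f x)) \<longlongrightarrow> 0) (at 0)"
        by (rule Lim_transform_eventually)
      then show ?thesis by (rule LIM_zero_cancel[OF tendsto_norm_zero_cancel])
    qed
    have "filterlim (\<lambda>n. 1 / real (Suc n)) (at 0) sequentially"
      by (intro filterlim_atI LIMSEQ_Suc[OF lim_1_over_n]) auto
    from filterlim_compose[OF * this] show ?thesis by (simp add: s_def)
  qed
  \<comment> \<open>The increments have length at most 1 and \<open>K\<close> lies within radius
    \<open>C\<close>, so all difference quotients vanish outside one ball of radius
    \<open>C + 1\<close>.\<close>
  have bound: "norm (s n x) \<le> indicator (cball 0 (C + 1)) x *\<^sub>R M" for n x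
  proof (cases "x \<in> cball 0 (C + 1)")
    case True
    have "norm (s n x) \<le> real (Suc n) * (M * (1 / real (Suc n)))"
      using norm_line_diff_le[OF f M', of "1 / real (Suc n)" x]
      by (simp add: s_def e_def mult_left_mono del: of_nat_Suc)
        (metis mult.commute pos_le_divide_eq of_nat_0_less_iff zero_less_Suc)
    with True show ?thesis by simp
  next
    case False
    have "norm x \<le> norm (x + (1 / real (Suc n)) *\<^sub>R e) + norm ((1 / real (Suc n)) *\<^sub>R e)"
      using norm_triangle_ineq4[of "x + (1 / real (Suc n)) *\<^sub>R e" "(1 / real (Suc n)) *\<^sub>R e"] by simp
    also have "norm ((1 / real (Suc n)) *\<^sub>R e) \<le> 1" by (simp add: e_def)
    finally have "x \<notin> K" "x + (1 / real (Suc n)) *\<^sub>R e \<notin> K" using C(1) False by force+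
    then show ?thesis using K(2) M(2) by (simp add: s_def)
  qed
  have wint: "integrable lborel (\<lambda>x. indicator (cball (0::real^3) (C + 1)) x *\<^sub>R M)"
    by (rule borel_integrable_compact) auto
  have meas: "s n \<in> borel_measurable lborel" for n unfolding s_def by measurable
  have "integral\<^sup>L lborel (s n) = 0" for n
    unfolding s_def using fint lborel_integral_translate[of f] by simp
  moreover have "(\<lambda>n. integral\<^sup>L lborel (s n)) \<longlonglongrightarrow> integral\<^sup>L lborel (pd i f)"
    by (rule integral_dominated_convergence[where s = s, OF _ meas wint]) (use lim bound in auto)
  ultimately have "integral\<^sup>L lborel (pd i f) = 0" by (simp add: LIMSEQ_const_iff)
  moreover have "integrable lborel (pd i f)"
    by (rule integrable_dominated_convergence[where s = s, OF _ meas wint]) (use lim bound in auto)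
  ultimately show ?thesis by (simp add: has_bochner_integral_iff)
qed

text \<open>Extension by zero transfers the result to functions that are C1 only on a neighbourhood
  of \<open>K\<close>.\<close>

lemma integral_pd_compact_support_on:
  fixes f :: "real^3 \<Rightarrow> 'a::{banach, second_countable_topology}"
  assumes "open U" "compact K" "K \<subseteq> U" "C1_on U f" "\<And>x. x \<in> U - K \<Longrightarrow> f x = 0"
  shows "set_integrable lborel K (pd i f)" "(LINT x:K|lborel. pd i f x) = 0"
proof -
  let ?g = "\<lambda>x. if x \<in> U then f x else 0"
  have pdU: "pd i ?g x = pd i f x" if "x \<in> U" for x
    by (rule pd_transform(2)[OF assms(1) that _ C1_onD(1)[OF assms(4) that]]) auto
  have pd0: "pd i ?g x = 0" if "x \<notin> K" for x
    using pd_transform(2)[of "- K" x "\<lambda>_. 0" ?g i] assms that compact_imp_closed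
    by (force simp: open_Compl)
  have "pd i ?g x = indicator K x *\<^sub>R pd i f x" for x
    using pdU[of x] pd0[of x] assms(3) by (cases "x \<in> K") auto
  then have "has_bochner_integral lborel (\<lambda>x. indicator K x *\<^sub>R pd i f x) 0"
    using integral_pd_compact_support[OF C1_on_extend_zero[OF assms], of K i] assms(2,5)
    by (auto cong: has_bochner_integral_cong)
  then show "set_integrable lborel K (pd i f)" "(LINT x:K|lborel. pd i f x) = 0"
    by (auto simp: has_bochner_integral_iff set_integrable_def set_lebesgue_integral_def)
qed

subsection \<open>Cutoff functions\<close>

text \<open>Squaring smooths the corner of the positive part. Test functions are only C1, and all
  cutoffs are built from this square.\<close>

lemma DERIV_max_sq: "((\<lambda>t. (max 0 t)\<^sup>2) has_real_derivative 2 * max 0 t) (at t)"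
proof (cases t "0::real" rule: linorder_cases)
  case less
  have "((\<lambda>t. 0) has_real_derivative 2 * max 0 t) (at t)" using less by simp
  then show ?thesis
    by (rule has_field_derivative_transform_within_open[of _ _ _ "{..<0}"]) (use less in auto)
next
  case equal
  have "((\<lambda>y::real. max 0 y) \<longlongrightarrow> 0) (at 0)"
    by (rule tendsto_eq_intros refl)+ auto
  then have "((\<lambda>y::real. ((max 0 y)\<^sup>2 - (max 0 0)\<^sup>2) / (y - 0)) \<longlongrightarrow> 0) (at 0)"
    by (rule Lim_transform_eventually)
      (auto simp: eventually_at_filter max_def power2_eq_square)
  with equal show ?thesis by (simp add: has_field_derivative_iff)
next
  case greater
  have "((\<lambda>t. t\<^sup>2) has_real_derivative 2 * max 0 t) (at t)"
    using greater by (auto intro!: derivative_eq_intros)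
  then show ?thesis
    by (rule has_field_derivative_transform_within_open[of _ _ _ "{0<..}"]) (use greater in auto)
qed

text \<open>The profile s^2 / (1 + s^2) in s = max 0 (t - 1): C1, zero up to 1, nondecreasing with
  limit 1. With argument \<open>n * t\<close> it vanishes while n t \<le> 1 and converges to 1 for
  every fixed t > 0.\<close>

definition ramp :: "real \<Rightarrow> real" where
  "ramp t = (max 0 (t - 1))\<^sup>2 / (1 + (max 0 (t - 1))\<^sup>2)"

definition ramp' :: "real \<Rightarrow> real" where
  "ramp' t = 2 * max 0 (t - 1) / (1 + (max 0 (t - 1))\<^sup>2)\<^sup>2"

lemma ramp_bounds: "0 \<le> ramp t" "ramp t \<le> 1" "t \<le> 1 \<Longrightarrow> ramp t = 0"
  by (auto simp: ramp_def divide_simps add_nonneg_nonneg)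
    (smt (verit) zero_le_power2)+

lemma ramp'_nonneg: "0 \<le> ramp' t" and ramp'_eq_0: "t \<le> 1 \<Longrightarrow> ramp' t = 0"
  by (auto simp: ramp'_def)

lemma DERIV_ramp: "(ramp has_real_derivative ramp' t) (at t)"
proof -
  have *: "((\<lambda>t. (max 0 (t - 1))\<^sup>2) has_real_derivative 2 * max 0 (t - 1)) (at t)"
    using DERIV_chain2[OF DERIV_max_sq DERIV_diff[OF DERIV_ident DERIV_const]] by simp
  have "1 + (max 0 (t - 1))\<^sup>2 \<noteq> 0" by (smt (verit) zero_le_power2)
  then show ?thesis
    unfolding ramp_def[abs_def] ramp'_def
    by (intro DERIV_cong[OF DERIV_divide[OF * DERIV_add[OF DERIV_const *]]])
      (auto simp: power2_eq_square field_simps)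
qed

lemma continuous_on_ramp': "continuous_on S ramp'"
proof -
  have "1 + (max 0 (t - 1))\<^sup>2 \<noteq> 0" for t :: real by (smt (verit) zero_le_power2)
  then show ?thesis unfolding ramp'_def[abs_def] by (auto intro!: continuous_intros)
qed

lemma tendsto_ramp:
  assumes "t > 0" shows "(\<lambda>n. ramp (real n * t)) \<longlonglongrightarrow> 1"
proof -
  have "((\<lambda>t::real. (t - 1)\<^sup>2 / (1 + (t - 1)\<^sup>2)) \<longlongrightarrow> 1) at_top" by real_asymp
  then have "(ramp \<longlongrightarrow> 1) at_top"
    by (rule Lim_transform_eventually)
      (auto simp: ramp_def intro!: eventually_mono[OF eventually_ge_at_top[of 1]])
  moreover have "filterlim (\<lambda>n. real n * t) at_top sequentially"
    using assms by (intro filterlim_at_top_mult_tendsto_pos[OF _ _ filterlim_real_sequentially]) auto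
  ultimately show ?thesis by (rule filterlim_compose)
qed

text \<open>For r > 0 it is positive exactly on the open ball, and the outer square makes it C1. It
  is left unnormalised because the partition of unity divides by the sum of the bumps.\<close>

definition bump :: "real^3 \<Rightarrow> real \<Rightarrow> real^3 \<Rightarrow> real" where
  "bump p r x = (max 0 (r\<^sup>2 - (x - p) \<bullet> (x - p)))\<^sup>2"

lemma C1_on_bump_inner: "C1_on S (\<lambda>x. r\<^sup>2 - (x - p) \<bullet> (x - p))"
  and pd_bump_inner: "pd i (\<lambda>x. r\<^sup>2 - (x - p) \<bullet> (x - p)) x = - 2 * (x - p) $ i"
proof -
  have *: "((\<lambda>x. r\<^sup>2 - (x - p) \<bullet> (x - p)) has_derivative (\<lambda>h. - 2 * ((x - p) \<bullet> h))) (at x)" for x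
    by (auto intro!: derivative_eq_intros simp: inner_commute algebra_simps)
  show "C1_on S (\<lambda>x. r\<^sup>2 - (x - p) \<bullet> (x - p))"
    by (rule C1_on_pdI[OF *]) (auto intro!: continuous_intros)
  show "pd i (\<lambda>x. r\<^sup>2 - (x - p) \<bullet> (x - p)) x = - 2 * (x - p) $ i"
    by (subst pd_has_derivative[OF *]) (simp add: inner_axis algebra_simps)
qed

lemma C1_on_bump: "C1_on S (bump p r)"
  unfolding bump_def[abs_def]
  by (rule C1_on_compose_real[of UNIV _ "\<lambda>t. 2 * max 0 t"])
    (auto intro!: DERIV_max_sq C1_on_bump_inner continuous_intros)

lemma pd_bump: "pd i (bump p r) x = - 4 * max 0 (r\<^sup>2 - (x - p) \<bullet> (x - p)) * (x - p) $ i"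
proof -
  have "pd i (bump p r) x = 2 * max 0 (r\<^sup>2 - (x - p) \<bullet> (x - p)) * (- 2 * (x - p) $ i)"
    unfolding bump_def[abs_def] pd_bump_inner[where i = i and p = p and r = r and x = x, symmetric]
    by (rule pd_compose_real[OF DERIV_max_sq C1_onD(1)[OF C1_on_bump_inner UNIV_I]])
  then show ?thesis by algebra
qed

lemma bump_nonneg: "0 \<le> bump p r x"
  by (simp add: bump_def)

lemma bump_pos_iff: "r > 0 \<Longrightarrow> bump p r x > 0 \<longleftrightarrow> x \<in> ball p r"
  using abs_le_square_iff[of r "norm (x - p)"]
  by (auto simp: bump_def dist_norm norm_minus_commute max_def simp flip: power2_norm_eq_inner)

lemma bump_eq_0: "r > 0 \<Longrightarrow> x \<notin> ball p r \<Longrightarrow> bump p r x = 0"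
  using bump_pos_iff[of r p x] bump_nonneg[of p r x] by linarith

subsection \<open>Divergence across a \<open>C1\<close> interface\<close>

lemma set_integrable_compact:
  fixes f :: "real^3 \<Rightarrow> 'a::{banach, second_countable_topology}"
  assumes "compact K" "continuous_on K f"
  shows "set_integrable lborel K f"
  using borel_integrable_compact[OF assms] by (simp add: set_integrable_def)

text \<open>The bound does not depend on \<open>\<kappa>'\<close>: a monotone profile across the level sets of \<open>\<rho>\<close> has
  bounded total variation however steep it is.\<close>

lemma integral_monotone_profile_le:
  assumes U: "open U" "compact K" "K \<subseteq> U"
    and \<rho>: "C1_on U \<rho>"
    and b: "C1_on U b" "\<And>x. x \<in> U - K \<Longrightarrow> b x = 0"
    and \<kappa>: "\<And>t. (\<kappa> has_real_derivative \<kappa>' t) (at t)" "continuous_on UNIV \<kappa>'" "\<And>t. \<bar>\<kappa> t\<bar> \<le> M"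
  shows "set_integrable lborel K (\<lambda>x. b x * (\<kappa>' (\<rho> x) * pd i \<rho> x))"
    "(LINT x:K|lborel. b x * (\<kappa>' (\<rho> x) * pd i \<rho> x)) \<le> M * (LINT x:K|lborel. \<bar>pd i b x\<bar>)"
proof -
  have \<kappa>\<rho>: "C1_on U (\<lambda>x. \<kappa> (\<rho> x))"
    by (rule C1_on_compose_real[OF \<kappa>(1,2) \<rho>]) auto
  have pd: "pd i (\<lambda>x. b x * \<kappa> (\<rho> x)) x = b x * (\<kappa>' (\<rho> x) * pd i \<rho> x) + pd i b x * \<kappa> (\<rho> x)"
    if "x \<in> K" for x
    using that U C1_onD(1)[OF b(1)] C1_onD(1)[OF \<kappa>\<rho>] C1_onD(1)[OF \<rho>]
    by (subst pd_mult) (auto simp: pd_compose_real[OF \<kappa>(1)])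
  note cont = C1_onD(2,3)[OF \<rho>, THEN continuous_on_subset, OF U(3)]
    C1_onD(2,3)[OF b(1), THEN continuous_on_subset, OF U(3)]
    C1_onD(3)[OF \<kappa>\<rho>, THEN continuous_on_subset, OF U(3)]
  have \<kappa>'\<rho>: "continuous_on K (\<lambda>x. \<kappa>' (\<rho> x))"
    by (rule continuous_on_compose2[OF \<kappa>(2) cont(2)]) auto
  show int1: "set_integrable lborel K (\<lambda>x. b x * (\<kappa>' (\<rho> x) * pd i \<rho> x))"
    by (intro set_integrable_compact U continuous_intros \<kappa>'\<rho> cont)
  have int2: "set_integrable lborel K (\<lambda>x. pd i b x * \<kappa> (\<rho> x))"
    by (intro set_integrable_compact U continuous_intros cont)
  have int3: "set_integrable lborel K (\<lambda>x. M * \<bar>pd i b x\<bar>)"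
    by (intro set_integrable_compact U continuous_intros cont)
  \<comment> \<open>The product of \<open>b\<close> and the profile vanishes off \<open>K\<close>,
    so its derivative has integral zero; this shifts the derivative from the steep profile to
    \<open>b\<close>.\<close>
  have "0 = (LINT x:K|lborel. pd i (\<lambda>x. b x * \<kappa> (\<rho> x)) x)"
    by (rule integral_pd_compact_support_on(2)[OF U C1_on_mult[OF b(1) \<kappa>\<rho>], symmetric])
      (use b(2) in auto)
  also have "\<dots> = (LINT x:K|lborel. b x * (\<kappa>' (\<rho> x) * pd i \<rho> x) + pd i b x * \<kappa> (\<rho> x))"
    by (intro set_lebesgue_integral_cong) (use U pd in \<open>auto simp: borel_compact\<close>)
  also have "\<dots> = (LINT x:K|lborel. b x * (\<kappa>' (\<rho> x) * pd i \<rho> x)) + (LINT x:K|lborel. pd i b x * \<kappa> (\<rho> x))"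
    by (rule set_integral_add(2)[OF int1 int2])
  finally have "(LINT x:K|lborel. b x * (\<kappa>' (\<rho> x) * pd i \<rho> x)) = - (LINT x:K|lborel. pd i b x * \<kappa> (\<rho> x))"
    by simp
  also have "\<dots> = (LINT x:K|lborel. - (pd i b x * \<kappa> (\<rho> x)))"
    by (simp add: set_lebesgue_integral_def)
  also have "\<dots> \<le> (LINT x:K|lborel. M * \<bar>pd i b x\<bar>)"
  proof (intro set_integral_mono int3)
    show "set_integrable lborel K (\<lambda>x. - (pd i b x * \<kappa> (\<rho> x)))"
      using int2 by (simp add: set_integrable_def)
    show "- (pd i b x * \<kappa> (\<rho> x)) \<le> M * \<bar>pd i b x\<bar>" for x
    proof -
      have "- (pd i b x * \<kappa> (\<rho> x)) \<le> \<bar>pd i b x\<bar> * \<bar>\<kappa> (\<rho> x)\<bar>"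
        by (metis abs_ge_minus_self abs_mult)
      also have "\<dots> \<le> M * \<bar>pd i b x\<bar>"
        using mult_left_mono[OF \<kappa>(3)[of "\<rho> x"], of "\<bar>pd i b x\<bar>"] by (simp add: mult.commute)
      finally show ?thesis .
    qed
  qed
  also have "\<dots> = M * (LINT x:K|lborel. \<bar>pd i b x\<bar>)" by simp
  finally show "(LINT x:K|lborel. b x * (\<kappa>' (\<rho> x) * pd i \<rho> x)) \<le> M * (LINT x:K|lborel. \<bar>pd i b x\<bar>)" .
qed

text \<open>With the profile \<open>arctan (m \<rho>)\<close> the density on the level set is \<open>m\<close> times a positive function,
  while the total variation stays bounded.\<close>

lemma level_set_null:
  fixes \<rho> :: "real^3 \<Rightarrow> real"
  assumes U: "open U" "cball p r \<subseteq> U" "r > 0"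
    and \<rho>: "C1_on U \<rho>" "\<And>x. x \<in> U \<Longrightarrow> pd i \<rho> x > 0"
  shows "{x \<in> ball p r. \<rho> x = 0} \<in> null_sets lborel"
proof -
  let ?b = "bump p r" and ?K = "cball p r"
  define Z where "Z = {x \<in> ball p r. \<rho> x = 0}"
  have "open (ball p r \<inter> U \<inter> \<rho> -` (- {0}))"
    using continuous_open_preimage[of "ball p r" \<rho> "- {0}"] U C1_onD(3)[OF \<rho>(1)]
    by (metis (no_types, lifting) Int_absorb2 ball_subset_cball continuous_on_subset
       dual_order.trans open_Compl open_ball closed_singleton)
  then have "ball p r - (ball p r \<inter> U \<inter> \<rho> -` (- {0})) \<in> sets borel" by auto
  moreover have "ball p r - (ball p r \<inter> U \<inter> \<rho> -` (- {0})) = Z"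
    using subsetD[OF U(2)] by (auto simp: Z_def less_imp_le)
  ultimately have Zm: "Z \<in> sets lborel" by simp
  have b: "C1_on U ?b" "\<And>x. x \<in> U - ?K \<Longrightarrow> ?b x = 0"
    using bump_eq_0[OF U(3)] by (auto simp: C1_on_bump)
  define A where "A = pi / 2 * (LINT x:?K|lborel. \<bar>pd i ?b x\<bar>)"
  define d where "d x = ?b x * pd i \<rho> x" for x
  have dpos: "d x > 0" if "x \<in> Z" for x
    using that subsetD[OF U(2), of x] \<rho>(2)[of x] bump_pos_iff[OF U(3), of p x] by (auto simp: d_def Z_def)
  have dnn: "d x \<ge> 0" if "x \<in> ?K" for x
    using that subsetD[OF U(2), of x] \<rho>(2)[of x] bump_nonneg[of p r x] by (auto simp: d_def intro!: mult_nonneg_nonneg)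
  have dK: "set_integrable lborel ?K d"
    unfolding d_def
    by (intro set_integrable_compact continuous_intros C1_onD(3)[OF C1_on_bump]
        continuous_on_subset[OF C1_onD(2)[OF \<rho>(1)]] U) auto
  have "set_integrable lborel Z d"
    by (rule set_integrable_subset[OF dK Zm]) (auto simp: Z_def)
  have bnd: "real (Suc n) * (LINT x:Z|lborel. d x) \<le> A" for n
  proof -
    let ?m = "real (Suc n)"
    let ?\<kappa>' = "\<lambda>t. ?m / (1 + (?m * t)\<^sup>2)"
    have \<kappa>: "((\<lambda>t. arctan (?m * t)) has_real_derivative ?\<kappa>' t) (at t)" for t
      by (auto intro!: derivative_eq_intros simp: divide_inverse)
    have "1 + (?m * t)\<^sup>2 \<noteq> 0" for t
      by (smt (verit) zero_le_power2)
    then have c: "continuous_on UNIV ?\<kappa>'" by (auto intro!: continuous_intros)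
    have a: "\<bar>arctan (?m * t)\<bar> \<le> pi / 2" for t
      using arctan_bounded[of "?m * t"] by linarith
    note I = integral_monotone_profile_le[OF U(1) compact_cball U(2) \<rho>(1) b \<kappa> c a, where i = i]
    \<comment> \<open>On \<open>Z\<close> the slope of arctan (m t) is taken at t = 0, where it
      equals m.\<close>
    have "?m * (LINT x:Z|lborel. d x) = (LINT x:Z|lborel. ?m * d x)" by simp
    also have "\<dots> = (LINT x:Z|lborel. ?b x * (?\<kappa>' (\<rho> x) * pd i \<rho> x))"
      by (intro set_lebesgue_integral_cong Zm) (auto simp: Z_def d_def)
    also have "\<dots> \<le> (LINT x:?K|lborel. ?b x * (?\<kappa>' (\<rho> x) * pd i \<rho> x))"
      unfolding set_lebesgue_integral_def
    proof (rule integral_mono)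
      have nn: "0 \<le> ?b x * (?\<kappa>' (\<rho> x) * pd i \<rho> x)" if "x \<in> ?K" for x
        using that subsetD[OF U(2), of x] \<rho>(2)[of x] bump_nonneg
        by (intro mult_nonneg_nonneg) (auto intro!: less_imp_le add_nonneg_nonneg)
      show "indicator Z x *\<^sub>R (?b x * (?\<kappa>' (\<rho> x) * pd i \<rho> x))
          \<le> indicator ?K x *\<^sub>R (?b x * (?\<kappa>' (\<rho> x) * pd i \<rho> x))" for x
        using nn[of x] by (auto simp: Z_def indicator_def)
      show "integrable lborel (\<lambda>x. indicator ?K x *\<^sub>R (?b x * (?\<kappa>' (\<rho> x) * pd i \<rho> x)))"
        using I(1) by (simp add: set_integrable_def)
      have "set_integrable lborel Z (\<lambda>x. ?b x * (?\<kappa>' (\<rho> x) * pd i \<rho> x))"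
        by (rule set_integrable_subset[OF I(1) Zm]) (auto simp: Z_def)
      then show "integrable lborel (\<lambda>x. indicator Z x *\<^sub>R (?b x * (?\<kappa>' (\<rho> x) * pd i \<rho> x)))"
        by (simp add: set_integrable_def)
    qed
    also have "\<dots> \<le> A" unfolding A_def by (rule I(2))
    finally show ?thesis .
  qed
  have "(LINT x:Z|lborel. d x) \<le> 0"
  proof (rule ccontr)
    assume "\<not> ?thesis"
    then obtain n where "real n * (LINT x:Z|lborel. d x) > A"
      using reals_Archimedean3[of "LINT x:Z|lborel. d x"] by (auto simp: not_le)
    with bnd[of n] \<open>\<not> _\<close> show False by (simp add: algebra_simps not_le)
  qed
  moreover have "(LINT x:Z|lborel. d x) \<ge> 0"
    unfolding set_lebesgue_integral_def
    by (intro integral_nonneg_AE AE_I2) (use dpos less_imp_le in \<open>auto simp: indicator_def\<close>)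
  ultimately have "(LINT x|lborel. indicator Z x *\<^sub>R d x) = 0"
    by (simp add: set_lebesgue_integral_def)
  then have "AE x in lborel. indicator Z x *\<^sub>R d x = 0"
    using \<open>set_integrable lborel Z d\<close> dpos less_imp_le
    by (subst (asm) integral_nonneg_eq_0_iff_AE)
       (auto simp: set_integrable_def indicator_def)
  then have "AE x in lborel. x \<notin> Z"
    by eventually_elim (metis dpos indicator_simps(1) less_irrefl scaleR_one)
  with Zm show ?thesis unfolding Z_def[symmetric]
    by (simp add: AE_iff_null_sets)
qed

lemma tendsto_set_integral_dominated:
  fixes s :: "nat \<Rightarrow> real^3 \<Rightarrow> 'a::{banach, second_countable_topology}"
  assumes "\<And>n. set_integrable lborel K (s n)" "compact K" "set_borel_measurable lborel K f"
    and "\<And>n x. x \<in> K \<Longrightarrow> norm (s n x) \<le> C"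
    and "AE x in lborel. x \<in> K \<longrightarrow> (\<lambda>n. s n x) \<longlonglongrightarrow> f x"
  shows "set_integrable lborel K f" "(\<lambda>n. LINT x:K|lborel. s n x) \<longlonglongrightarrow> (LINT x:K|lborel. f x)"
proof -
  have w: "integrable lborel (\<lambda>x. indicator K x *\<^sub>R C)"
    by (rule borel_integrable_compact) (use assms in auto)
  have m: "(\<lambda>x. indicator K x *\<^sub>R s n x) \<in> borel_measurable lborel" for n
    using assms(1)[of n] by (simp add: set_integrable_def borel_measurable_integrable)
  have f: "(\<lambda>x. indicator K x *\<^sub>R f x) \<in> borel_measurable lborel"
    using assms(3) by (simp add: set_borel_measurable_def)
  have bd: "AE x in lborel. norm (indicator K x *\<^sub>R s n x) \<le> indicator K x *\<^sub>R C" for n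
    using assms(4) by (auto simp: indicator_def)
  have lim: "AE x in lborel. (\<lambda>n. indicator K x *\<^sub>R s n x) \<longlonglongrightarrow> indicator K x *\<^sub>R f x"
    using assms(5) by eventually_elim (auto simp: indicator_def)
  show "set_integrable lborel K f"
    unfolding set_integrable_def
    by (rule integrable_dominated_convergence[where s = "\<lambda>n x. indicator K x *\<^sub>R s n x", OF f m w lim bd])
  show "(\<lambda>n. LINT x:K|lborel. s n x) \<longlonglongrightarrow> (LINT x:K|lborel. f x)"
    unfolding set_lebesgue_integral_def
    by (rule integral_dominated_convergence[where s = "\<lambda>n x. indicator K x *\<^sub>R s n x", OF f m w lim bd])
qed

text \<open>Stated with one scalar derivative per component, the form in which the integral of each
  summand is known to vanish.\<close>

lemma divergence_scaleR:
  assumes "\<phi> differentiable at x" "F differentiable at x"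
  shows "(\<Sum>j\<in>UNIV. pd j (\<lambda>y. \<phi> y *\<^sub>R F y $ j) x) =
    \<phi> x *\<^sub>R divergence F x + (\<Sum>j\<in>UNIV. pd j \<phi> x *\<^sub>R F x $ j)"
proof -
  have "(\<lambda>y. F y $ j) differentiable at x" for j
    using assms(2) bounded_linear.has_derivative[OF bounded_linear_vec_nth]
    unfolding differentiable_def by blast
  then show ?thesis
    using assms by (simp add: pd_scaleR pd_component sum.distrib divergence_def scaleR_sum_right)
qed

text \<open>The field is multiplied by a cutoff vanishing near the interface. Differentiating the cutoff
  leaves a layer term; its density is odd in \<open>\<rho>\<close>, so in the limit it only sees the jump of the
  normal component, and \<open>H\<close> has none.\<close>

lemma integral_divergence_interface_local:
  fixes F :: vec_field and H :: "real^3 \<Rightarrow> complex"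
  assumes U: "open U" "compact K" "K \<subseteq> U"
    and \<rho>: "C1_on U \<rho>" "\<And>x. x \<in> U \<Longrightarrow> pd i \<rho> x > 0" "{x\<in>K. \<rho> x = 0} \<in> null_sets lborel"
    and b: "C1_on U b" "\<And>x. x \<in> U \<Longrightarrow> b x \<ge> 0" "\<And>x. x \<in> U - K \<Longrightarrow> b x = 0"
    and \<phi>: "C1_on U \<phi>" "\<And>x. x \<in> U \<Longrightarrow> \<bar>\<phi> x\<bar> \<le> b x"
    and F: "C1_on {x\<in>U. \<rho> x \<noteq> 0} F"
      "\<And>x. x \<in> K \<Longrightarrow> \<rho> x \<noteq> 0 \<Longrightarrow> norm (F x) \<le> M \<and> norm (divergence F x) \<le> M"
    and H: "continuous_on U H"
      "\<And>x. x \<in> U \<Longrightarrow> \<rho> x \<noteq> 0 \<Longrightarrow> (\<Sum>j\<in>UNIV. pd j \<rho> x *\<^sub>R F x $ j) = H x"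
  defines "w \<equiv> \<lambda>x. \<phi> x *\<^sub>R divergence F x + (\<Sum>j\<in>UNIV. pd j \<phi> x *\<^sub>R F x $ j)"
  shows "set_integrable lborel {x\<in>K. \<rho> x \<noteq> 0} w" "(LINT x:{x\<in>K. \<rho> x \<noteq> 0}|lborel. w x) = 0"
proof -
  define V where "V = {x\<in>U. \<rho> x \<noteq> 0}"
  have "V = U \<inter> \<rho> -` (- {0})" by (auto simp: V_def)
  then have V: "open V"
    using continuous_open_preimage[OF C1_onD(3)[OF \<rho>(1)] U(1), of "- {0}"] by auto
  have VU: "V \<subseteq> U" by (auto simp: V_def)
  have KV: "{x\<in>K. \<rho> x \<noteq> 0} = K \<inter> V" using U by (auto simp: V_def)
  have Kb: "K \<in> sets borel" using U(2) by (rule borel_compact)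
  have KU: "continuous_on U f \<Longrightarrow> continuous_on K f" for f :: "real^3 \<Rightarrow> 'z::topological_space"
    using U(3) continuous_on_subset by blast
  have iK: "continuous_on K f \<Longrightarrow> set_integrable lborel K f" for f :: "real^3 \<Rightarrow> complex"
    using set_integrable_compact U(2) by blast
  have iK': "continuous_on K f \<Longrightarrow> set_integrable lborel K f" for f :: "real^3 \<Rightarrow> real"
    using set_integrable_compact U(2) by blast
  have FV: "C1_on V F" using F(1) by (simp add: V_def)
  have M: "norm (F x) \<le> M" "norm (divergence F x) \<le> M" if "x \<in> K \<inter> V" for x
    using F(2)[of x] that by (auto simp: V_def)

  \<comment> \<open>\<open>h n\<close> is the even cutoff, zero for |n t| \<le> 1 and tending to 1
    off zero; \<open>\<kappa> n\<close> is its odd monotone companion. Since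
    \<open>\<kappa>' n\<close> dominates the absolute value of \<open>h' n\<close>, the variation
    bound for monotone profiles will control the layer term.\<close>
  define \<kappa> where "\<kappa> n t = ramp (real n * t) - ramp (- real n * t)" for n t
  define \<kappa>' where "\<kappa>' n t = real n * ramp' (real n * t) + real n * ramp' (- real n * t)" for n t
  define h where "h n t = ramp (real n * t) + ramp (- real n * t)" for n t
  define h' where "h' n t = real n * ramp' (real n * t) - real n * ramp' (- real n * t)" for n t
  have R: "((\<lambda>t. ramp (c * t)) has_real_derivative c * ramp' (c * t)) (at t)" for c t
    using DERIV_chain2[OF DERIV_ramp DERIV_cmult[OF DERIV_ident], of c t] by (simp add: mult.commute)
  have \<kappa>: "(\<kappa> n has_real_derivative \<kappa>' n t) (at t)" for n t
    unfolding \<kappa>_def[abs_def] \<kappa>'_def by (rule DERIV_cong[OF DERIV_diff[OF R R]]) simp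
  have h: "(h n has_real_derivative h' n t) (at t)" for n t
    unfolding h_def[abs_def] h'_def by (rule DERIV_cong[OF DERIV_add[OF R R]]) simp
  have c\<kappa>': "continuous_on UNIV (\<kappa>' n)" and ch': "continuous_on UNIV (h' n)" for n
    unfolding \<kappa>'_def[abs_def] h'_def[abs_def]
    by (intro continuous_intros continuous_on_compose2[OF continuous_on_ramp'[of UNIV]]; simp)+
  have \<kappa>1: "\<bar>\<kappa> n t\<bar> \<le> 1" for n t
    using ramp_bounds(1,2)[of "real n * t"] ramp_bounds(1,2)[of "- real n * t"] by (auto simp: \<kappa>_def)
  have h2: "\<bar>h n t\<bar> \<le> 2" for n t
    using ramp_bounds(1,2)[of "real n * t"] ramp_bounds(1,2)[of "- real n * t"] by (auto simp: h_def)
  have h'\<kappa>': "\<bar>h' n t\<bar> \<le> \<kappa>' n t" for n t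
    using ramp'_nonneg[of "real n * t"] ramp'_nonneg[of "- real n * t"]
    by (auto simp: h'_def \<kappa>'_def abs_le_iff algebra_simps)
  have h0: "h n t = 0" "h' n t = 0" if "\<bar>real n * t\<bar> \<le> 1" for n t
    using that by (auto simp: h_def h'_def ramp_bounds ramp'_eq_0)
  have hlim: "(\<lambda>n. h n t) \<longlonglongrightarrow> 1" if "t \<noteq> 0" for t
  proof (cases "t > 0")
    case True
    then have "- real n * t \<le> 1" for n
      by (smt (verit) mult_minus_left mult_nonneg_nonneg of_nat_0_le_iff)
    then have "h n t = ramp (real n * t)" for n by (simp add: h_def ramp_bounds(3))
    with True show ?thesis by (simp add: tendsto_ramp)
  next
    case False
    then have "real n * t \<le> 1" for n
      by (smt (verit) mult_nonneg_nonpos of_nat_0_le_iff)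
    then have "h n t = ramp (real n * (- t))" for n by (simp add: h_def ramp_bounds(3))
    with False that show ?thesis using tendsto_ramp[of "- t"] by simp
  qed

  define \<eta> where "\<eta> n x = h n (\<rho> x)" for n x
  have C\<eta>: "C1_on U (\<eta> n)" for n
    unfolding \<eta>_def[abs_def] by (rule C1_on_compose_real[OF h ch' \<rho>(1)]) auto
  have pd\<eta>: "pd j (\<eta> n) x = h' n (\<rho> x) * pd j \<rho> x" if "x \<in> U" for n j x
    unfolding \<eta>_def[abs_def] by (rule pd_compose_real[OF h C1_onD(1)[OF \<rho>(1) that]])
  have \<phi>0: "\<phi> x = 0" if "x \<in> U - K" for x
    using \<phi>(2)[of x] b(3)[OF that] that by auto

  \<comment> \<open>Divergence of the cut-off field\<close>
  define \<Phi> where "\<Phi> n j x = (\<phi> x * \<eta> n x) *\<^sub>R F x $ j" for n j x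
  have Q: "set_integrable lborel K (\<lambda>x. \<eta> n x *\<^sub>R w x)"
    "(LINT x:K|lborel. \<eta> n x *\<^sub>R w x) = - (LINT x:K|lborel. (\<phi> x * h' n (\<rho> x)) *\<^sub>R H x)" for n
  proof -
    \<comment> \<open>On the neighbourhood \<open>W\<close> of the interface the cutoff is
      identically zero, so the cut-off field is C1 on all of \<open>U\<close> whatever
      \<open>F\<close> does at the interface.\<close>
    define W where "W = {x\<in>U. \<bar>real n * \<rho> x\<bar> < 1}"
    have "W = U \<inter> (\<lambda>x. \<bar>real n * \<rho> x\<bar>) -` {..<1}" by (auto simp: W_def)
    then have W: "open W"
      using continuous_open_preimage[OF continuous_on_rabs[OF continuous_on_mult_left[OF C1_onD(3)[OF \<rho>(1)]]] U(1) open_lessThan]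
      by simp
    have VW: "V \<union> W = U" by (auto simp: V_def W_def)
    have \<Phi>W: "\<Phi> n j x = 0" if "x \<in> W" for j x
      using that by (auto simp: \<Phi>_def \<eta>_def W_def h0)
    have "C1_on V (\<Phi> n j)" for j
      unfolding \<Phi>_def[abs_def]
      by (intro C1_on_scaleR C1_on_mult C1_on_subset[OF \<phi>(1) VU] C1_on_subset[OF C\<eta> VU] C1_on_component FV)
    moreover have "C1_on W (\<Phi> n j)" for j
      by (rule C1_on_cong[OF W C1_on_const[of _ 0]]) (simp add: \<Phi>W)
    ultimately have C\<Phi>: "C1_on U (\<Phi> n j)" for j
      using C1_on_Un[OF V W, of "\<Phi> n j"] VW by simp
    note I = integral_pd_compact_support_on[OF U C\<Phi>]
    have \<Phi>0: "\<Phi> n j x = 0" if "x \<in> U - K" for j x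
      using \<phi>0[OF that] by (simp add: \<Phi>_def)
    \<comment> \<open>Off the interface the gradient of the cutoff is \<open>h'\<close> times that
      of \<rho>, and its pairing with \<open>F\<close> gives \<open>H\<close>; on the interface both
      sides vanish.\<close>
    have eq: "(\<Sum>j\<in>UNIV. pd j (\<Phi> n j) x) = \<eta> n x *\<^sub>R w x + (\<phi> x * h' n (\<rho> x)) *\<^sub>R H x" if "x \<in> U" for x
    proof (cases "\<rho> x = 0")
      case False
      have "(\<Sum>j\<in>UNIV. pd j (\<Phi> n j) x) = (\<phi> x * \<eta> n x) *\<^sub>R divergence F x
          + (\<Sum>j\<in>UNIV. pd j (\<lambda>y. \<phi> y * \<eta> n y) x *\<^sub>R F x $ j)"
        unfolding \<Phi>_def[abs_def] using that False C1_onD(1)[OF FV]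
        by (intro divergence_scaleR C1_onD(1)[OF C1_on_mult[OF \<phi>(1) C\<eta>]]) (auto simp: V_def)
      also have "(\<Sum>j\<in>UNIV. pd j (\<lambda>y. \<phi> y * \<eta> n y) x *\<^sub>R F x $ j) =
          (\<Sum>j\<in>UNIV. (\<phi> x * h' n (\<rho> x)) *\<^sub>R (pd j \<rho> x *\<^sub>R F x $ j) + \<eta> n x *\<^sub>R (pd j \<phi> x *\<^sub>R F x $ j))"
        using that by (simp add: pd_mult C1_onD(1)[OF \<phi>(1)] C1_onD(1)[OF C\<eta>] pd\<eta> algebra_simps)
      also have "\<dots> = (\<phi> x * h' n (\<rho> x)) *\<^sub>R H x + \<eta> n x *\<^sub>R (\<Sum>j\<in>UNIV. pd j \<phi> x *\<^sub>R F x $ j)"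
        by (simp only: sum.distrib H(2)[OF that False] flip: scaleR_sum_right)
      finally show ?thesis by (simp add: w_def algebra_simps)
    next
      case True
      then have "x \<in> W" using that by (simp add: W_def)
      then have "pd j (\<Phi> n j) x = 0" for j
        using pd_transform(2)[OF W _ _ , of x "\<lambda>_. 0" "\<Phi> n j" j] \<Phi>W by simp
      with True show ?thesis by (simp add: \<eta>_def h0)
    qed
    have h'\<rho>: "continuous_on K (\<lambda>x. h' n (\<rho> x))"
      by (rule continuous_on_compose2[OF ch' KU[OF C1_onD(3)[OF \<rho>(1)]]]) auto
    have iH: "set_integrable lborel K (\<lambda>x. (\<phi> x * h' n (\<rho> x)) *\<^sub>R H x)"
      by (intro iK continuous_intros h'\<rho> KU C1_onD(3)[OF \<phi>(1)] H(1))
    have iS: "set_integrable lborel K (\<lambda>x. \<Sum>j\<in>UNIV. pd j (\<Phi> n j) x)"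
      using I(1) \<Phi>0 unfolding set_integrable_def scaleR_sum_right
      by (intro Bochner_Integration.integrable_sum) auto
    then have iS': "set_integrable lborel K (\<lambda>x. \<eta> n x *\<^sub>R w x + (\<phi> x * h' n (\<rho> x)) *\<^sub>R H x)"
      using eq U(3) by (subst (asm) set_integrable_cong[OF refl refl]) auto
    show iw: "set_integrable lborel K (\<lambda>x. \<eta> n x *\<^sub>R w x)"
      using set_integral_diff(1)[OF iS' iH] by simp
    have "0 = (LINT x:K|lborel. \<Sum>j\<in>UNIV. pd j (\<Phi> n j) x)"
      using I(2) \<Phi>0 I(1) unfolding set_lebesgue_integral_def set_integrable_def
      by (subst scaleR_sum_right, subst Bochner_Integration.integral_sum) auto
    also have "\<dots> = (LINT x:K|lborel. \<eta> n x *\<^sub>R w x + (\<phi> x * h' n (\<rho> x)) *\<^sub>R H x)"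
      by (rule set_lebesgue_integral_cong) (use eq U(3) Kb in auto)
    also have "\<dots> = (LINT x:K|lborel. \<eta> n x *\<^sub>R w x) + (LINT x:K|lborel. (\<phi> x * h' n (\<rho> x)) *\<^sub>R H x)"
      by (rule set_integral_add(2)[OF iw iH])
    finally show "(LINT x:K|lborel. \<eta> n x *\<^sub>R w x) = - (LINT x:K|lborel. (\<phi> x * h' n (\<rho> x)) *\<^sub>R H x)"
      by (simp add: eq_neg_iff_add_eq_0)
  qed

  \<comment> \<open>Passage to the limit in the cutoff\<close>
  define J where "J n = (LINT x:K|lborel. (\<phi> x * h' n (\<rho> x)) *\<^sub>R H x)" for n
  define L where "L = (LINT x:K \<inter> V|lborel. w x)"
  have ind: "(\<lambda>x. indicator K x *\<^sub>R (indicator V x *\<^sub>R w x)) = (\<lambda>x. indicator (K \<inter> V) x *\<^sub>R w x)"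
    by (auto simp: indicator_def)
  \<comment> \<open>\<open>w\<close> is known to be continuous only off the interface; the indicator
    discards its values there.\<close>
  have wm: "set_borel_measurable lborel K (\<lambda>x. indicator V x *\<^sub>R w x)"
  proof -
    have "continuous_on V w"
      unfolding w_def divergence_def
      by (intro continuous_intros C1_onD(2,3)[OF FV] C1_onD(2,3)[OF C1_on_subset[OF \<phi>(1) VU]])
    then have "continuous_on (K \<inter> V) w" by (rule continuous_on_subset) auto
    then show ?thesis unfolding set_borel_measurable_def ind
      using borel_measurable_continuous_on_indicator[of "K \<inter> V" w] Kb V by auto
  qed
  obtain C1 where C1: "\<And>x. x \<in> K \<Longrightarrow> norm (\<phi> x) \<le> C1" "C1 \<ge> 0"
    using bounded_on_compact_continuous[OF U(2) KU[OF C1_onD(3)[OF \<phi>(1)]]] by blast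
  obtain C2 where C2: "\<And>x. x \<in> K \<Longrightarrow> (\<Sum>j\<in>UNIV. \<bar>pd j \<phi> x\<bar>) \<le> C2" "C2 \<ge> 0"
  proof -
    have "continuous_on K (\<lambda>x. \<Sum>j\<in>UNIV. \<bar>pd j \<phi> x\<bar>)"
      by (intro continuous_intros KU C1_onD(2)[OF \<phi>(1)])
    from bounded_on_compact_continuous[OF U(2) this] that show thesis
      by (metis abs_le_D1 real_norm_def)
  qed
  have wb: "norm (w x) \<le> (C1 + C2) * M" if "x \<in> K \<inter> V" for x
  proof -
    have M0: "M \<ge> 0" using M(1)[OF that] norm_ge_zero order_trans by blast
    have "norm (w x) \<le> norm (\<phi> x *\<^sub>R divergence F x) + (\<Sum>j\<in>UNIV. norm (pd j \<phi> x *\<^sub>R F x $ j))"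
      unfolding w_def by (rule order_trans[OF norm_triangle_ineq add_left_mono[OF norm_sum]])
    also have "\<dots> \<le> C1 * M + (\<Sum>j\<in>UNIV. \<bar>pd j \<phi> x\<bar> * M)"
      using C1 that M[OF that] Finite_Cartesian_Product.norm_nth_le[of "F x"] M0
      by (intro add_mono sum_mono) (auto intro!: mult_mono intro: order_trans)
    also have "\<dots> \<le> C1 * M + C2 * M"
      using C2(1)[of x] that M0 by (simp add: mult_right_mono flip: sum_distrib_right)
    finally show ?thesis by (simp add: algebra_simps)
  qed
  have \<eta>w: "norm (\<eta> n x *\<^sub>R w x) \<le> 2 * ((C1 + C2) * \<bar>M\<bar>)" if "x \<in> K" for n x
  proof (cases "x \<in> V")
    case True
    have "norm (w x) \<le> (C1 + C2) * \<bar>M\<bar>"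
      using wb[of x] True that C1(2) C2(2)
      by (intro order_trans[OF wb mult_left_mono]) auto
    then show ?thesis using h2[of n "\<rho> x"] by (auto simp: \<eta>_def intro!: mult_mono)
  next
    case False
    then have "\<eta> n x = 0" using that U(3) by (auto simp: V_def \<eta>_def h0)
    then show ?thesis using C1(2) C2(2) by simp
  qed
  have \<eta>lim: "(\<lambda>n. \<eta> n x *\<^sub>R w x) \<longlonglongrightarrow> indicator V x *\<^sub>R w x" if "x \<in> K" for x
  proof (cases "x \<in> V")
    case True
    then have "(\<lambda>n. \<eta> n x *\<^sub>R w x) \<longlonglongrightarrow> 1 *\<^sub>R w x"
      unfolding \<eta>_def by (intro tendsto_intros hlim) (simp add: V_def)
    then show ?thesis using True by simp
  next
    case False
    then have "\<eta> n x = 0" for n using that U(3) by (auto simp: V_def \<eta>_def h0)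
    then show ?thesis using False by simp
  qed
  note DC = tendsto_set_integral_dominated[where s = "\<lambda>n x. \<eta> n x *\<^sub>R w x", OF Q(1) U(2) wm \<eta>w]
  have iL: "set_integrable lborel (K \<inter> V) w"
    using DC(1) \<eta>lim ind by (simp add: set_integrable_def)
  have "(LINT x:K|lborel. indicator V x *\<^sub>R w x) = L"
    by (simp only: L_def set_lebesgue_integral_def ind)
  moreover have "(\<lambda>n. LINT x:K|lborel. \<eta> n x *\<^sub>R w x) \<longlonglongrightarrow> (LINT x:K|lborel. indicator V x *\<^sub>R w x)"
    using DC(2) \<eta>lim by blast
  ultimately have "(\<lambda>n. - J n) \<longlonglongrightarrow> L"
    by (simp only: Q(2) J_def)
  then have JL: "J \<longlonglongrightarrow> - L" using tendsto_minus[of "\<lambda>n. - J n" L] by simp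

  define A where "A = (LINT x:K|lborel. \<bar>pd i b x\<bar>)"
  have A0: "A \<ge> 0" unfolding A_def set_lebesgue_integral_def by (intro integral_nonneg_AE AE_I2) auto
  \<comment> \<open>\<open>H\<close> divided by the positive function \<open>pd i \<rho>\<close> is
    continuous, so up to \<open>e\<close> it is a polynomial \<open>P\<close>. The error
    \<open>X n\<close> is at most \<open>e\<close> times the variation bound, uniformly in
    \<open>n\<close>, while the polynomial part can be integrated by parts and disappears in the
    limit.\<close>
  have small: "norm L \<le> e * A" if "e > 0" for e
  proof -
    have "continuous_on K (\<lambda>x. H x /\<^sub>R pd i \<rho> x)"
      by (intro continuous_intros KU H(1) C1_onD(2)[OF \<rho>(1)]) (use \<rho>(2) U(3) in force)
    from Stone_Weierstrass_polynomial_function[OF U(2) this that] obtain P :: "real^3 \<Rightarrow> complex"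
      where P: "polynomial_function P"
      "\<And>x. x \<in> K \<Longrightarrow> norm (H x /\<^sub>R pd i \<rho> x - P x) < e" by blast
    have CP: "C1_on U P" by (rule C1_on_polynomial_function[OF P(1)])
    define q where "q n x = \<phi> x * h' n (\<rho> x) * pd i \<rho> x" for n x
    define X where "X n = (LINT x:K|lborel. q n x *\<^sub>R (H x /\<^sub>R pd i \<rho> x - P x))" for n
    define Y where "Y n = (LINT x:K|lborel. (\<eta> n x - 1) *\<^sub>R pd i (\<lambda>x. \<phi> x *\<^sub>R P x) x)" for n
    have h'\<rho>: "continuous_on K (\<lambda>x. h' n (\<rho> x))" for n
      by (rule continuous_on_compose2[OF ch' KU[OF C1_onD(3)[OF \<rho>(1)]]]) auto
    have cq: "continuous_on K (q n)" for n
      unfolding q_def[abs_def]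
      by (intro continuous_intros h'\<rho> KU C1_onD(3)[OF \<phi>(1)] C1_onD(2)[OF \<rho>(1)])
    have cHP: "continuous_on K (\<lambda>x. H x /\<^sub>R pd i \<rho> x - P x)"
      by (intro continuous_intros KU H(1) C1_onD(2)[OF \<rho>(1)] C1_onD(3)[OF CP]) (use \<rho>(2) U(3) in force)
    have iX: "set_integrable lborel K (\<lambda>x. q n x *\<^sub>R (H x /\<^sub>R pd i \<rho> x - P x))" for n
      by (intro iK continuous_on_scaleR cq cHP)
    have C\<phi>P: "C1_on U (\<lambda>x. \<phi> x *\<^sub>R P x)" by (rule C1_on_scaleR[OF \<phi>(1) CP])
    have iY: "set_integrable lborel K (\<lambda>x. (\<eta> n x - 1) *\<^sub>R pd i (\<lambda>x. \<phi> x *\<^sub>R P x) x)" for n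
      by (intro iK continuous_intros KU C1_onD(3)[OF C\<eta>] C1_onD(2)[OF C\<phi>P])
    have iqP: "set_integrable lborel K (\<lambda>x. q n x *\<^sub>R P x)" for n
      by (intro iK continuous_on_scaleR cq KU C1_onD(3)[OF CP])
    have J: "J n = X n - Y n" for n
    proof -
      \<comment> \<open>Subtracting 1 does not change the derivative of the cutoff, and makes the
        factor left after integration by parts tend to zero off the interface.\<close>
      have C\<eta>1: "C1_on U (\<lambda>x. \<eta> n x - 1)" by (intro C1_on_diff C\<eta> C1_on_const)
      note Z = integral_pd_compact_support_on[OF U C1_on_scaleR[OF C\<eta>1 C\<phi>P]]
      have "pd i (\<lambda>x. (\<eta> n x - 1) *\<^sub>R \<phi> x *\<^sub>R P x) x =
          (\<eta> n x - 1) *\<^sub>R pd i (\<lambda>x. \<phi> x *\<^sub>R P x) x + q n x *\<^sub>R P x" if "x \<in> U" for x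
        using that
        by (subst pd_scaleR[OF C1_onD(1)[OF C\<eta>1 that] C1_onD(1)[OF C\<phi>P that]])
          (simp add: pd_diff[OF C1_onD(1)[OF C\<eta> that]] pd\<eta> q_def mult_ac)
      then have "(LINT x:K|lborel. pd i (\<lambda>x. (\<eta> n x - 1) *\<^sub>R \<phi> x *\<^sub>R P x) x) =
          (LINT x:K|lborel. (\<eta> n x - 1) *\<^sub>R pd i (\<lambda>x. \<phi> x *\<^sub>R P x) x + q n x *\<^sub>R P x)"
        by (intro set_lebesgue_integral_cong) (use U(3) Kb in auto)
      also have "\<dots> = Y n + (LINT x:K|lborel. q n x *\<^sub>R P x)"
        unfolding Y_def by (rule set_integral_add(2)[OF iY iqP])
      finally have qP: "(LINT x:K|lborel. q n x *\<^sub>R P x) = - Y n"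
        using Z(2) \<phi>0 by (simp add: eq_neg_iff_add_eq_0 add.commute)
      have "J n = (LINT x:K|lborel. q n x *\<^sub>R (H x /\<^sub>R pd i \<rho> x - P x) + q n x *\<^sub>R P x)"
        unfolding J_def
      proof (intro set_lebesgue_integral_cong allI impI)
        fix x assume "x \<in> K"
        then have "pd i \<rho> x \<noteq> 0" using \<rho>(2)[of x] U(3) by auto
        then show "(\<phi> x * h' n (\<rho> x)) *\<^sub>R H x = q n x *\<^sub>R (H x /\<^sub>R pd i \<rho> x - P x) + q n x *\<^sub>R P x"
          by (simp add: scaleR_diff_right q_def)
      qed (use Kb in auto)
      also have "\<dots> = X n - Y n"
        unfolding X_def using qP by (subst set_integral_add(2)[OF iX iqP]) simp
      finally show ?thesis .
    qed
    have XA: "norm (X n) \<le> e * A" for n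
    proof -
      note V1 = integral_monotone_profile_le[OF U \<rho>(1) b(1,3) \<kappa> c\<kappa>' \<kappa>1, where i = i]
      have "norm (X n) \<le> (LINT x:K|lborel. norm (q n x *\<^sub>R (H x /\<^sub>R pd i \<rho> x - P x)))"
        unfolding X_def by (rule set_integral_norm_bound[OF iX])
      also have "\<dots> \<le> (LINT x:K|lborel. e * (b x * (\<kappa>' n (\<rho> x) * pd i \<rho> x)))"
      proof (rule set_integral_mono)
        show "set_integrable lborel K (\<lambda>x. norm (q n x *\<^sub>R (H x /\<^sub>R pd i \<rho> x - P x)))"
          by (intro iK' continuous_intros cq cHP)
        show "set_integrable lborel K (\<lambda>x. e * (b x * (\<kappa>' n (\<rho> x) * pd i \<rho> x)))"
          using V1(1) by simp
        fix x assume x: "x \<in> K"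
        then have xU: "x \<in> U" using U by auto
        have "\<bar>q n x\<bar> \<le> b x * (\<kappa>' n (\<rho> x) * pd i \<rho> x)"
          using \<phi>(2)[OF xU] h'\<kappa>'[of n "\<rho> x"] \<rho>(2)[OF xU] b(2)[OF xU]
          by (auto simp: q_def abs_mult mult.assoc intro!: mult_mono)
        then have "\<bar>q n x\<bar> * norm (H x /\<^sub>R pd i \<rho> x - P x) \<le> (b x * (\<kappa>' n (\<rho> x) * pd i \<rho> x)) * e"
          using P(2)[OF x] by (intro mult_mono) auto
        then show "norm (q n x *\<^sub>R (H x /\<^sub>R pd i \<rho> x - P x)) \<le> e * (b x * (\<kappa>' n (\<rho> x) * pd i \<rho> x))"
          by (simp add: mult.commute)
      qed
      also have "\<dots> = e * (LINT x:K|lborel. b x * (\<kappa>' n (\<rho> x) * pd i \<rho> x))" by simp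
      also have "\<dots> \<le> e * A"
        using V1(2) that by (intro mult_left_mono) (auto simp: A_def)
      finally show ?thesis .
    qed
    have Y0: "Y \<longlonglongrightarrow> 0"
    proof -
      obtain C3 where C3: "\<And>x. x \<in> K \<Longrightarrow> norm (pd i (\<lambda>x. \<phi> x *\<^sub>R P x) x) \<le> C3" "C3 \<ge> 0"
        using bounded_on_compact_continuous[OF U(2) KU[OF C1_onD(2)[OF C\<phi>P]]] by blast
      \<comment> \<open>The factor \<open>\<eta> n x - 1\<close> stays at -1 on the interface, which
        must therefore be a null set.\<close>
      have "AE x in lborel. x \<notin> {x\<in>K. \<rho> x = 0}"
        using \<rho>(3) by (rule AE_not_in)
      then have l: "AE x in lborel. x \<in> K \<longrightarrow> (\<lambda>n. (\<eta> n x - 1) *\<^sub>R pd i (\<lambda>x. \<phi> x *\<^sub>R P x) x) \<longlonglongrightarrow> 0"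
      proof eventually_elim
        fix x assume "x \<notin> {x\<in>K. \<rho> x = 0}"
        then show "x \<in> K \<longrightarrow> (\<lambda>n. (\<eta> n x - 1) *\<^sub>R pd i (\<lambda>x. \<phi> x *\<^sub>R P x) x) \<longlonglongrightarrow> 0"
          using hlim[of "\<rho> x"] by (auto simp: \<eta>_def intro!: tendsto_eq_intros)
      qed
      have bd: "norm ((\<eta> n x - 1) *\<^sub>R pd i (\<lambda>x. \<phi> x *\<^sub>R P x) x) \<le> 3 * C3" if "x \<in> K" for n x
        using C3(1)[OF that] h2[of n "\<rho> x"] by (auto simp: \<eta>_def intro!: mult_mono)
      have "(\<lambda>n. LINT x:K|lborel. (\<eta> n x - 1) *\<^sub>R pd i (\<lambda>x. \<phi> x *\<^sub>R P x) x)
          \<longlonglongrightarrow> (LINT x:K|lborel. (0::complex))"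
        by (rule tendsto_set_integral_dominated(2)[OF iY U(2) _ bd l]) (auto simp: set_borel_measurable_def)
      then show ?thesis by (simp add: Y_def[abs_def] set_lebesgue_integral_def)
    qed
    have "X = (\<lambda>n. J n + Y n)" using J by auto
    then have "X \<longlonglongrightarrow> - L" using tendsto_add[OF JL Y0] by simp
    from tendsto_norm[OF this] have "norm (- L) \<le> e * A"
      by (rule LIMSEQ_le_const2) (use XA in auto)
    then show ?thesis by simp
  qed
  have "norm L \<le> 0"
  proof (rule field_le_epsilon)
    fix e :: real assume "e > 0"
    \<comment> \<open>The denominator is \<open>A + 1\<close> because \<open>A\<close> may be
      zero.\<close>
    then have "norm L \<le> (e / (A + 1)) * A" using A0 by (intro small) auto
    also have "\<dots> \<le> e" using A0 \<open>e > 0\<close> by (simp add: divide_simps)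
    finally show "norm L \<le> 0 + e" by simp
  qed
  then show "set_integrable lborel {x\<in>K. \<rho> x \<noteq> 0} w" "(LINT x:{x\<in>K. \<rho> x \<noteq> 0}|lborel. w x) = 0"
    using iL by (simp_all add: KV L_def)
qed

section \<open>Localization of test functions and the global divergence statement\<close>

lemma C1_on_inverse:
  fixes s :: "real^3 \<Rightarrow> real"
  assumes "C1_on S s" "\<And>x. x \<in> S \<Longrightarrow> s x > 0"
  shows "C1_on S (\<lambda>x. inverse (s x))"
  by (rule C1_on_compose_real[where T = "{0<..}" and \<kappa>' = "\<lambda>t. - (inverse t)\<^sup>2"])
    (use assms in \<open>auto intro!: derivative_eq_intros continuous_intros simp: power2_eq_square\<close>)

text \<open>A partition of unity in the form of an induction principle. Finitely many bumps have a
  sum \<open>s\<close> that is positive on \<open>K\<close>, and \<phi> is the sum of these bumps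
  times the one function \<phi>/s; the arbitrary C1 factor in \<open>loc\<close> is there to receive
  this quotient.\<close>

lemma C1_test_function_localization:
  fixes \<phi> :: "real^3 \<Rightarrow> real"
  assumes zero: "Q (\<lambda>_. 0)" and add: "\<And>f g. Q f \<Longrightarrow> Q g \<Longrightarrow> Q (\<lambda>x. f x + g x)"
    and loc: "\<And>x. \<exists>r>0. \<forall>\<psi>. C1_on UNIV \<psi> \<longrightarrow> Q (\<lambda>y. bump x r y * \<psi> y)"
    and \<phi>: "C1_on UNIV \<phi>" "compact K" "\<And>x. x \<notin> K \<Longrightarrow> \<phi> x = 0"
  shows "Q \<phi>"
proof -
  obtain r where r: "\<And>x. r x > 0" "\<And>x \<psi>. C1_on UNIV \<psi> \<Longrightarrow> Q (\<lambda>y. bump x (r x) y * \<psi> y)"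
    using loc by metis
  obtain D where D: "D \<subseteq> K" "finite D" "K \<subseteq> (\<Union>x\<in>D. ball x (r x))"
    using compactE_image[OF \<phi>(2), of K "\<lambda>x. ball x (r x)"] r(1) by force
  define s where "s y = (\<Sum>x\<in>D. bump x (r x) y)" for y
  have Cs: "C1_on UNIV s" unfolding s_def[abs_def] by (intro C1_on_sum C1_on_bump)
  define V where "V = {y. s y > 0}"
  have V: "open V"
    using continuous_open_preimage[OF C1_onD(3)[OF Cs] open_UNIV open_greaterThan[of 0]]
    by (simp add: V_def vimage_def)
  have KV: "K \<subseteq> V"
  proof
    fix y assume "y \<in> K"
    then obtain x where "x \<in> D" "y \<in> ball x (r x)" using D(3) by auto
    then have "bump x (r x) y > 0" "x \<in> D" using bump_pos_iff[OF r(1)] by auto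
    then show "y \<in> V" unfolding V_def s_def
      using D(2) bump_nonneg by (auto intro!: sum_pos2)
  qed
  define \<psi> where "\<psi> y = (if y \<in> V then \<phi> y * inverse (s y) else 0)" for y
  have "C1_on V (\<lambda>y. \<phi> y * inverse (s y))"
    by (intro C1_on_mult C1_on_inverse C1_on_subset[OF \<phi>(1)] C1_on_subset[OF Cs]) (auto simp: V_def)
  then have C\<psi>: "C1_on UNIV \<psi>"
    unfolding \<psi>_def[abs_def] by (rule C1_on_extend_zero[OF V \<phi>(2) KV]) (use \<phi>(3) in auto)
  have Qs: "Q (\<lambda>y. \<Sum>x\<in>D'. bump x (r x) y * \<psi> y)" if "D' \<subseteq> D" for D'
    using finite_subset[OF that D(2)] by (induction D' rule: finite_induct) (auto intro!: zero add r C\<psi>)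
  have "(\<Sum>x\<in>D. bump x (r x) y * \<psi> y) = \<phi> y" for y
  proof (cases "y \<in> V")
    case True
    then have "s y \<noteq> 0" by (simp add: V_def)
    with True show ?thesis by (simp add: \<psi>_def s_def flip: sum_distrib_right)
  next
    case False
    then show ?thesis using \<phi>(3)[of y] KV by (auto simp: \<psi>_def)
  qed
  with Qs[of D] show ?thesis by simp
qed

text \<open>Where \<open>F\<close> and \<phi> are differentiable this is the divergence of \<phi>
  \<open>F\<close>; the product rule is written out so that linearity in \<phi> is visible.\<close>

definition flux_density :: "vec_field \<Rightarrow> (real^3 \<Rightarrow> real) \<Rightarrow> real^3 \<Rightarrow> complex" where
  "flux_density F \<phi> x = \<phi> x *\<^sub>R divergence F x + (\<Sum>j\<in>UNIV. pd j \<phi> x *\<^sub>R F x $ j)"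

lemma flux_density_outside:
  assumes "closed K" "\<And>y. y \<notin> K \<Longrightarrow> \<phi> y = 0" "x \<notin> K"
  shows "flux_density F \<phi> x = 0"
proof -
  have "pd j \<phi> x = 0" for j
    using pd_transform(2)[of "- K" x "\<lambda>_. 0" \<phi> j] assms by (auto simp: open_Compl)
  with assms show ?thesis by (simp add: flux_density_def)
qed

lemma set_integral_support:
  assumes "\<And>x. x \<in> S - T \<Longrightarrow> f x = 0" "T \<subseteq> S"
  shows "set_integrable M S f \<longleftrightarrow> set_integrable M T f"
    "(LINT x:S|M. f x) = (LINT x:T|M. f x)"
proof -
  have "(\<lambda>x. indicator S x *\<^sub>R f x) = (\<lambda>x. indicator T x *\<^sub>R f x)"
    using assms by (auto simp: indicator_def fun_eq_iff)
  then show "set_integrable M S f \<longleftrightarrow> set_integrable M T f" "(LINT x:S|M. f x) = (LINT x:T|M. f x)"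
    by (simp_all add: set_integrable_def set_lebesgue_integral_def)
qed

lemma flux_density_integral_support:
  assumes "closed K" "\<forall>y. y \<notin> K \<longrightarrow> \<phi> y = 0"
  shows "set_integrable lborel S (flux_density F \<phi>) \<longleftrightarrow> set_integrable lborel (K \<inter> S) (flux_density F \<phi>)"
    "(LINT x:S|lborel. flux_density F \<phi> x) = (LINT x:K \<inter> S|lborel. flux_density F \<phi> x)"
  using set_integral_support[of S "K \<inter> S" "flux_density F \<phi>" lborel] flux_density_outside[of K \<phi> _ F] assms
  by auto

text \<open>The case away from the interface: the density is a sum of partial derivatives of
  compactly supported functions.\<close>

lemma integral_flux_density_smooth:
  assumes "open U" "compact K" "K \<subseteq> U" "C1_on U F" "C1_on UNIV \<phi>" "\<And>x. x \<notin> K \<Longrightarrow> \<phi> x = 0"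
  shows "set_integrable lborel K (flux_density F \<phi>)" "(LINT x:K|lborel. flux_density F \<phi> x) = 0"
proof -
  have "C1_on U (\<lambda>y. \<phi> y *\<^sub>R F y $ j)" for j
    by (intro C1_on_scaleR C1_on_component C1_on_subset[OF assms(5)] assms(4)) auto
  note I = integral_pd_compact_support_on[OF assms(1-3) this, unfolded set_integrable_def set_lebesgue_integral_def]
  have eq: "indicator K x *\<^sub>R flux_density F \<phi> x = (\<Sum>j\<in>UNIV. indicator K x *\<^sub>R pd j (\<lambda>y. \<phi> y *\<^sub>R F y $ j) x)" for x
    using divergence_scaleR[OF C1_onD(1)[OF assms(5)] C1_onD(1)[OF assms(4)], of x] assms(3)
    by (cases "x \<in> K") (auto simp: flux_density_def)
  show "set_integrable lborel K (flux_density F \<phi>)"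
    unfolding set_integrable_def eq by (intro Bochner_Integration.integrable_sum I(1)) (simp add: assms)
  show "(LINT x:K|lborel. flux_density F \<phi> x) = 0"
    unfolding set_lebesgue_integral_def eq
    by (subst Bochner_Integration.integral_sum) (auto intro!: sum.neutral I simp: assms)
qed

text \<open>The continuous function \<open>H\<close> expresses that the normal component has equal
  limits from both sides, so that no part of the divergence sits on the interface. By localization
  it is enough to test with bumps inside \<Omega> or inside one chart.\<close>

theorem integral_divergence_interface:
  fixes F :: vec_field
  assumes \<Omega>: "open \<Omega>" "C1_on \<Omega> F"
    and interface: "\<And>x. x \<notin> \<Omega> \<Longrightarrow> \<exists>U \<rho> H M. open U \<and> x \<in> U \<and> C1_on U \<rho> \<and> grad \<rho> x \<noteq> 0 \<and>
      \<Omega> \<inter> U = {y\<in>U. \<rho> y \<noteq> 0} \<and>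
      (\<forall>y\<in>\<Omega> \<inter> U. norm (F y) \<le> M \<and> norm (divergence F y) \<le> M) \<and>
      continuous_on U H \<and> (\<forall>y\<in>\<Omega> \<inter> U. (\<Sum>j\<in>UNIV. pd j \<rho> y *\<^sub>R F y $ j) = H y)"
    and \<phi>: "C1_on UNIV \<phi>" "compact K" "\<And>x. x \<notin> K \<Longrightarrow> \<phi> x = 0"
  shows "set_integrable lborel \<Omega> (flux_density F \<phi>)" "(LINT x:\<Omega>|lborel. flux_density F \<phi> x) = 0"
proof -
  define Q where "Q \<phi> \<longleftrightarrow> C1_on UNIV \<phi> \<and> set_integrable lborel \<Omega> (flux_density F \<phi>) \<and>
    (LINT x:\<Omega>|lborel. flux_density F \<phi> x) = 0" for \<phi>
  have "Q \<phi>"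
  proof (rule C1_test_function_localization[OF _ _ _ \<phi>])
    show "Q (\<lambda>_. 0)"
      by (simp add: Q_def flux_density_def C1_on_const set_integrable_def set_lebesgue_integral_def)
  next
    fix f g assume fg: "Q f" "Q g"
    then have C: "C1_on UNIV f" "C1_on UNIV g" by (auto simp: Q_def)
    have "flux_density F (\<lambda>x. f x + g x) = (\<lambda>x. flux_density F f x + flux_density F g x)"
      by (simp add: fun_eq_iff flux_density_def pd_add[OF C[THEN C1_onD(1), OF UNIV_I]] scaleR_add_left sum.distrib)
    then show "Q (\<lambda>x. f x + g x)"
      using fg by (simp add: Q_def C1_on_add set_integral_add)
  next
    fix x :: "real^3"
    show "\<exists>r>0. \<forall>\<psi>. C1_on UNIV \<psi> \<longrightarrow> Q (\<lambda>y. bump x r y * \<psi> y)"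
    proof (cases "x \<in> \<Omega>")
      case True
      then obtain r where r: "r > 0" "cball x r \<subseteq> \<Omega>"
        using \<Omega>(1) open_contains_cball by blast
      have "Q (\<lambda>y. bump x r y * \<psi> y)" if \<psi>: "C1_on UNIV \<psi>" for \<psi>
      proof -
        have C: "C1_on UNIV (\<lambda>y. bump x r y * \<psi> y)" by (intro C1_on_mult C1_on_bump \<psi>)
        have 0: "bump x r y * \<psi> y = 0" if "y \<notin> cball x r" for y
          using that bump_eq_0[OF r(1)] by auto
        have "\<forall>y. y \<notin> cball x r \<longrightarrow> bump x r y * \<psi> y = 0" "cball x r \<inter> \<Omega> = cball x r" using 0 r(2) by auto
        note supp = flux_density_integral_support[OF closed_cball this(1), of \<Omega> F, unfolded this(2)]
        from integral_flux_density_smooth[OF \<Omega>(1) compact_cball r(2) \<Omega>(2) C 0] C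
        show ?thesis unfolding Q_def by (simp add: supp)
      qed
      with r(1) show ?thesis by blast
    next
      case False
      then obtain U \<rho>0 H0 M where U: "open U" "x \<in> U" "C1_on U \<rho>0" "grad \<rho>0 x \<noteq> 0"
        "\<Omega> \<inter> U = {y\<in>U. \<rho>0 y \<noteq> 0}"
        "\<forall>y\<in>\<Omega> \<inter> U. norm (F y) \<le> M \<and> norm (divergence F y) \<le> M"
        "continuous_on U H0" "\<forall>y\<in>\<Omega> \<inter> U. (\<Sum>j\<in>UNIV. pd j \<rho>0 y *\<^sub>R F y $ j) = H0 y"
        using interface[OF False] by (elim exE conjE) (rule that; assumption)
      obtain i where i: "pd i \<rho>0 x \<noteq> 0"
        using U(4) by (auto simp: grad_def vec_eq_iff)
      \<comment> \<open>A nonzero partial derivative is made positive by a sign change of \<rho>,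
        which is passed on to \<open>H\<close>; continuity then keeps it positive on a
        neighbourhood.\<close>
      define s where "s = sgn (pd i \<rho>0 x)"
      define \<rho> where "\<rho> y = s * \<rho>0 y" for y
      define H where "H y = s *\<^sub>R H0 y" for y
      have s: "s \<noteq> 0" "s * pd i \<rho>0 x > 0" using i by (auto simp: s_def sgn_if)
      have C\<rho>: "C1_on U \<rho>" unfolding \<rho>_def[abs_def] by (intro C1_on_mult C1_on_const U(3))
      have pd\<rho>: "pd j \<rho> y = s * pd j \<rho>0 y" if "y \<in> U" for j y
        unfolding \<rho>_def[abs_def] using C1_onD(1)[OF U(3) that] by (simp add: pd_mult)
      define U' where "U' = U \<inter> pd i \<rho> -` {0<..}"
      have U': "open U'" "x \<in> U'"
        unfolding U'_def using U(2) s(2)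
        by (auto intro!: continuous_open_preimage[OF C1_onD(2)[OF C\<rho>] U(1)] simp: pd\<rho>)
      then obtain r where r: "r > 0" "cball x r \<subseteq> U'" using open_contains_cball by blast
      have U'U: "U' \<subseteq> U" by (auto simp: U'_def)
      \<comment> \<open>Half the radius: the level set will be null in the open ball of radius
        \<open>r\<close>, and the closed ball \<open>K'\<close> has to fit inside it.\<close>
      define K' where "K' = cball x (r / 2)"
      have K'U: "K' \<subseteq> U'" using r by (auto simp: K'_def subset_iff)
      have pos: "pd i \<rho> y > 0" if "y \<in> U'" for y using that by (simp add: U'_def)
      have C\<rho>': "C1_on U' \<rho>" by (rule C1_on_subset[OF C\<rho> U'U])
      have "{y\<in>ball x r. \<rho> y = 0} \<in> null_sets lborel"
        by (rule level_set_null[OF U'(1) r(2,1) C\<rho>' pos])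
      then have "K' \<inter> {y\<in>ball x r. \<rho> y = 0} \<in> null_sets lborel"
        by (rule null_set_Int1) (simp add: K'_def)
      moreover have "K' \<inter> {y\<in>ball x r. \<rho> y = 0} = {y\<in>K'. \<rho> y = 0}"
        using r(1) by (auto simp: K'_def)
      ultimately have null: "{y\<in>K'. \<rho> y = 0} \<in> null_sets lborel" by simp
      have nz: "\<Omega> \<inter> U' = {y\<in>U'. \<rho> y \<noteq> 0}" using U(5) U'U s(1) by (auto simp: \<rho>_def)
      have K\<Omega>: "{y\<in>K'. \<rho> y \<noteq> 0} = K' \<inter> \<Omega>" using nz K'U by auto
      have "Q (\<lambda>y. bump x (r/2) y * \<psi> y)" if \<psi>: "C1_on UNIV \<psi>" for \<psi>
      proof -
        let ?\<phi> = "\<lambda>y. bump x (r/2) y * \<psi> y"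
        have C: "C1_on UNIV ?\<phi>" by (intro C1_on_mult C1_on_bump \<psi>)
        have b0: "bump x (r/2) y = 0" if "y \<notin> K'" for y
          using that r(1) by (intro bump_eq_0) (auto simp: K'_def)
        then have 0: "?\<phi> y = 0" if "y \<notin> K'" for y using that by simp
        \<comment> \<open>As \<psi> is bounded by \<open>N\<close> on \<open>K'\<close>,
          \<open>N\<close> times the bump is the nonnegative majorant \<open>b\<close> of the local
          statement.\<close>
        obtain N where N: "\<And>y. y \<in> K' \<Longrightarrow> norm (\<psi> y) \<le> N" "N \<ge> 0"
          using bounded_on_compact_continuous[of K' \<psi>] continuous_on_subset[OF C1_onD(3)[OF \<psi>], of K']
          by (auto simp: K'_def)
        have Cb: "C1_on U' (\<lambda>y. N * bump x (r/2) y)" and C': "C1_on U' ?\<phi>"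
          by (auto intro!: C1_on_mult C1_on_const C1_on_bump C1_on_subset[OF C])
        have bn: "N * bump x (r/2) y \<ge> 0" "y \<in> U' - K' \<Longrightarrow> N * bump x (r/2) y = 0" for y
          using N(2) bump_nonneg[of x "r/2" y] b0 by auto
        have Nb: "\<bar>bump x (r/2) y * \<psi> y\<bar> \<le> N * bump x (r/2) y" for y
          using N b0[of y] bump_nonneg[of x "r/2" y]
          by (cases "y \<in> K'") (auto simp: abs_mult mult.commute[of N] intro!: mult_left_mono)
        have F1: "C1_on {y \<in> U'. \<rho> y \<noteq> 0} F"
          by (rule C1_on_subset[OF \<Omega>(2)]) (use nz in auto)
        have F2: "norm (F y) \<le> M \<and> norm (divergence F y) \<le> M" if "y \<in> K'" "\<rho> y \<noteq> 0" for y
          using U(6) that K'U U'U nz by blast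
        have H1: "continuous_on U' H"
          unfolding H_def[abs_def] by (intro continuous_intros continuous_on_subset[OF U(7) U'U])
        have H2: "(\<Sum>j\<in>UNIV. pd j \<rho> y *\<^sub>R F y $ j) = H y" if "y \<in> U'" "\<rho> y \<noteq> 0" for y
        proof -
          have "y \<in> \<Omega> \<inter> U" using that nz U'U by blast
          with U(8) show ?thesis
            by (simp add: pd\<rho> H_def flip: scaleR_scaleR scaleR_sum_right)
        qed
        have "compact K'" by (simp add: K'_def)
        note L = integral_divergence_interface_local[OF U'(1) this K'U C\<rho>' pos null Cb bn C' Nb F1 F2 H1 H2]
        have "closed K'" "\<forall>y. y \<notin> K' \<longrightarrow> ?\<phi> y = 0" using 0 by (auto simp: K'_def)
        note supp = flux_density_integral_support[OF this, of \<Omega> F]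
        show ?thesis
          using C L unfolding Q_def supp K\<Omega> by (simp add: flux_density_def[abs_def])
      qed
      then show ?thesis using r(1) by (intro exI[of _ "r/2"]) auto
    qed
  qed
  then show "set_integrable lborel \<Omega> (flux_density F \<phi>)" "(LINT x:\<Omega>|lborel. flux_density F \<phi> x) = 0"
    by (auto simp: Q_def)
qed

subsection \<open>Vector calculus for complex fields\<close>

lemma ccross_nth [simp]:
  "ccross a b $ 1 = a $ 2 * b $ 3 - a $ 3 * b $ 2"
  "ccross a b $ 2 = a $ 3 * b $ 1 - a $ 1 * b $ 3"
  "ccross a b $ 3 = a $ 1 * b $ 2 - a $ 2 * b $ 1"
  by (simp_all add: ccross_def)

lemma cdot_3: "cdot a b = a $ 1 * b $ 1 + a $ 2 * b $ 2 + a $ 3 * b $ 3"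
  by (simp add: cdot_def sum_3)

lemma cdot_commute: "cdot a b = cdot b a"
  by (simp add: cdot_def mult.commute)

lemma norm_cdot_le: "norm (cdot a b) \<le> norm a * norm b"
proof -
  have "norm (cdot a b) \<le> (\<Sum>i\<in>UNIV. \<bar>norm (a $ i)\<bar> * \<bar>norm (b $ i)\<bar>)"
    unfolding cdot_def by (rule order_trans[OF norm_sum]) (simp add: norm_mult)
  also have "\<dots> \<le> norm a * norm b" unfolding norm_vec_def by (rule L2_set_mult_ineq)
  finally show ?thesis .
qed

lemma norm_ccross_nth_le: "norm (ccross a b $ j) \<le> 2 * (norm a * norm b)"
proof -
  have "norm (a $ i * b $ k) \<le> norm a * norm b" for i k
    by (simp add: norm_mult mult_mono Finite_Cartesian_Product.norm_nth_le)
  then have *: "norm (a $ i * b $ k - a $ l * b $ m) \<le> 2 * (norm a * norm b)" for i k l m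
    using norm_triangle_ineq4[of "a $ i * b $ k" "a $ l * b $ m"] by (smt (verit, best))
  show ?thesis using exhaust_3[of j] * by auto
qed

lemma norm_ccross_le: "norm (ccross a b) \<le> 6 * (norm a * norm b)"
proof -
  have "norm (ccross a b) \<le> (\<Sum>j\<in>UNIV. norm (ccross a b $ j))"
    unfolding norm_vec_def by (rule L2_set_le_sum) simp
  also have "\<dots> \<le> (\<Sum>j\<in>(UNIV::3 set). 2 * (norm a * norm b))"
    by (intro sum_mono norm_ccross_nth_le)
  finally show ?thesis by simp
qed

lemma tendsto_cdot:
  "(f \<longlongrightarrow> a) F \<Longrightarrow> (g \<longlongrightarrow> b) F \<Longrightarrow> ((\<lambda>x. cdot (f x) (g x)) \<longlongrightarrow> cdot a b) F"
  unfolding cdot_def by (intro tendsto_intros)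

lemma tendsto_ccross:
  assumes "(f \<longlongrightarrow> a) F" "(g \<longlongrightarrow> b) F"
  shows "((\<lambda>x. ccross (f x) (g x)) \<longlongrightarrow> ccross a b) F"
proof (rule vec_tendstoI)
  show "((\<lambda>x. ccross (f x) (g x) $ j) \<longlongrightarrow> ccross a b $ j) F" for j
    using exhaust_3[of j] by (elim disjE; simp; intro tendsto_intros assms)
qed

lemma tendsto_cvec: "(f \<longlongrightarrow> a) F \<Longrightarrow> ((\<lambda>x. cvec (f x)) \<longlongrightarrow> cvec a) F"
  by (rule vec_tendstoI) (auto simp: cvec_def intro!: tendsto_intros)

lemma continuous_on_cdot:
  "continuous_on S f \<Longrightarrow> continuous_on S g \<Longrightarrow> continuous_on S (\<lambda>x. cdot (f x) (g x))"
  unfolding continuous_on_def by (blast intro: tendsto_cdot)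

lemma continuous_on_ccross:
  "continuous_on S f \<Longrightarrow> continuous_on S g \<Longrightarrow> continuous_on S (\<lambda>x. ccross (f x) (g x))"
  unfolding continuous_on_def by (blast intro: tendsto_ccross)

lemma continuous_on_cvec: "continuous_on S f \<Longrightarrow> continuous_on S (\<lambda>x. cvec (f x))"
  unfolding continuous_on_def by (blast intro: tendsto_cvec)

lemma C1_on_vecI:
  fixes F :: vec_field
  assumes "\<And>j. C1_on S (\<lambda>x. F x $ j)"
  shows "C1_on S F"
proof -
  have "bounded_linear (axis j :: complex \<Rightarrow> complex^3)" for j
    by (rule linear_conv_bounded_linear[THEN iffD1], rule linearI)
      (auto simp: axis_def vec_eq_iff)
  then have "C1_on S (\<lambda>x. \<Sum>j\<in>UNIV. axis j (F x $ j))"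
    by (intro C1_on_sum C1_on_compose_bounded_linear[OF _ assms])
  moreover have "(\<Sum>j\<in>UNIV. axis j (F x $ j)) = F x" for x
    by (simp add: vec_eq_iff axis_def if_distrib cong: if_cong)
  ultimately show ?thesis by simp
qed

lemma C1_on_ccross:
  assumes "C1_on S a" "C1_on S b" shows "C1_on S (\<lambda>x. ccross (a x) (b x))"
proof (rule C1_on_vecI)
  show "C1_on S (\<lambda>x. ccross (a x) (b x) $ j)" for j
    using exhaust_3[of j] by (elim disjE; simp; intro C1_on_diff C1_on_mult C1_on_component assms)
qed

lemma curl_nth:
  "curl F x $ 1 = pd 2 F x $ 3 - pd 3 F x $ 2"
  "curl F x $ 2 = pd 3 F x $ 1 - pd 1 F x $ 3"
  "curl F x $ 3 = pd 1 F x $ 2 - pd 2 F x $ 1"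
  by (simp_all add: curl_def)

lemma C1_on_curl:
  assumes "C2_on S F" shows "C1_on S (curl F)"
proof (rule C1_on_vecI)
  show "C1_on S (\<lambda>x. curl F x $ j)" for j
    using exhaust_3[of j] assms unfolding C2_on_def
    by (elim disjE; simp add: curl_nth; intro C1_on_diff C1_on_component; simp)
qed

lemma continuous_on_curl:
  assumes "C1_on S F" shows "continuous_on S (curl F)"
proof -
  have "continuous_on S (\<lambda>x. curl F x $ j)" for j
    using exhaust_3[of j]
    by (elim disjE; simp add: curl_nth; intro continuous_intros C1_onD(2)[OF assms])
  then show ?thesis
    unfolding continuous_on_def by (blast intro: vec_tendstoI)
qed

lemma divergence_ccross:
  assumes "a differentiable at x" "c differentiable at x"
  shows "divergence (\<lambda>y. ccross (a y) (c y)) x = cdot (curl a x) (c x) - cdot (a x) (curl c x)"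
proof -
  have d: "(\<lambda>y. F y $ j) differentiable at x" if "F differentiable at x" for F :: vec_field and j
    using that bounded_linear.has_derivative[OF bounded_linear_vec_nth]
    unfolding differentiable_def by blast
  have "C1_on {x} F \<Longrightarrow> F differentiable at x" for F :: vec_field by (simp add: C1_on_def)
  \<comment> \<open>\<open>C1_on\<close> over a singleton amounts to differentiability at its point,
    so the product rule for C1 fields can be reused here.\<close>
  have D: "(\<lambda>y. ccross (a y) (c y)) differentiable at x"
    using C1_on_ccross[of "{x}" a c] assms by (simp add: C1_on_def continuous_on_sing)
  have m: "pd i (\<lambda>y. a y $ p * c y $ q - a y $ r * c y $ s) x =
     a x $ p * pd i c x $ q + pd i a x $ p * c x $ q - (a x $ r * pd i c x $ s + pd i a x $ r * c x $ s)"
    for i p q r s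
    by (subst pd_diff) (auto intro!: differentiable_mult d assms simp: pd_mult pd_component d assms)
  show ?thesis
    unfolding divergence_def sum_3 pd_component[OF D, symmetric] ccross_nth m cdot_3 curl_nth
    by (simp add: algebra_simps)
qed

subsection \<open>Geometry near the interface\<close>

text \<open>If one sign were missing, \<open>x\<close> would be an extremum of \<rho> on the open
  set \<open>U\<close> and the gradient would vanish there.\<close>

lemma level_point_signs:
  fixes \<rho> :: "real^3 \<Rightarrow> real"
  assumes "open U" "C1_on U \<rho>" "x \<in> U" "\<rho> x = 0" "grad \<rho> x \<noteq> 0"
  shows "\<exists>y\<in>U. \<rho> y < 0" "\<exists>y\<in>U. \<rho> y > 0"
proof -
  have "\<not> ((\<forall>y\<in>U. \<rho> y \<le> \<rho> x) \<or> (\<forall>y\<in>U. \<rho> x \<le> \<rho> y))"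
  proof
    assume "(\<forall>y\<in>U. \<rho> y \<le> \<rho> x) \<or> (\<forall>y\<in>U. \<rho> x \<le> \<rho> y)"
    from differential_zero_maxmin[OF assms(3,1) pd_works[OF C1_onD(1)[OF assms(2,3)]] this]
    show False using assms(5) by (simp add: grad_def pd_def vec_eq_iff)
  qed
  then show "\<exists>y\<in>U. \<rho> y < 0" "\<exists>y\<in>U. \<rho> y > 0" using assms(4) by (auto simp: not_le)
qed

text \<open>The definition describes only \<open>B\<close> in a chart. A point with \<rho> > 0 has a
  neighbourhood free of \<open>B\<close>; near a point with \<rho> = 0 there are negative values, so
  it lies in the closure of \<open>B\<close>. This separates exterior from boundary.\<close>

lemma C1_boundary_local:
  assumes B: "open B" "C1_boundary_with_normal B n" and x: "x \<in> frontier B"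
  shows "\<exists>U \<rho>. open U \<and> x \<in> U \<and> C1_on U \<rho> \<and> (\<forall>y\<in>U. grad \<rho> y \<noteq> 0) \<and>
    B \<inter> U = {y\<in>U. \<rho> y < 0} \<and> exterior B \<inter> U = {y\<in>U. \<rho> y > 0} \<and> frontier B \<inter> U = {y\<in>U. \<rho> y = 0} \<and>
    (\<forall>y\<in>frontier B \<inter> U. n y = grad \<rho> y /\<^sub>R norm (grad \<rho> y))"
proof -
  obtain U \<rho> where U: "open U" "x \<in> U" "C1_on U \<rho>" "\<forall>y\<in>U. grad \<rho> y \<noteq> 0" "B \<inter> U = {y\<in>U. \<rho> y < 0}"
    "\<forall>y\<in>frontier B \<inter> U. n y = grad \<rho> y /\<^sub>R norm (grad \<rho> y)"
    using bspec[OF B(2)[unfolded C1_boundary_with_normal_def] x]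
    by (elim exE conjE) (rule that; assumption)
  have iffB: "y \<in> B \<longleftrightarrow> \<rho> y < 0" if "y \<in> U" for y using U(5) that by blast
  have pos: "y \<in> exterior B" if y: "y \<in> U" "\<rho> y > 0" for y
  proof -
    have "open (U \<inter> \<rho> -` {0<..})"
      by (rule continuous_open_preimage[OF C1_onD(3)[OF U(3)] U(1)]) simp
    moreover have "(U \<inter> \<rho> -` {0<..}) \<inter> B = {}" using iffB by auto
    ultimately have "(U \<inter> \<rho> -` {0<..}) \<inter> closure B = {}" using open_Int_closure_eq_empty by blast
    then show ?thesis using y by (auto simp: exterior_def)
  qed
  have zero: "y \<in> closure B" if y: "y \<in> U" "\<rho> y = 0" for y
    unfolding closure_iff_nhds_not_empty
  proof (intro allI impI)
    fix A V assume "V \<subseteq> A" "open V" "y \<in> V"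
    then have "\<exists>z\<in>U \<inter> V. \<rho> z < 0"
      using y U by (intro level_point_signs[of _ _ y] C1_on_subset[OF U(3)]) auto
    then show "B \<inter> A \<noteq> {}" using U(5) \<open>V \<subseteq> A\<close> by blast
  qed
  have BI: "closure B \<inter> B = B" "interior B = B"
    using closure_subset[of B] interior_open[OF B(1)] by auto
  have E: "exterior B \<inter> U = {y\<in>U. \<rho> y > 0}"
  proof (intro set_eqI iffI)
    fix y assume y: "y \<in> exterior B \<inter> U"
    then have "y \<notin> B" "y \<notin> closure B" "y \<in> U" using closure_subset[of B] by (auto simp: exterior_def)
    then have "\<not> \<rho> y < 0" "\<rho> y \<noteq> 0" using zero[of y] U(5) by auto
    then show "y \<in> {y\<in>U. \<rho> y > 0}" using \<open>y \<in> U\<close> by auto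
  qed (use pos in auto)
  have "y \<in> frontier B \<longleftrightarrow> y \<notin> B \<and> y \<notin> exterior B" for y
    unfolding frontier_def BI(2) exterior_def by auto
  moreover have "y \<in> B \<longleftrightarrow> \<rho> y < 0" "y \<in> exterior B \<longleftrightarrow> \<rho> y > 0" if "y \<in> U" for y
    using U(5) E that by blast+
  ultimately have "frontier B \<inter> U = {y\<in>U. \<rho> y = 0}" by force
  then show ?thesis using U E by blast
qed

text \<open>Limits along these filters are unique, so the \<open>Lim\<close> in
  \<open>trace_in\<close> and \<open>trace_out\<close> equals any limit that is found.\<close>

lemma frontier_not_trivial:
  assumes B: "open B" "C1_boundary_with_normal B n" and x: "x \<in> frontier B"
  shows "at x within B \<noteq> bot" "at x within exterior B \<noteq> bot"
proof -
  obtain U \<rho> where U: "open U" "x \<in> U" "C1_on U \<rho>" "\<forall>y\<in>U. grad \<rho> y \<noteq> 0"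
    "B \<inter> U = {y\<in>U. \<rho> y < 0}" "exterior B \<inter> U = {y\<in>U. \<rho> y > 0}" "frontier B \<inter> U = {y\<in>U. \<rho> y = 0}"
    using C1_boundary_local[OF assms] by (elim exE conjE) (rule that; assumption)
  have 0: "\<rho> x = 0" using U x by blast
  have "\<exists>z\<in>U \<inter> V. \<rho> z < 0" "\<exists>z\<in>U \<inter> V. \<rho> z > 0" if "open V" "x \<in> V" for V
    using that U 0 by (auto intro!: level_point_signs[of _ _ x] C1_on_subset[OF U(3)])
  note sgn = this
  have "x islimpt B" "x islimpt exterior B"
    unfolding islimpt_def
  proof (safe)
    fix V :: "(real^3) set" assume V: "x \<in> V" "open V"
    obtain z where "z \<in> U \<inter> V" "\<rho> z < 0" using sgn(1)[OF V(2,1)] by blast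
    then show "\<exists>y\<in>B. y \<in> V \<and> y \<noteq> x" using 0 U(5) by (intro bexI[of _ z]) auto
    obtain z where "z \<in> U \<inter> V" "\<rho> z > 0" using sgn(2)[OF V(2,1)] by blast
    then show "\<exists>y\<in>exterior B. y \<in> V \<and> y \<noteq> x" using 0 U(6) by (intro bexI[of _ z]) auto
  qed
  then show "at x within B \<noteq> bot" "at x within exterior B \<noteq> bot"
    using trivial_limit_within[of x B] trivial_limit_within[of x "exterior B"] by auto
qed

text \<open>Compactness: one-sided limits bound the field near a boundary point and continuity does
  so elsewhere; finitely many such neighbourhoods cover the ball.\<close>

lemma traces_bounded:
  assumes B: "open B" and F: "continuous_on (B \<union> exterior B) F" "has_traces B F"
  obtains M where "\<And>x. x \<in> B \<union> exterior B \<Longrightarrow> norm x \<le> R \<Longrightarrow> norm (F x) \<le> M"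
proof -
  let ?\<Omega> = "B \<union> exterior B"
  have \<Omega>: "open ?\<Omega>" using B by (auto simp: exterior_def)
  have loc: "\<exists>V M. open V \<and> x \<in> V \<and> (\<forall>y\<in>V \<inter> ?\<Omega>. norm (F y) \<le> M)" for x
  proof (cases "x \<in> ?\<Omega>")
    case True
    then have "(F \<longlongrightarrow> F x) (at x)"
      using F(1) \<Omega> by (auto simp: continuous_on_eq_continuous_at isCont_def)
    then have "\<forall>\<^sub>F y in at x. norm (F y) < norm (F x) + 1"
      by (intro order_tendstoD[OF tendsto_norm]) auto
    then obtain V where V: "open V" "x \<in> V" "\<And>y. y \<in> V \<Longrightarrow> y \<noteq> x \<Longrightarrow> norm (F y) < norm (F x) + 1"
      unfolding eventually_at_topological by blast
    then have "norm (F y) \<le> norm (F x) + 1" if "y \<in> V" for y using that by (cases "y = x") (auto intro: less_imp_le)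
    with V show ?thesis by blast
  next
    case False
    then have x: "x \<in> frontier B" using B by (auto simp: frontier_def exterior_def interior_open)
    have *: "\<exists>V M. open V \<and> x \<in> V \<and> (\<forall>y\<in>V \<inter> S. norm (F y) \<le> M)" if "(F \<longlongrightarrow> l) (at x within S)" "x \<notin> S" for l S
    proof -
      have "\<forall>\<^sub>F y in at x within S. norm (F y) < norm l + 1"
        using that(1) by (intro order_tendstoD[OF tendsto_norm]) auto
      then obtain V where "open V" "x \<in> V" "\<And>y. y \<in> V \<Longrightarrow> y \<noteq> x \<Longrightarrow> y \<in> S \<Longrightarrow> norm (F y) < norm l + 1"
        unfolding eventually_at_topological by blast
      then show ?thesis using that(2) by (metis IntD1 IntD2 less_imp_le)
    qed
    obtain V1 M1 V2 M2 where V: "open V1" "x \<in> V1" "\<forall>y\<in>V1 \<inter> B. norm (F y) \<le> M1"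
      "open V2" "x \<in> V2" "\<forall>y\<in>V2 \<inter> exterior B. norm (F y) \<le> M2"
      using F(2) x False *[of _ B] *[of _ "exterior B"] unfolding has_traces_def by (metis UnI1 UnI2)
    then have "open (V1 \<inter> V2) \<and> x \<in> V1 \<inter> V2 \<and> (\<forall>y\<in>V1 \<inter> V2 \<inter> ?\<Omega>. norm (F y) \<le> max M1 M2)"
      by (auto simp: le_max_iff_disj)
    then show ?thesis by blast
  qed
  obtain V M where V: "\<And>x. open (V x) \<and> x \<in> V x \<and> (\<forall>y\<in>V x \<inter> ?\<Omega>. norm (F y) \<le> M x)"
    using loc by metis
  obtain D where D: "D \<subseteq> cball 0 R" "finite D" "cball 0 R \<subseteq> (\<Union>x\<in>D. V x)"
    using compactE_image[of "cball 0 R" "cball 0 R" V] V by (metis UN_iff compact_cball subsetI)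
  have "norm (F y) \<le> (\<Sum>x\<in>D. \<bar>M x\<bar>)" if y: "y \<in> ?\<Omega>" "norm y \<le> R" for y
  proof -
    obtain x where x: "x \<in> D" "y \<in> V x" using D(3) y(2) by auto
    then have "norm (F y) \<le> \<bar>M x\<bar>" using V[of x] y(1) by force
    also have "\<dots> \<le> (\<Sum>x\<in>D. \<bar>M x\<bar>)" using D(2) x by (intro member_le_sum) auto
    finally show ?thesis .
  qed
  then show ?thesis using that by blast
qed

text \<open>Continuity of \<open>L\<close> comes for free: each \<open>L y\<close> is a limit of
  values of \<open>G\<close> taken close to \<open>y\<close>, and for \<open>y\<close> near
  \<open>x\<close> these already lie within e/2 of \<open>L x\<close>.\<close>

lemma continuous_on_extension_limits:
  fixes G :: "'a::metric_space \<Rightarrow> 'b::metric_space"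
  assumes "open U" "open \<Omega>" "continuous_on (\<Omega> \<inter> U) G"
    and L: "\<And>x. x \<in> U - \<Omega> \<Longrightarrow> (G \<longlongrightarrow> L x) (at x within \<Omega>) \<and> at x within \<Omega> \<noteq> bot"
  shows "continuous_on U (\<lambda>y. if y \<in> \<Omega> then G y else L y)"
proof (rule continuous_at_imp_continuous_on, rule ballI)
  fix x assume x: "x \<in> U"
  let ?H = "\<lambda>y. if y \<in> \<Omega> then G y else L y"
  show "isCont ?H x"
  proof (cases "x \<in> \<Omega>")
    case True
    have "open (\<Omega> \<inter> U)" using assms by auto
    then have "isCont G x" using assms(3) True x by (simp add: continuous_on_eq_continuous_at)
    then show ?thesis
      by (rule isCont_cong[THEN iffD1, rotated])
        (use assms(2) True in \<open>auto intro!: eventually_mono[OF eventually_nhds_in_open]\<close>)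
  next
    case False
    show ?thesis unfolding continuous_at_eps_delta
    proof (intro allI impI)
      fix e :: real assume "e > 0"
      then have "\<forall>\<^sub>F y in at x within \<Omega>. dist (G y) (L x) < e / 2"
        using L[of x] x False by (intro tendstoD) auto
      then obtain d1 where d1: "d1 > 0" "\<And>y. y \<in> \<Omega> \<Longrightarrow> dist y x < d1 \<Longrightarrow> dist (G y) (L x) < e / 2"
        using False unfolding eventually_at by metis
      obtain d2 where d2: "d2 > 0" "ball x d2 \<subseteq> U" using assms(1) x open_contains_ball by blast
      show "\<exists>d>0. \<forall>y. dist y x < d \<longrightarrow> dist (?H y) (?H x) < e"
      proof (intro exI[of _ "min d1 d2"] conjI allI impI)
        fix y assume y: "dist y x < min d1 d2"
        show "dist (?H y) (?H x) < e"
        proof (cases "y \<in> \<Omega>")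
          case True
          then show ?thesis using d1(2)[of y] y False \<open>e > 0\<close> by simp
        next
          case yF: False
          then have yL: "(G \<longlongrightarrow> L y) (at y within \<Omega>)" "at y within \<Omega> \<noteq> bot"
            using L[of y] d2 y by (auto simp: dist_commute subset_iff)
          have "\<forall>\<^sub>F z in at y within \<Omega>. dist z y < d1 - dist y x"
            unfolding eventually_at by (intro exI[of _ "d1 - dist y x"]) (use y in auto)
          moreover have "\<forall>\<^sub>F z in at y within \<Omega>. z \<in> \<Omega>" by (simp add: eventually_at_filter)
          ultimately have "\<forall>\<^sub>F z in at y within \<Omega>. dist (L x) (G z) \<le> e / 2"
          proof eventually_elim
            case (elim z)
            then have "dist z x < d1" using dist_triangle[of z x y] by linarith
            then show ?case using d1(2)[of z] elim by (simp add: dist_commute)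
          qed
          then have "dist (L x) (L y) \<le> e / 2" by (rule Lim_dist_ubound[OF yL(2,1)])
          then show ?thesis using \<open>e > 0\<close> yF False by (simp add: dist_commute)
        qed
      qed (use d1 d2 in auto)
    qed
  qed
qed

subsection \<open>Green's identity across the interface\<close>

text \<open>The interface condition shared by \<theta> and, for \<mu>_r = 1, by
  \<open>curl \<theta>\<close>: tangential parts agree, while the normal component may jump.\<close>

definition transmitted :: "(real^3) set \<Rightarrow> (real^3 \<Rightarrow> real^3) \<Rightarrow> vec_field \<Rightarrow> bool" where
  "transmitted B n a \<longleftrightarrow> has_traces B a \<and>
    (\<forall>x\<in>frontier B. jump B (\<lambda>y. ccross (cvec (n x)) (a y)) x = 0)"

lemma transmitted_traces:
  assumes B: "open B" "C1_boundary_with_normal B n" and a: "transmitted B n a" and x: "x \<in> frontier B"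
  obtains p q where "(a \<longlongrightarrow> p) (at x within B)" "(a \<longlongrightarrow> q) (at x within exterior B)"
    "ccross (cvec (n x)) p = ccross (cvec (n x)) q"
proof -
  obtain p q where pq: "(a \<longlongrightarrow> p) (at x within B)" "(a \<longlongrightarrow> q) (at x within exterior B)"
    using a x unfolding transmitted_def has_traces_def by blast
  have "jump B (\<lambda>y. ccross (cvec (n x)) (a y)) x = ccross (cvec (n x)) q - ccross (cvec (n x)) p"
    unfolding jump_def trace_in_def trace_out_def
    using frontier_not_trivial[OF B x] by (intro arg_cong2[of _ _ _ _ minus] tendsto_Lim tendsto_ccross pq tendsto_const)
  then show ?thesis using a x pq that unfolding transmitted_def by simp
qed

text \<open>The scalar triple product only sees the tangential parts of its arguments.\<close>

lemma triple_product_tangential: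
  assumes "ccross N a = ccross N a'" "ccross N c = ccross N c'"
  shows "cdot N (ccross a c) = cdot N (ccross a' c')"
proof -
  have 1: "cdot N (ccross a c) = cdot (ccross N a) c" "cdot N (ccross a c) = - cdot (ccross N c) a" for a c
    by (simp_all add: cdot_3 algebra_simps)
  show ?thesis by (metis 1 assms)
qed

lemma cdot_scaleR_left: "cdot (cvec (r *\<^sub>R v)) w = r *\<^sub>R cdot (cvec v) w"
  by (simp add: cdot_def cvec_def scaleR_sum_right mult.assoc) (simp add: scaleR_conv_of_real)

lemma cdot_cvec: "cdot (cvec v) w = (\<Sum>j\<in>UNIV. v $ j *\<^sub>R w $ j)"
  by (simp add: cdot_def cvec_def scaleR_conv_of_real)

text \<open>Meant for \<open>c = curl b\<close>. The normal component of \<open>a \<times> c\<close>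
  is a triple product of tangential traces, hence continuous across the boundary. Traces bound
  \<open>a\<close>, \<open>c\<close> and \<open>curl a\<close> near it; \<open>curl c\<close> is
  then of second order, and a bound is assumed instead.\<close>

lemma integral_ccross_interface:
  assumes B: "open B" "C1_boundary_with_normal B n"
    and a: "C1_on (B \<union> exterior B) a" "transmitted B n a"
    and c: "C1_on (B \<union> exterior B) c" "transmitted B n c"
    and bnd: "has_traces B (curl a)" "\<And>x. x \<in> B \<union> exterior B \<Longrightarrow> norm (curl c x) \<le> M"
    and \<phi>: "C1_on UNIV \<phi>" "compact K" "\<And>x. x \<notin> K \<Longrightarrow> \<phi> x = 0"
  defines "w \<equiv> \<lambda>x. \<phi> x *\<^sub>R (cdot (curl a x) (c x) - cdot (a x) (curl c x)) +
     (\<Sum>j\<in>UNIV. pd j \<phi> x *\<^sub>R ccross (a x) (c x) $ j)"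
  shows "set_integrable lborel (B \<union> exterior B) w" "(LINT x:B \<union> exterior B|lborel. w x) = 0"
proof -
  define \<Omega> where "\<Omega> = B \<union> exterior B"
  define F where "F y = ccross (a y) (c y)" for y
  have \<Omega>: "open \<Omega>" using B by (auto simp: exterior_def \<Omega>_def)
  have CF: "C1_on \<Omega> F" unfolding F_def[abs_def] \<Omega>_def by (rule C1_on_ccross[OF a(1) c(1)])
  have div: "divergence F y = cdot (curl a y) (c y) - cdot (a y) (curl c y)" if "y \<in> \<Omega>" for y
    unfolding F_def[abs_def] using that C1_onD(1)[OF a(1)] C1_onD(1)[OF c(1)]
    by (intro divergence_ccross) (auto simp: \<Omega>_def)
  have tr: "has_traces B a" "has_traces B c" using a(2) c(2) by (auto simp: transmitted_def)
  have interface: "\<exists>U \<rho> H M. open U \<and> x \<in> U \<and> C1_on U \<rho> \<and> grad \<rho> x \<noteq> 0 \<and>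
      \<Omega> \<inter> U = {y\<in>U. \<rho> y \<noteq> 0} \<and>
      (\<forall>y\<in>\<Omega> \<inter> U. norm (F y) \<le> M \<and> norm (divergence F y) \<le> M) \<and>
      continuous_on U H \<and> (\<forall>y\<in>\<Omega> \<inter> U. (\<Sum>j\<in>UNIV. pd j \<rho> y *\<^sub>R F y $ j) = H y)"
    if x: "x \<notin> \<Omega>" for x
  proof -
    have fr: "frontier B = - \<Omega>"
      using B(1) closure_subset[of B] by (auto simp: frontier_def \<Omega>_def exterior_def interior_open)
    then have xf: "x \<in> frontier B" using x by simp
    obtain U0 \<rho> where U0: "open U0" "x \<in> U0" "C1_on U0 \<rho>" "\<forall>y\<in>U0. grad \<rho> y \<noteq> 0"
      "B \<inter> U0 = {y\<in>U0. \<rho> y < 0}" "exterior B \<inter> U0 = {y\<in>U0. \<rho> y > 0}" "frontier B \<inter> U0 = {y\<in>U0. \<rho> y = 0}"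
      "\<forall>y\<in>frontier B \<inter> U0. n y = grad \<rho> y /\<^sub>R norm (grad \<rho> y)"
      using C1_boundary_local[OF B xf] by (elim exE conjE) (rule that; assumption)
    \<comment> \<open>Intersecting with a ball about the origin makes the bounds on closed balls
      available on all of \<open>U\<close>.\<close>
    define U where "U = U0 \<inter> ball 0 (norm x + 1)"
    have U: "open U" "x \<in> U" "U \<subseteq> U0" using U0 by (auto simp: U_def)
    have C\<rho>: "C1_on U \<rho>" by (rule C1_on_subset[OF U0(3) U(3)])
    define R where "R = norm x + 1"
    obtain Ma where Ma: "\<And>y. y \<in> \<Omega> \<Longrightarrow> norm y \<le> R \<Longrightarrow> norm (a y) \<le> Ma"
      using traces_bounded[OF B(1) C1_onD(3)[OF a(1)] tr(1)] unfolding \<Omega>_def by metis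
    obtain Mc where Mc: "\<And>y. y \<in> \<Omega> \<Longrightarrow> norm y \<le> R \<Longrightarrow> norm (c y) \<le> Mc"
      using traces_bounded[OF B(1) C1_onD(3)[OF c(1)] tr(2)] unfolding \<Omega>_def by metis
    obtain Mk where Mk: "\<And>y. y \<in> \<Omega> \<Longrightarrow> norm y \<le> R \<Longrightarrow> norm (curl a y) \<le> Mk"
      using traces_bounded[OF B(1) continuous_on_curl[OF a(1)] bnd(1)] unfolding \<Omega>_def by metis
    define M' where "M' = 6 * (\<bar>Ma\<bar> * \<bar>Mc\<bar>) + (\<bar>Mk\<bar> * \<bar>Mc\<bar> + \<bar>Ma\<bar> * \<bar>M\<bar>)"
    have bound: "norm (F y) \<le> M' \<and> norm (divergence F y) \<le> M'" if y: "y \<in> \<Omega> \<inter> U" for y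
    proof -
      have yR: "y \<in> \<Omega>" "norm y \<le> R" using y by (auto simp: U_def R_def)
      have "norm (a y) \<le> \<bar>Ma\<bar>" "norm (c y) \<le> \<bar>Mc\<bar>" "norm (curl a y) \<le> \<bar>Mk\<bar>" "norm (curl c y) \<le> \<bar>M\<bar>"
        using Ma[OF yR] Mc[OF yR] Mk[OF yR] bnd(2)[of y] yR(1) by (auto simp: \<Omega>_def)
      then have *: "norm (a y) * norm (c y) \<le> \<bar>Ma\<bar> * \<bar>Mc\<bar>" "norm (curl a y) * norm (c y) \<le> \<bar>Mk\<bar> * \<bar>Mc\<bar>"
        "norm (a y) * norm (curl c y) \<le> \<bar>Ma\<bar> * \<bar>M\<bar>" by (auto intro!: mult_mono)
      have "norm (F y) \<le> 6 * (\<bar>Ma\<bar> * \<bar>Mc\<bar>)"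
        unfolding F_def using norm_ccross_le[of "a y" "c y"] *(1) by linarith
      moreover have "norm (divergence F y) \<le> \<bar>Mk\<bar> * \<bar>Mc\<bar> + \<bar>Ma\<bar> * \<bar>M\<bar>"
        unfolding div[OF yR(1)]
        using norm_triangle_ineq4[of "cdot (curl a y) (c y)" "cdot (a y) (curl c y)"] *(2,3)
          norm_cdot_le[of "curl a y" "c y"] norm_cdot_le[of "a y" "curl c y"] by linarith
      ultimately show ?thesis unfolding M'_def by (smt (verit) mult_nonneg_nonneg abs_ge_zero)
    qed
    define G where "G y = cdot (cvec (grad \<rho> y)) (F y)" for y
    have cg: "continuous_on U (grad \<rho>)"
      unfolding grad_def[abs_def] by (intro continuous_on_vec_lambda C1_onD(2)[OF C\<rho>])
    have cG: "continuous_on (\<Omega> \<inter> U) G"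
      unfolding G_def[abs_def]
      by (intro continuous_on_cdot continuous_on_cvec continuous_on_subset[OF cg]
           continuous_on_subset[OF C1_onD(3)[OF CF]]) auto
    have "\<exists>l. (G \<longlongrightarrow> l) (at y within \<Omega>) \<and> at y within \<Omega> \<noteq> bot" if y: "y \<in> U - \<Omega>" for y
    proof -
      have yf: "y \<in> frontier B" using y fr by simp
      obtain p q where pq: "(a \<longlongrightarrow> p) (at y within B)" "(a \<longlongrightarrow> q) (at y within exterior B)"
        "ccross (cvec (n y)) p = ccross (cvec (n y)) q" using transmitted_traces[OF B a(2) yf] by blast
      obtain p' q' where pq': "(c \<longlongrightarrow> p') (at y within B)" "(c \<longlongrightarrow> q') (at y within exterior B)"
        "ccross (cvec (n y)) p' = ccross (cvec (n y)) q'" using transmitted_traces[OF B c(2) yf] by blast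
      have "isCont (grad \<rho>) y" using cg U(1) y by (simp add: continuous_on_eq_continuous_at)
      then have g: "(grad \<rho> \<longlongrightarrow> grad \<rho> y) (at y within S)" for S
        unfolding isCont_def by (rule tendsto_within_subset) simp
      \<comment> \<open>The gradient is a multiple of the unit normal, so the tangential conditions
        in terms of \<open>n\<close> carry over to \<open>G\<close>.\<close>
      have n: "grad \<rho> y = norm (grad \<rho> y) *\<^sub>R n y"
        using U0(4,8) yf y U(3) by auto
      have "(G \<longlongrightarrow> cdot (cvec (grad \<rho> y)) (ccross p p')) (at y within B)"
        "(G \<longlongrightarrow> cdot (cvec (grad \<rho> y)) (ccross q q')) (at y within exterior B)"
        unfolding G_def[abs_def] F_def[abs_def]
        by (intro tendsto_cdot tendsto_cvec tendsto_ccross g pq pq')+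
      moreover have "cdot (cvec (grad \<rho> y)) (ccross p p') = cdot (cvec (grad \<rho> y)) (ccross q q')"
        by (subst (1 2) n) (simp only: cdot_scaleR_left triple_product_tangential[OF pq(3) pq'(3)])
      ultimately have "(G \<longlongrightarrow> cdot (cvec (grad \<rho> y)) (ccross p p')) (at y within \<Omega>)"
        unfolding \<Omega>_def by (intro Lim_Un) simp_all
      moreover have "at y within \<Omega> \<noteq> bot"
        using frontier_not_trivial(1)[OF B yf] at_le[of B \<Omega> y] by (auto simp: \<Omega>_def bot_unique)
      ultimately show ?thesis by blast
    qed
    then obtain L where L: "\<And>y. y \<in> U - \<Omega> \<Longrightarrow> (G \<longlongrightarrow> L y) (at y within \<Omega>) \<and> at y within \<Omega> \<noteq> bot"
      by metis
    have "continuous_on U (\<lambda>y. if y \<in> \<Omega> then G y else L y)"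
      by (rule continuous_on_extension_limits[OF U(1) \<Omega> cG L])
    moreover have "\<forall>y\<in>\<Omega> \<inter> U. (\<Sum>j\<in>UNIV. pd j \<rho> y *\<^sub>R F y $ j) = (if y \<in> \<Omega> then G y else L y)"
      by (auto simp: G_def cdot_cvec grad_def)
    moreover have "\<Omega> \<inter> U = {y\<in>U. \<rho> y \<noteq> 0}"
      using U0(7) U(3) fr by blast
    ultimately show ?thesis
      using U(1,2) C\<rho> U0(2,4) bound by blast
  qed
  have eq: "flux_density F \<phi> x = w x" if "x \<in> \<Omega>" for x
    using that by (simp add: flux_density_def w_def div F_def)
  note I = integral_divergence_interface[OF \<Omega> CF interface \<phi>]
  have "set_integrable lborel \<Omega> w \<longleftrightarrow> set_integrable lborel \<Omega> (flux_density F \<phi>)"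
    by (rule set_integrable_cong) (simp_all add: eq)
  moreover have "(LINT x:\<Omega>|lborel. w x) = (LINT x:\<Omega>|lborel. flux_density F \<phi> x)"
    by (rule set_lebesgue_integral_cong) (use \<Omega> eq in auto)
  ultimately show "set_integrable lborel (B \<union> exterior B) w" "(LINT x:B \<union> exterior B|lborel. w x) = 0"
    using I by (simp_all add: \<Omega>_def)
qed

subsection \<open>Decay and cutoffs at infinity\<close>

text \<open>Comparison with a dyadic sum: the ball of radius 2^n has volume of order 8^n and carries
  a weight of order 16^-n, so the integrals form a geometric series of ratio 1/2.\<close>

lemma integrable_decay4: "integrable lborel (\<lambda>x::real^3. 1 / (1 + norm x) ^ 4)"
proof -
  define f where "f n x = indicator (ball (0::real^3) (2 ^ n)) x * (16 * (1/16) ^ n :: real)" for n x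
  have fi: "integrable lborel (f n)" for n
    unfolding f_def using emeasure_bounded_finite[OF bounded_ball[of "0::real^3" "2 ^ n"]]
    by (intro integrable_mult_left integrable_real_indicator) auto
  have "integral\<^sup>L lborel (f n) = 16 * unit_ball_vol 3 * (1/2) ^ n" for n
  proof -
    have "integral\<^sup>L lborel (f n) = measure lborel (ball (0::real^3) (2 ^ n)) * (16 * (1/16) ^ n)"
      unfolding f_def by simp
    also have "measure lborel (ball (0::real^3) (2 ^ n)) = unit_ball_vol 3 * (2 ^ n) ^ 3"
      by (subst content_ball) auto
    also have "((2::real) ^ n) ^ 3 * (1/16) ^ n = (1/2) ^ n"
      by (simp add: power_mult[symmetric] mult.commute[of n] power_mult power_mult_distrib[symmetric])
    then have "unit_ball_vol 3 * (2 ^ n) ^ 3 * (16 * (1/16) ^ n) = 16 * unit_ball_vol 3 * (1/2) ^ n"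
      by (simp add: algebra_simps)
    finally show ?thesis .
  qed
  moreover have "(\<lambda>x. norm (f n x)) = f n" for n by (simp add: f_def fun_eq_iff)
  ultimately have s: "summable (\<lambda>n. integral\<^sup>L lborel (\<lambda>x. norm (f n x)))"
    by (simp only:) (intro summable_mult summable_geometric, simp)
  have s': "summable (\<lambda>n. norm (f n x))" for x
    by (rule summable_comparison_test'[of "\<lambda>n. 16 * (1/16) ^ n" 0])
      (auto simp: f_def indicator_def intro!: summable_mult summable_geometric)
  have I: "integrable lborel (\<lambda>x. \<Sum>n. f n x)"
    by (rule integrable_suminf[OF fi _ s]) (use s' in auto)
  have le: "1 / (1 + norm x) ^ 4 \<le> (\<Sum>n. f n x)" for x
  proof -
    \<comment> \<open>For n = m + 1 minimality gives |x| \<ge> 2^m, hence a bound by 16^-m; this is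
      the source of the extra factor 16 in \<open>f\<close>.\<close>
    define n where "n = (LEAST n. norm x < 2 ^ n)"
    have n: "norm x < 2 ^ n" unfolding n_def
      by (rule LeastI_ex) (rule real_arch_pow, simp)
    have "1 / (1 + norm x) ^ 4 \<le> 16 * (1/16) ^ n"
    proof (cases n)
      case 0
      have "1 \<le> (1 + norm x) ^ 4" by (rule one_le_power) simp
      then have "1 / (1 + norm x) ^ 4 \<le> 1" by (simp add: divide_le_eq)
      then show ?thesis using 0 by simp
    next
      case (Suc m)
      then have "\<not> norm x < 2 ^ m" using not_less_Least[of m "\<lambda>n. norm x < 2 ^ n"] by (simp add: n_def)
      then have "(2 ^ m) ^ 4 \<le> (1 + norm x) ^ 4" by (intro power_mono) auto
      moreover have "((2::real) ^ m) ^ 4 = (2 ^ 4) ^ m" by (metis mult.commute power_mult)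
      ultimately show ?thesis using Suc by (simp add: divide_simps)
    qed
    also have "\<dots> = f n x" using n by (simp add: f_def)
    also have "\<dots> \<le> (\<Sum>n. f n x)"
    proof -
      have "f m x \<ge> 0" for m by (simp add: f_def)
      then show ?thesis using sum_le_suminf[OF summable_norm_cancel[OF s'[of x]], of "{n}"] by simp
    qed
    finally show ?thesis .
  qed
  show ?thesis
  proof (rule Bochner_Integration.integrable_bound[OF I])
    show "(\<lambda>x::real^3. 1 / (1 + norm x) ^ 4) \<in> borel_measurable lborel" by measurable
    show "AE x in lborel. norm (1 / (1 + norm x) ^ 4) \<le> norm (\<Sum>n. f n x)"
      by (rule AE_I2) (use le in \<open>auto intro: order_trans[OF _ abs_ge_self]\<close>)
  qed
qed

text \<open>Equal to (1 - |x|^2 / R^2)^2 on the ball of radius R = n + 1: division by R^4 makes it 1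
  at the origin, and \<open>Suc n\<close> keeps R \<ge> 1.\<close>

definition cutoff :: "nat \<Rightarrow> real^3 \<Rightarrow> real" where
  "cutoff n x = bump 0 (Suc n) x / real (Suc n) ^ 4"

lemma C1_on_cutoff: "C1_on S (cutoff n)"
  unfolding cutoff_def[abs_def] divide_inverse by (intro C1_on_mult C1_on_bump C1_on_const)

lemma cutoff_outside: "x \<notin> cball 0 (Suc n) \<Longrightarrow> cutoff n x = 0"
  unfolding cutoff_def by (subst bump_eq_0) auto

lemma cutoff_root:
  defines "s \<equiv> \<lambda>n x. max 0 (1 - (norm x / real (Suc n))\<^sup>2)"
  shows "cutoff n x = (s n x)\<^sup>2" "pd j (cutoff n) x = - 4 * s n x * x $ j / (real (Suc n))\<^sup>2"
    "0 \<le> s n x" "s n x \<le> 1"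
proof -
  define R where "R = real (Suc n)"
  have R: "R > 0" by (simp add: R_def)
  have s: "s n x = max 0 (1 - (norm x / R)\<^sup>2)" by (simp only: s_def R_def)
  have "R\<^sup>2 - (x - 0) \<bullet> (x - 0) = R\<^sup>2 * (1 - (norm x / R)\<^sup>2)"
    using R by (simp add: power_divide right_diff_distrib flip: power2_norm_eq_inner)
  then have m: "max 0 (R\<^sup>2 - (x - 0) \<bullet> (x - 0)) = R\<^sup>2 * s n x"
    unfolding s by (simp only: max_mult_distrib_left) simp
  show "cutoff n x = (s n x)\<^sup>2"
    unfolding cutoff_def bump_def R_def[symmetric] m using R by (simp add: power_mult_distrib)
  have "pd j (cutoff n) x = pd j (bump 0 R) x / R ^ 4"
    unfolding cutoff_def[abs_def] divide_inverse R_def[symmetric]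
    by (subst pd_mult) (auto simp: C1_onD(1)[OF C1_on_bump UNIV_I])
  also have "\<dots> = - 4 * s n x * x $ j / R\<^sup>2"
    unfolding pd_bump m using R by (simp add: divide_simps power4_eq_xxxx power2_eq_square)
  finally show "pd j (cutoff n) x = - 4 * s n x * x $ j / (real (Suc n))\<^sup>2" by (simp add: R_def)
qed (auto simp: s_def)

lemma cutoff_bounds: "0 \<le> cutoff n x" "cutoff n x \<le> 1"
  unfolding cutoff_root(1) by (auto intro!: power_le_one)

text \<open>The square root is what a squared cutoff provides; it allows the cutoff error to be
  absorbed into the weighted energy. The constant is 4 from the derivative times 2, since |x_j| (1 +
  |x|) \<le> 2 R^2 when |x| \<le> R and R \<ge> 1.\<close>

lemma pd_cutoff_le: "\<bar>pd j (cutoff n) x\<bar> \<le> 8 * sqrt (cutoff n x) / (1 + norm x)"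
proof -
  define R where "R = real (Suc n)"
  define s where "s = max 0 (1 - (norm x / R)\<^sup>2)"
  note r = cutoff_root[where n = n and x = x, folded R_def, folded s_def]
  have R: "R \<ge> 1" by (simp add: R_def)
  have "\<bar>pd j (cutoff n) x\<bar> * (1 + norm x) = 4 * s * (\<bar>x $ j\<bar> * (1 + norm x) / R\<^sup>2)"
    using r(2,3) by (simp add: abs_mult)
  also have "\<dots> \<le> 4 * s * 2"
  proof (cases "norm x \<le> R")
    case True
    have "\<bar>x $ j\<bar> * (1 + norm x) \<le> R * (R + R)"
      using True R component_le_norm_cart[of x j] by (intro mult_mono) auto
    then have "\<bar>x $ j\<bar> * (1 + norm x) / R\<^sup>2 \<le> 2" using R by (simp add: divide_simps power2_eq_square)
    then show ?thesis using r(3) by (intro mult_left_mono) auto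
  next
    case False
    then have "norm x / R \<ge> 1" using R by simp
    then have "s = 0" by (simp add: s_def)
    then show ?thesis by simp
  qed
  finally have "\<bar>pd j (cutoff n) x\<bar> * (1 + norm x) \<le> 8 * s" by simp
  moreover have "sqrt (cutoff n x) = s" using r by simp
  ultimately show ?thesis by (simp add: pos_le_divide_eq add_pos_nonneg)
qed

lemma tendsto_cutoff: "(\<lambda>n. cutoff n x) \<longlonglongrightarrow> 1" "(\<lambda>n. pd j (cutoff n) x) \<longlonglongrightarrow> 0"
proof -
  have 0: "(\<lambda>n. c / real (Suc n)) \<longlonglongrightarrow> 0" for c :: real
    using tendsto_mult_right_zero[OF LIMSEQ_Suc[OF lim_1_over_n], of c] by simp
  have s: "(\<lambda>n. max 0 (1 - (norm x / real (Suc n))\<^sup>2)) \<longlonglongrightarrow> 1"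
    using tendsto_max[OF tendsto_const[of 0] tendsto_diff[OF tendsto_const[of 1] tendsto_power[OF 0[of "norm x"], of 2]]]
    by simp
  show "(\<lambda>n. cutoff n x) \<longlonglongrightarrow> 1"
    unfolding cutoff_root(1) using tendsto_power[OF s, of 2] by simp
  have "(\<lambda>n. - 4 * max 0 (1 - (norm x / real (Suc n))\<^sup>2) * (x $ j / real (Suc n)) * (1 / real (Suc n))) \<longlonglongrightarrow> - 4 * 1 * 0 * 0"
    by (intro tendsto_mult tendsto_const s 0)
  then show "(\<lambda>n. pd j (cutoff n) x) \<longlonglongrightarrow> 0"
    unfolding cutoff_root(2) by (simp add: power2_eq_square)
qed

subsection \<open>Energy estimate and Green's identity on the whole space\<close>

lemma set_integrable_continuous_bound:
  fixes f :: "real^3 \<Rightarrow> 'a::{banach, second_countable_topology}" and g :: "real^3 \<Rightarrow> real"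
  assumes "open S" "continuous_on S f" "set_integrable lborel S g" "\<And>x. x \<in> S \<Longrightarrow> norm (f x) \<le> g x"
  shows "set_integrable lborel S f"
proof (rule set_integrable_bound[OF assms(3)])
  show "set_borel_measurable lborel S f"
    unfolding set_borel_measurable_def
    using borel_measurable_continuous_on_indicator[of S f] assms(1,2)
    by (simp add: add_pos_nonneg)
  show "AE x in lborel. x \<in> S \<longrightarrow> norm (f x) \<le> norm (g x)"
    using assms(4) by (auto intro: order_trans[OF _ abs_ge_self])
qed

lemma set_integrable_indicator_bounded:
  assumes "open B" "bounded B" "open S"
  shows "set_integrable lborel S (\<lambda>x::real^3. indicator B x * (c::real))"
proof -
  have "emeasure lborel (S \<inter> B) < \<infinity>"
    using emeasure_bounded_finite[OF bounded_subset[OF assms(2)], of "S \<inter> B"] by simp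
  then have "integrable lborel (\<lambda>x. indicator (S \<inter> B) x * c)"
    using assms by (intro integrable_mult_left integrable_real_indicator) auto
  then show ?thesis by (simp add: set_integrable_def indicator_inter_arith mult.assoc)
qed

lemma set_integrable_decay4:
  assumes "open S" shows "set_integrable lborel S (\<lambda>x::real^3. c * (1 / (1 + norm x) ^ 4))"
proof -
  have "integrable lborel (\<lambda>x::real^3. c * (1 / (1 + norm x) ^ 4))"
    by (intro integrable_mult_right integrable_decay4)
  from integrable_mult_indicator[OF _ this, of S] assms show ?thesis
    by (simp add: set_integrable_def)
qed

text \<open>What a solution and its complex conjugate have in common when \<mu>_r = 1. The equation
  in \<open>B\<close>, which conjugation alters, is retained only as a bound on
  \<open>curl (curl a)\<close>; decay at infinity becomes a bound on the whole domain.\<close>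

definition eddy_field :: "(real^3) set \<Rightarrow> (real^3 \<Rightarrow> real^3) \<Rightarrow> vec_field \<Rightarrow> bool" where
  "eddy_field B n a \<longleftrightarrow>
    C1_on (B \<union> exterior B) a \<and> C1_on (B \<union> exterior B) (curl a) \<and>
    transmitted B n a \<and> transmitted B n (curl a) \<and>
    (\<forall>x\<in>exterior B. curl (curl a) x = 0) \<and>
    (\<exists>M. \<forall>x\<in>B. norm (curl (curl a) x) \<le> M) \<and>
    (\<exists>C. \<forall>x\<in>B \<union> exterior B. norm (a x) \<le> C / (1 + norm x))"

lemma eddy_field_bounds:
  assumes "eddy_field B n a"
  obtains C M where "C \<ge> 0" "M \<ge> 0" "\<And>x. x \<in> B \<union> exterior B \<Longrightarrow> norm (a x) \<le> C / (1 + norm x)"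
    "\<And>x. x \<in> B \<union> exterior B \<Longrightarrow> norm (curl (curl a) x) \<le> indicator B x * M"
proof -
  obtain C0 M0 where 1: "\<forall>x\<in>B \<union> exterior B. norm (a x) \<le> C0 / (1 + norm x)"
    "\<forall>x\<in>B. norm (curl (curl a) x) \<le> M0"
    using assms by (auto simp: eddy_field_def)
  have "norm (a x) \<le> \<bar>C0\<bar> / (1 + norm x)" if "x \<in> B \<union> exterior B" for x
    by (rule order_trans[OF bspec[OF 1(1) that]]) (auto intro!: divide_right_mono)
  moreover have "norm (curl (curl a) x) \<le> indicator B x * \<bar>M0\<bar>" if "x \<in> B \<union> exterior B" for x
    using that assms 1(2) by (cases "x \<in> B") (auto simp: eddy_field_def intro: order_trans[OF _ abs_ge_self])
  ultimately show ?thesis using that[of "\<bar>C0\<bar>" "\<bar>M0\<bar>"] by auto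
qed

lemma cnj_vec_nth [simp]: "cnj_vec v $ i = cnj (v $ i)"
  by (simp add: cnj_vec_def)

lemma norm_cnj_vec [simp]: "norm (cnj_vec v) = norm v"
  by (simp add: norm_vec_def)

lemma cdot_cnj_vec_self: "cdot (cnj_vec v) v = of_real ((norm v)\<^sup>2)"
proof -
  have "(norm v)\<^sup>2 = (\<Sum>i\<in>UNIV. (norm (v $ i))\<^sup>2)"
    by (simp add: norm_vec_def L2_set_def sum_nonneg)
  then show ?thesis by (simp add: cdot_def complex_norm_square[symmetric] mult.commute)
qed

lemma bounded_linear_cnj_vec: "bounded_linear cnj_vec"
  by (rule linear_conv_bounded_linear[THEN iffD1], rule linearI) (auto simp: vec_eq_iff)

lemma curl_cnj_vec:
  assumes "a differentiable at x"
  shows "curl (\<lambda>y. cnj_vec (a y)) x = cnj_vec (curl a x)"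
  unfolding curl_def pd_bounded_linear[OF bounded_linear_cnj_vec assms]
  by (simp add: vec_eq_iff forall_3)

lemma curl_cong:
  assumes "open S" "x \<in> S" "\<And>y. y \<in> S \<Longrightarrow> f y = g y" "f differentiable at x"
  shows "curl g x = curl f x"
proof -
  have "pd i g x = pd i f x" for i by (rule pd_transform(2)) (use assms in auto)
  then show ?thesis by (simp only: curl_def)
qed

lemma ccross_cvec_cnj_vec: "ccross (cvec v) (cnj_vec w) = cnj_vec (ccross (cvec v) w)"
  by (simp add: vec_eq_iff forall_3 cvec_def)

text \<open>The divergence of \<open>a \<times> curl b\<close>, bilinear in the fields; conjugates
  are inserted explicitly.\<close>

definition green_density :: "vec_field \<Rightarrow> vec_field \<Rightarrow> real^3 \<Rightarrow> complex" where
  "green_density a b x = cdot (curl a x) (curl b x) - cdot (a x) (curl (curl b) x)"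

definition layer :: "nat \<Rightarrow> vec_field \<Rightarrow> vec_field \<Rightarrow> real^3 \<Rightarrow> complex" where
  "layer m a b x = (\<Sum>j\<in>UNIV. pd j (cutoff m) x *\<^sub>R ccross (a x) (curl b x) $ j)"

text \<open>One factor 1 / (1 + |x|) comes from the gradient of the cutoff, the other from the decay
  of \<open>a\<close>; \<open>curl b\<close> is kept because no decay of it is known. The constant
  is 48 = 3 \<cdot> 8 \<cdot> 2: components, cutoff gradient, cross product.\<close>

lemma norm_layer_le:
  assumes "norm (a x) \<le> C / (1 + norm x)" "C \<ge> 0"
  shows "norm (layer m a b x) \<le> sqrt (cutoff m x) * norm (curl b x) * (48 * C / (1 + norm x)\<^sup>2)"
proof -
  have "norm (layer m a b x) \<le> (\<Sum>j\<in>(UNIV::3 set). (8 * sqrt (cutoff m x) / (1 + norm x)) * (2 * ((C / (1 + norm x)) * norm (curl b x))))"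
    unfolding layer_def
  proof (rule order_trans[OF norm_sum], rule sum_mono)
    fix j :: 3
    have "norm (a x) * norm (curl b x) \<le> (C / (1 + norm x)) * norm (curl b x)"
      by (rule mult_right_mono[OF assms(1)]) simp
    then have "norm (ccross (a x) (curl b x) $ j) \<le> 2 * ((C / (1 + norm x)) * norm (curl b x))"
      using norm_ccross_nth_le[of "a x" "curl b x" j] by linarith
    then show "norm (pd j (cutoff m) x *\<^sub>R ccross (a x) (curl b x) $ j)
        \<le> (8 * sqrt (cutoff m x) / (1 + norm x)) * (2 * ((C / (1 + norm x)) * norm (curl b x)))"
      unfolding norm_scaleR by (intro mult_mono pd_cutoff_le) (auto simp: cutoff_bounds)
  qed
  also have "\<dots> = sqrt (cutoff m x) * norm (curl b x) * (48 * C / (1 + norm x)\<^sup>2)"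
    by (simp add: power2_eq_square)
  finally show ?thesis .
qed

lemma norm_cdot_curl_curl_le:
  assumes "norm (a x) \<le> C / (1 + norm x)" "C \<ge> 0" "norm (curl (curl b) x) \<le> indicator B x * M" "M \<ge> 0"
  shows "norm (cdot (a x) (curl (curl b) x)) \<le> indicator B x * (C * M)"
proof -
  have "norm (a x) \<le> C"
    by (rule order_trans[OF assms(1)])
      (use divide_left_mono[of 1 "1 + norm x" C] assms(2) in \<open>simp add: add_pos_nonneg\<close>)
  then have "norm (a x) * norm (curl (curl b) x) \<le> C * (indicator B x * M)"
    using assms by (intro mult_mono) auto
  then show ?thesis using norm_cdot_le[of "a x" "curl (curl b) x"] by (simp add: mult_ac)
qed

context
  fixes B :: "(real^3) set" and n :: "real^3 \<Rightarrow> real^3"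
  assumes B: "open B" "bounded B" "C1_boundary_with_normal B n"
begin

lemma open_domain: "open (B \<union> exterior B)"
  using B(1) by (auto simp: exterior_def)

text \<open>The interface statement for \<open>c = curl b\<close>, tested with
  \<open>cutoff m\<close>.\<close>

lemma green_cutoff:
  assumes "eddy_field B n a" "eddy_field B n b"
  shows "set_integrable lborel (B \<union> exterior B) (\<lambda>x. cutoff m x *\<^sub>R green_density a b x + layer m a b x)"
    "(LINT x:B \<union> exterior B|lborel. cutoff m x *\<^sub>R green_density a b x + layer m a b x) = 0"
proof -
  obtain C M where M: "M \<ge> 0" "\<And>x. x \<in> B \<union> exterior B \<Longrightarrow> norm (curl (curl b) x) \<le> indicator B x * M"
    using eddy_field_bounds[OF assms(2)] by metis
  have M': "norm (curl (curl b) x) \<le> M" if "x \<in> B \<union> exterior B" for x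
    using M(2)[OF that] M(1) by (cases "x \<in> B") auto
  have *: "C1_on (B \<union> exterior B) a" "transmitted B n a" "C1_on (B \<union> exterior B) (curl b)"
    "transmitted B n (curl b)" "has_traces B (curl a)"
    using assms by (auto simp: eddy_field_def transmitted_def)
  show "set_integrable lborel (B \<union> exterior B) (\<lambda>x. cutoff m x *\<^sub>R green_density a b x + layer m a b x)"
    "(LINT x:B \<union> exterior B|lborel. cutoff m x *\<^sub>R green_density a b x + layer m a b x) = 0"
    unfolding green_density_def layer_def
    by (rule integral_ccross_interface[OF B(1,3) * _ C1_on_cutoff compact_cball];
        (rule M' cutoff_outside; assumption))+
qed

text \<open>The normal is real, so conjugation commutes with the cross product by
  \<open>n\<close>.\<close>

lemma transmitted_cnj_vec:
  assumes "transmitted B n a"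
  shows "transmitted B n (\<lambda>x. cnj_vec (a x))"
proof -
  have t: "((\<lambda>x. cnj_vec (a x)) \<longlongrightarrow> cnj_vec l) F" if "(a \<longlongrightarrow> l) F" for l F
    by (rule bounded_linear.tendsto[OF bounded_linear_cnj_vec that])
  have "jump B (\<lambda>y. ccross (cvec (n x)) (cnj_vec (a y))) x = 0" if x: "x \<in> frontier B" for x
  proof -
    obtain p q where pq: "(a \<longlongrightarrow> p) (at x within B)" "(a \<longlongrightarrow> q) (at x within exterior B)"
      "ccross (cvec (n x)) p = ccross (cvec (n x)) q"
      using transmitted_traces[OF B(1,3) assms x] by blast
    have "jump B (\<lambda>y. ccross (cvec (n x)) (cnj_vec (a y))) x
        = ccross (cvec (n x)) (cnj_vec q) - ccross (cvec (n x)) (cnj_vec p)"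
      unfolding jump_def trace_in_def trace_out_def using frontier_not_trivial[OF B(1,3) x]
      by (intro arg_cong2[of _ _ _ _ minus] tendsto_Lim tendsto_ccross t pq tendsto_const)
    then show ?thesis by (simp add: ccross_cvec_cnj_vec pq(3))
  qed
  moreover have "has_traces B (\<lambda>x. cnj_vec (a x))"
    using assms t unfolding transmitted_def has_traces_def by blast
  ultimately show ?thesis by (simp add: transmitted_def)
qed

text \<open>Traces only see values in \<open>B\<close> and its exterior. This matters for curls:
  conjugation commutes with \<open>curl\<close> at points of differentiability, which boundary
  points need not be.\<close>

lemma transmitted_cong:
  assumes "transmitted B n a" "\<And>x. x \<in> B \<union> exterior B \<Longrightarrow> a x = b x"
  shows "transmitted B n b"
proof -
  have eq: "(a \<longlongrightarrow> l) (at x within S) \<longleftrightarrow> (b \<longlongrightarrow> l) (at x within S)" if "S = B \<or> S = exterior B" for l x S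
    by (rule Lim_cong_within) (use that assms(2) in auto)
  have "jump B (\<lambda>y. ccross (cvec (n x)) (b y)) x = 0" if x: "x \<in> frontier B" for x
  proof -
    obtain p q where pq: "(a \<longlongrightarrow> p) (at x within B)" "(a \<longlongrightarrow> q) (at x within exterior B)"
      "ccross (cvec (n x)) p = ccross (cvec (n x)) q"
      using transmitted_traces[OF B(1,3) assms(1) x] by blast
    then have pq': "(b \<longlongrightarrow> p) (at x within B)" "(b \<longlongrightarrow> q) (at x within exterior B)" by (simp_all add: eq)
    have "jump B (\<lambda>y. ccross (cvec (n x)) (b y)) x = ccross (cvec (n x)) q - ccross (cvec (n x)) p"
      unfolding jump_def trace_in_def trace_out_def using frontier_not_trivial[OF B(1,3) x]
      by (intro arg_cong2[of _ _ _ _ minus] tendsto_Lim tendsto_ccross pq' tendsto_const)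
    then show ?thesis by (simp add: pq(3))
  qed
  moreover have "has_traces B b"
    using assms(1) unfolding transmitted_def has_traces_def by (simp add: eq)
  ultimately show ?thesis by (simp add: transmitted_def)
qed

lemma curl_curl_cnj_vec:
  assumes "C1_on (B \<union> exterior B) a" "C1_on (B \<union> exterior B) (curl a)" "x \<in> B \<union> exterior B"
  shows "curl (curl (\<lambda>y. cnj_vec (a y))) x = cnj_vec (curl (curl a) x)"
proof -
  have "curl (curl (\<lambda>y. cnj_vec (a y))) x = curl (\<lambda>y. cnj_vec (curl a y)) x"
  proof (rule curl_cong[OF open_domain assms(3)])
    show "cnj_vec (curl a y) = curl (\<lambda>y. cnj_vec (a y)) y" if "y \<in> B \<union> exterior B" for y
      using curl_cnj_vec[OF C1_onD(1)[OF assms(1) that]] by simp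
    show "(\<lambda>y. cnj_vec (curl a y)) differentiable at x"
      using C1_onD(1)[OF C1_on_compose_bounded_linear[OF bounded_linear_cnj_vec assms(2)] assms(3)] .
  qed
  also have "\<dots> = cnj_vec (curl (curl a) x)"
    by (rule curl_cnj_vec[OF C1_onD(1)[OF assms(2,3)]])
  finally show ?thesis .
qed

lemma eddy_field_cnj_vec:
  assumes a: "eddy_field B n a"
  shows "eddy_field B n (\<lambda>x. cnj_vec (a x))"
proof -
  have C: "C1_on (B \<union> exterior B) a" "C1_on (B \<union> exterior B) (curl a)" using a by (auto simp: eddy_field_def)
  have c: "cnj_vec (curl a x) = curl (\<lambda>x. cnj_vec (a x)) x" if "x \<in> B \<union> exterior B" for x
    using curl_cnj_vec[OF C1_onD(1)[OF C(1) that]] by simp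
  note cc = curl_curl_cnj_vec[OF C]
  have "C1_on (B \<union> exterior B) (curl (\<lambda>x. cnj_vec (a x)))"
    by (rule C1_on_cong[OF open_domain C1_on_compose_bounded_linear[OF bounded_linear_cnj_vec C(2)] c])
  moreover have "transmitted B n (curl (\<lambda>x. cnj_vec (a x)))"
    by (rule transmitted_cong[OF transmitted_cnj_vec c]) (use a in \<open>auto simp: eddy_field_def\<close>)
  moreover have "cnj_vec 0 = 0" by (simp add: vec_eq_iff)
  ultimately show ?thesis
    using a unfolding eddy_field_def
    by (auto simp: cc intro!: transmitted_cnj_vec C1_on_compose_bounded_linear[OF bounded_linear_cnj_vec])
qed

lemma continuous_on_green:
  assumes "eddy_field B n a" "eddy_field B n b"
  shows "continuous_on (B \<union> exterior B) (\<lambda>x. cdot (curl a x) (curl b x))"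
    "continuous_on (B \<union> exterior B) (\<lambda>x. cdot (a x) (curl (curl b) x))"
    "continuous_on (B \<union> exterior B) (\<lambda>x. (norm (curl a x))\<^sup>2)"
  using assms unfolding eddy_field_def
  by (auto intro!: continuous_on_cdot continuous_on_curl continuous_intros intro: C1_onD(3))

text \<open>Testing with the conjugate field and absorbing half of the energy by Young's inequality; the
  remaining cutoff error is controlled by the decay of \<open>a\<close> alone.\<close>

lemma eddy_field_finite_energy:
  assumes a: "eddy_field B n a"
  shows "set_integrable lborel (B \<union> exterior B) (\<lambda>x. (norm (curl a x))\<^sup>2)"
proof -
  define \<Omega> where "\<Omega> = B \<union> exterior B"
  define a' where "a' = (\<lambda>x. cnj_vec (a x))"
  have a': "eddy_field B n a'" unfolding a'_def by (rule eddy_field_cnj_vec[OF a])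
  obtain C M where CM: "C \<ge> 0" "M \<ge> 0" "\<And>x. x \<in> \<Omega> \<Longrightarrow> norm (a x) \<le> C / (1 + norm x)"
    "\<And>x. x \<in> \<Omega> \<Longrightarrow> norm (curl (curl a) x) \<le> indicator B x * M"
    using eddy_field_bounds[OF a] unfolding \<Omega>_def by blast
  have na': "norm (a' x) = norm (a x)" for x by (simp add: a'_def)
  \<comment> \<open>The two terms majorise the interior source term and, after Young's inequality,
    the part of the layer term that is free of \<open>curl a\<close>.\<close>
  define h where "h x = indicator B x * (C * M) + (1/2) * (48 * C)\<^sup>2 * (1 / (1 + norm x) ^ 4)" for x :: "real^3"
  have \<Omega>: "open \<Omega>" using open_domain by (simp add: \<Omega>_def)
  have hi: "set_integrable lborel \<Omega> h"
    unfolding h_def by (intro set_integral_add set_integrable_indicator_bounded B \<Omega> set_integrable_decay4)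
  have hn: "h x \<ge> 0" for x unfolding h_def using CM by (auto intro!: add_nonneg_nonneg mult_nonneg_nonneg)
  define w where "w m x = cutoff m x *\<^sub>R green_density a' a x + layer m a' a x" for m x
  have wi: "set_integrable lborel \<Omega> (w m)" "(LINT x:\<Omega>|lborel. w m x) = 0" for m
    using green_cutoff[OF a' a, of m] by (auto simp: \<Omega>_def w_def[abs_def])
  have key: "cutoff m x * (norm (curl a x))\<^sup>2 \<le> 2 * (Re (w m x) + h x)" if x: "x \<in> \<Omega>" for m x
  proof -
    define s where "s = sqrt (cutoff m x)"
    have s: "s \<ge> 0" "s\<^sup>2 = cutoff m x" by (auto simp: s_def cutoff_bounds)
    define c where "c = norm (curl a x)"
    have "a differentiable at x" using a x C1_onD(1) by (auto simp: eddy_field_def \<Omega>_def)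
    then have g: "green_density a' a x = of_real (c\<^sup>2) - cdot (a' x) (curl (curl a) x)"
      unfolding green_density_def a'_def by (simp add: curl_cnj_vec cdot_cnj_vec_self c_def)
    have 1: "norm (cdot (a' x) (curl (curl a) x)) \<le> indicator B x * (C * M)"
      by (rule norm_cdot_curl_curl_le) (use CM x na' in auto)
    have 2: "norm (layer m a' a x) \<le> s * c * (48 * C / (1 + norm x)\<^sup>2)"
      unfolding s_def c_def by (rule norm_layer_le) (use CM x na' in auto)
    \<comment> \<open>Young's inequality: (s c)^2 is \<open>cutoff m x\<close> times |curl a|^2.
      Half of it moves to the left side, whence the factor 2 in \<open>key\<close>.\<close>
    have "s * c * (48 * C / (1 + norm x)\<^sup>2) \<le> (1/2) * (s * c)\<^sup>2 + (1/2) * (48 * C / (1 + norm x)\<^sup>2)\<^sup>2"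
      using sum_squares_bound[of "s * c" "48 * C / (1 + norm x)\<^sup>2"] by simp
    also have "(48 * C / (1 + norm x)\<^sup>2)\<^sup>2 = (48 * C)\<^sup>2 * (1 / (1 + norm x) ^ 4)"
      by (simp add: power_divide flip: power_mult)
    finally have 3: "norm (layer m a' a x) \<le> (1/2) * (cutoff m x * c\<^sup>2) + (1/2) * (48 * C)\<^sup>2 * (1 / (1 + norm x) ^ 4)"
      using 2 by (simp add: power_mult_distrib s)
    have "norm (cutoff m x *\<^sub>R cdot (a' x) (curl (curl a) x)) \<le> 1 * (indicator B x * (C * M))"
      unfolding norm_scaleR using 1 cutoff_bounds[of m x] by (intro mult_mono) auto
    moreover have "w m x = of_real (cutoff m x * c\<^sup>2) - cutoff m x *\<^sub>R cdot (a' x) (curl (curl a) x) + layer m a' a x"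
      unfolding w_def g by (simp add: scaleR_conv_of_real algebra_simps)
    then have "cutoff m x * c\<^sup>2 = Re (w m x) + Re (cutoff m x *\<^sub>R cdot (a' x) (curl (curl a) x)) - Re (layer m a' a x)"
      by simp
    ultimately show ?thesis
      using 3 complex_Re_le_cmod[of "- layer m a' a x"]
        complex_Re_le_cmod[of "cutoff m x *\<^sub>R cdot (a' x) (curl (curl a) x)"]
      unfolding h_def c_def[symmetric] norm_minus_cancel uminus_complex.sel by argo
  qed
  define g where "g m x = indicator \<Omega> x * (cutoff m x * (norm (curl a x))\<^sup>2)" for m x
  have cont: "continuous_on \<Omega> (\<lambda>x. (norm (curl a x))\<^sup>2)"
    using continuous_on_green(3)[OF a a] by (simp add: \<Omega>_def)
  have gm: "g m \<in> borel_measurable lborel" for m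
    unfolding g_def
    using borel_measurable_continuous_on_indicator[of \<Omega> "\<lambda>x. cutoff m x * (norm (curl a x))\<^sup>2"] \<Omega>
     continuous_on_mult[OF C1_onD(3)[OF C1_on_cutoff] cont] by simp
  have fm: "(\<lambda>x. indicator \<Omega> x *\<^sub>R (norm (curl a x))\<^sup>2) \<in> borel_measurable lborel"
    using borel_measurable_continuous_on_indicator[OF _ cont] \<Omega> by simp
  define E where "E = 2 * (LINT x:\<Omega>|lborel. h x)"
  \<comment> \<open>\<open>w m\<close> has integral zero, so the bound is independent of
    \<open>m\<close>.\<close>
  have gE: "(\<integral>\<^sup>+x. ennreal (g m x) \<partial>lborel) \<le> ennreal E" for m
  proof -
    have Rw: "integrable lborel (\<lambda>x. Re (indicator \<Omega> x *\<^sub>R w m x))"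
      using wi(1)[of m] unfolding set_integrable_def by (rule integrable_Re)
    have hi': "integrable lborel (\<lambda>x. indicator \<Omega> x *\<^sub>R h x)" using hi by (simp add: set_integrable_def)
    have "(\<integral>\<^sup>+x. ennreal (g m x) \<partial>lborel) \<le> (\<integral>\<^sup>+x. ennreal (2 * (Re (indicator \<Omega> x *\<^sub>R w m x) + indicator \<Omega> x *\<^sub>R h x)) \<partial>lborel)"
      using key by (intro nn_integral_mono ennreal_leI) (auto simp: g_def indicator_def)
    also have "\<dots> = ennreal (LINT x|lborel. 2 * (Re (indicator \<Omega> x *\<^sub>R w m x) + indicator \<Omega> x *\<^sub>R h x))"
    proof (rule nn_integral_eq_integral)
      show "integrable lborel (\<lambda>x. 2 * (Re (indicator \<Omega> x *\<^sub>R w m x) + indicator \<Omega> x *\<^sub>R h x))"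
        by (intro integrable_mult_right Bochner_Integration.integrable_add Rw hi')
      have "0 \<le> cutoff m x * (norm (curl a x))\<^sup>2" for x by (simp add: cutoff_bounds)
      then show "AE x in lborel. 0 \<le> 2 * (Re (indicator \<Omega> x *\<^sub>R w m x) + indicator \<Omega> x *\<^sub>R h x)"
        using order_trans[OF _ key] by (intro AE_I2) (auto simp: indicator_def)
    qed
    also have "(LINT x|lborel. 2 * (Re (indicator \<Omega> x *\<^sub>R w m x) + indicator \<Omega> x *\<^sub>R h x)) = E"
      using wi(2)[of m] wi(1)[of m] unfolding E_def set_lebesgue_integral_def set_integrable_def
      by (simp only: integral_mult_right_zero Bochner_Integration.integral_add[OF Rw hi'] integral_Re) simp
    finally show ?thesis .
  qed
  have lim: "(\<lambda>m. ennreal (g m x)) \<longlonglongrightarrow> ennreal (indicator \<Omega> x *\<^sub>R (norm (curl a x))\<^sup>2)" for x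
    unfolding g_def using tendsto_mult[OF tendsto_const[of "indicator \<Omega> x"] tendsto_mult[OF tendsto_cutoff(1)[of x] tendsto_const[of "(norm (curl a x))\<^sup>2"]]]
    by (intro tendsto_ennrealI) simp
  \<comment> \<open>Fatou's lemma removes the cutoff.\<close>
  have "(\<integral>\<^sup>+x. ennreal (indicator \<Omega> x *\<^sub>R (norm (curl a x))\<^sup>2) \<partial>lborel) = (\<integral>\<^sup>+x. liminf (\<lambda>m. ennreal (g m x)) \<partial>lborel)"
    using lim_imp_Liminf[OF sequentially_bot lim] by simp
  also have "\<dots> \<le> liminf (\<lambda>m. \<integral>\<^sup>+x. ennreal (g m x) \<partial>lborel)"
    by (rule nn_integral_liminf) (use gm in measurable)
  also have "\<dots> \<le> ennreal E"
    using Liminf_mono[of "\<lambda>m. \<integral>\<^sup>+x. ennreal (g m x) \<partial>lborel" "\<lambda>_. ennreal E" sequentially] gE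
    by (simp add: Liminf_const)
  also have "ennreal E < \<infinity>" by simp
  finally have "(\<integral>\<^sup>+x. ennreal (indicator \<Omega> x *\<^sub>R (norm (curl a x))\<^sup>2) \<partial>lborel) < \<infinity>" .
  then show ?thesis
    unfolding set_integrable_def \<Omega>_def[symmetric] by (intro integrableI_nonneg fm) (auto simp: indicator_def)
qed

text \<open>Finite energy makes the product of the curls integrable and supplies a majorant for the
  cutoff identities; their layer term tends to zero pointwise, so dominated convergence removes the
  cutoff.\<close>

lemma green_identity:
  assumes a: "eddy_field B n a" and b: "eddy_field B n b"
  shows "set_integrable lborel (B \<union> exterior B) (\<lambda>x. cdot (curl a x) (curl b x))"
    "set_integrable lborel B (\<lambda>x. cdot (a x) (curl (curl b) x))"
    "(LINT x:B \<union> exterior B|lborel. cdot (curl a x) (curl b x)) = (LINT x:B|lborel. cdot (a x) (curl (curl b) x))"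
proof -
  define \<Omega> where "\<Omega> = B \<union> exterior B"
  have \<Omega>: "open \<Omega>" using open_domain by (simp add: \<Omega>_def)
  obtain C where C: "C \<ge> 0" "\<And>x. x \<in> \<Omega> \<Longrightarrow> norm (a x) \<le> C / (1 + norm x)"
    using eddy_field_bounds[OF a] unfolding \<Omega>_def by metis
  obtain M where M: "M \<ge> 0" "\<And>x. x \<in> \<Omega> \<Longrightarrow> norm (curl (curl b) x) \<le> indicator B x * M"
    using eddy_field_bounds[OF b] unfolding \<Omega>_def by metis
  note cont = continuous_on_green[OF a b, folded \<Omega>_def]
  have ea: "set_integrable lborel \<Omega> (\<lambda>x. (norm (curl a x))\<^sup>2)"
    and eb: "set_integrable lborel \<Omega> (\<lambda>x. (norm (curl b x))\<^sup>2)"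
    using eddy_field_finite_energy[OF a] eddy_field_finite_energy[OF b] by (simp_all add: \<Omega>_def)
  have cc: "norm (cdot (a x) (curl (curl b) x)) \<le> indicator B x * (C * M)" if "x \<in> \<Omega>" for x
    by (rule norm_cdot_curl_curl_le) (use C M that in auto)
  have young: "r * s \<le> r\<^sup>2 + s\<^sup>2" for r s :: real
    using sum_squares_bound[of r s] zero_le_power2[of r] zero_le_power2[of s] by linarith
  have c: "norm (cdot (curl a x) (curl b x)) \<le> (norm (curl a x))\<^sup>2 + (norm (curl b x))\<^sup>2" for x
    using norm_cdot_le[of "curl a x" "curl b x"] young[of "norm (curl a x)" "norm (curl b x)"] by linarith
  have i1: "set_integrable lborel \<Omega> (\<lambda>x. cdot (curl a x) (curl b x))"
    by (rule set_integrable_continuous_bound[OF \<Omega> cont(1) set_integral_add(1)[OF ea eb] c])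
  have i2: "set_integrable lborel \<Omega> (\<lambda>x. cdot (a x) (curl (curl b) x))"
    by (rule set_integrable_continuous_bound[OF \<Omega> cont(2) set_integrable_indicator_bounded[OF B(1,2) \<Omega>] cc])
  have out: "cdot (a x) (curl (curl b) x) = 0" if "x \<in> \<Omega> - B" for x
    using cc[of x] that by simp
  have supp: "set_integrable lborel \<Omega> (\<lambda>x. cdot (a x) (curl (curl b) x)) \<longleftrightarrow>
      set_integrable lborel B (\<lambda>x. cdot (a x) (curl (curl b) x))"
    "(LINT x:\<Omega>|lborel. cdot (a x) (curl (curl b) x)) = (LINT x:B|lborel. cdot (a x) (curl (curl b) x))"
    by (rule set_integral_support; use out in \<open>auto simp: \<Omega>_def\<close>)+
  have i3: "set_integrable lborel B (\<lambda>x. cdot (a x) (curl (curl b) x))"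
    using i2 supp(1) by simp
  \<comment> \<open>The bracketed last pair dominates the layer term, the other summands the Green
    density.\<close>
  define D where "D x = (norm (curl a x))\<^sup>2 + (norm (curl b x))\<^sup>2 + indicator B x * (C * M)
     + ((norm (curl b x))\<^sup>2 + (48 * C)\<^sup>2 * (1 / (1 + norm x) ^ 4))" for x
  have Di: "integrable lborel (\<lambda>x. indicator \<Omega> x *\<^sub>R D x)"
    unfolding set_integrable_def[symmetric] D_def
    by (intro set_integral_add(1) ea eb set_integrable_indicator_bounded B \<Omega> set_integrable_decay4)
  define w where "w m x = cutoff m x *\<^sub>R green_density a b x + layer m a b x" for m x
  have wi: "set_integrable lborel \<Omega> (w m)" "(LINT x:\<Omega>|lborel. w m x) = 0" for m
    using green_cutoff[OF a b, of m] by (auto simp: \<Omega>_def w_def[abs_def])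
  have gi: "set_integrable lborel \<Omega> (green_density a b)"
    unfolding green_density_def[abs_def] by (rule set_integral_diff(1)[OF i1 i2])
  have wD: "norm (w m x) \<le> D x" if x: "x \<in> \<Omega>" for m x
  proof -
    have "norm (cutoff m x *\<^sub>R green_density a b x) \<le> 1 * ((norm (curl a x))\<^sup>2 + (norm (curl b x))\<^sup>2 + indicator B x * (C * M))"
      unfolding norm_scaleR
    proof (intro mult_mono)
      show "norm (green_density a b x) \<le> (norm (curl a x))\<^sup>2 + (norm (curl b x))\<^sup>2 + indicator B x * (C * M)"
        unfolding green_density_def by (rule order_trans[OF norm_triangle_ineq4 add_mono[OF c cc[OF x]]])
    qed (auto simp: cutoff_bounds)
    moreover have "norm (layer m a b x) \<le> sqrt (cutoff m x) * norm (curl b x) * (48 * C / (1 + norm x)\<^sup>2)"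
      by (rule norm_layer_le) (use C x in auto)
    moreover have "sqrt (cutoff m x) * norm (curl b x) * (48 * C / (1 + norm x)\<^sup>2)
        \<le> 1 * norm (curl b x) * (48 * C / (1 + norm x)\<^sup>2)"
      using C(1) cutoff_bounds[of m x] by (intro mult_right_mono) auto
    moreover have "norm (curl b x) * (48 * C / (1 + norm x)\<^sup>2) \<le> (norm (curl b x))\<^sup>2 + (48 * C)\<^sup>2 * (1 / (1 + norm x) ^ 4)"
      using young[of "norm (curl b x)" "48 * C / (1 + norm x)\<^sup>2"]
      by (simp add: power_divide flip: power_mult)
    ultimately show ?thesis
      unfolding w_def D_def mult_1 using norm_triangle_ineq[of "cutoff m x *\<^sub>R green_density a b x" "layer m a b x"]
      by linarith
  qed
  have wlim: "(\<lambda>m. w m x) \<longlonglongrightarrow> green_density a b x" for x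
  proof -
    have "(\<lambda>m. w m x) \<longlonglongrightarrow> 1 *\<^sub>R green_density a b x + (\<Sum>j\<in>UNIV. 0 *\<^sub>R ccross (a x) (curl b x) $ j)"
      unfolding w_def layer_def by (intro tendsto_intros tendsto_cutoff)
    then show ?thesis by simp
  qed
  have "(\<lambda>m. LINT x|lborel. indicator \<Omega> x *\<^sub>R w m x) \<longlonglongrightarrow> (LINT x|lborel. indicator \<Omega> x *\<^sub>R green_density a b x)"
  proof (rule integral_dominated_convergence[OF _ _ Di])
    show "(\<lambda>x. indicator \<Omega> x *\<^sub>R green_density a b x) \<in> borel_measurable lborel"
      using gi by (simp add: set_integrable_def borel_measurable_integrable)
    show "(\<lambda>x. indicator \<Omega> x *\<^sub>R w m x) \<in> borel_measurable lborel" for m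
      using wi(1)[of m] by (simp add: set_integrable_def borel_measurable_integrable)
    show "AE x in lborel. (\<lambda>m. indicator \<Omega> x *\<^sub>R w m x) \<longlonglongrightarrow> indicator \<Omega> x *\<^sub>R green_density a b x"
      by (intro AE_I2 tendsto_scaleR tendsto_const wlim)
    show "AE x in lborel. norm (indicator \<Omega> x *\<^sub>R w m x) \<le> indicator \<Omega> x *\<^sub>R D x" for m
      using wD by (intro AE_I2) (auto simp: indicator_def)
  qed
  then have "(LINT x:\<Omega>|lborel. green_density a b x) = 0"
    using wi(2) unfolding set_lebesgue_integral_def by (simp add: LIMSEQ_const_iff)
  then have "(LINT x:\<Omega>|lborel. cdot (curl a x) (curl b x)) = (LINT x:\<Omega>|lborel. cdot (a x) (curl (curl b) x))"
    unfolding green_density_def using set_integral_diff(2)[OF i1 i2] by simp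
  also have "\<dots> = (LINT x:B|lborel. cdot (a x) (curl (curl b) x))"
    by (rule supp(2))
  finally show "(LINT x:B \<union> exterior B|lborel. cdot (curl a x) (curl b x)) = (LINT x:B|lborel. cdot (a x) (curl (curl b) x))"
    by (simp add: \<Omega>_def)
  show "set_integrable lborel (B \<union> exterior B) (\<lambda>x. cdot (curl a x) (curl b x))"
    "set_integrable lborel B (\<lambda>x. cdot (a x) (curl (curl b) x))"
    using i1 i3 by (simp_all add: \<Omega>_def)
qed

end

subsection \<open>The transmission problem\<close>

lemma norm_vector_scalar_mult: "norm (c *s (w :: complex^3)) = norm c * norm w"
  by (simp add: norm_vec_def L2_set_right_distrib norm_mult)

text \<open>Boundedness on a large ball and decay outside it combine into one estimate; 1 + |x|
  avoids the singularity of 1 / |x| at the origin.\<close>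

lemma eddy_decay:
  assumes B: "open B" and \<theta>: "continuous_on (B \<union> exterior B) \<theta>" "has_traces B \<theta>"
    and O: "(\<lambda>x. norm (\<theta> x)) \<in> O[at_infinity](\<lambda>x. 1 / norm x)"
  obtains C where "\<And>x. x \<in> B \<union> exterior B \<Longrightarrow> norm (\<theta> x) \<le> C / (1 + norm x)"
proof -
  obtain c where c: "c > 0" "\<forall>\<^sub>F x in at_infinity. norm (norm (\<theta> x)) \<le> c * norm (1 / norm x)"
    using landau_o.bigE[OF O] by blast
  then obtain R0 where R0: "\<And>x. norm x \<ge> R0 \<Longrightarrow> norm (\<theta> x) \<le> c / norm x"
    unfolding eventually_at_infinity by auto
  \<comment> \<open>R \<ge> 1 gives 1 + |x| \<le> 2 |x| outside the ball, which explains the term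
    \<open>2 * c\<close> in the constant.\<close>
  define R where "R = max 1 R0"
  obtain M where M: "\<And>x. x \<in> B \<union> exterior B \<Longrightarrow> norm x \<le> R \<Longrightarrow> norm (\<theta> x) \<le> M"
    using traces_bounded[OF B \<theta>] by metis
  have "norm (\<theta> x) \<le> (\<bar>M\<bar> * (1 + R) + 2 * c) / (1 + norm x)" if x: "x \<in> B \<union> exterior B" for x
  proof (cases "norm x \<le> R")
    case True
    have "norm (\<theta> x) * (1 + norm x) \<le> \<bar>M\<bar> * (1 + R)"
      using M[OF x True] True by (intro mult_mono) auto
    then have "norm (\<theta> x) * (1 + norm x) \<le> \<bar>M\<bar> * (1 + R) + 2 * c" using c(1) by linarith
    then show ?thesis by (simp add: pos_le_divide_eq add_pos_nonneg)
  next
    case False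
    then have n: "norm x \<ge> 1" "norm x \<ge> R0" by (auto simp: R_def)
    have "norm (\<theta> x) * (1 + norm x) \<le> (c / norm x) * (2 * norm x)"
      using R0[OF n(2)] n(1) c(1) by (intro mult_mono) auto
    also have "\<dots> = 2 * c" using n(1) by auto
    also have "\<dots> \<le> \<bar>M\<bar> * (1 + R) + 2 * c" by (simp add: R_def)
    finally show ?thesis by (simp add: pos_le_divide_eq add_pos_nonneg)
  qed
  then show ?thesis using that by blast
qed

text \<open>For \<mu>_r = 1 the weight in the second jump condition is 1, so
  \<open>curl \<theta>\<close> itself is tangentially continuous; with a bounded source the equation
  in \<open>B\<close> bounds \<open>curl (curl \<theta>)\<close>.\<close>

lemma theta1_problem_eddy_field:
  assumes B: "open B" "bounded B"
    and \<theta>: "theta1_problem B n 1 \<nu> \<theta>0 \<theta>" and \<theta>0: "\<And>x. x \<in> B \<Longrightarrow> norm (\<theta>0 x) \<le> M0"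
  shows "eddy_field B n \<theta>"
    "x \<in> B \<Longrightarrow> curl (curl \<theta>) x = (\<i> * complex_of_real \<nu>) *s (\<theta> x + \<theta>0 x)"
    "\<exists>M. \<forall>x\<in>B. norm (\<theta> x) \<le> M"
proof -
  let ?\<Omega> = "B \<union> exterior B"
  have E: "open (exterior B)" by (auto simp: exterior_def)
  have "mu_tilde B 1 x = 1" for x by (simp add: mu_tilde_def)
  with \<theta> have P: "C2_on B \<theta>" "C2_on (exterior B) \<theta>" "has_traces B \<theta>" "has_traces B (curl \<theta>)"
    "\<And>x. x \<in> B \<Longrightarrow> curl (curl \<theta>) x = (\<i> * complex_of_real \<nu>) *s (\<theta> x + \<theta>0 x)"
    "\<And>x. x \<in> exterior B \<Longrightarrow> curl (curl \<theta>) x = 0"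
    "\<And>x. x \<in> frontier B \<Longrightarrow> jump B (\<lambda>y. ccross (cvec (n x)) (\<theta> y)) x = 0"
    "\<And>x. x \<in> frontier B \<Longrightarrow> jump B (\<lambda>y. ccross (cvec (n x)) (curl \<theta> y)) x = 0"
    "(\<lambda>x. norm (\<theta> x)) \<in> O[at_infinity](\<lambda>x. 1 / norm x)"
    by (simp_all add: theta1_problem_def)
  show eq: "x \<in> B \<Longrightarrow> curl (curl \<theta>) x = (\<i> * complex_of_real \<nu>) *s (\<theta> x + \<theta>0 x)" for x by (rule P(5))
  have C: "C1_on ?\<Omega> \<theta>" "C1_on ?\<Omega> (curl \<theta>)"
    using P(1,2) by (auto intro!: C1_on_Un B E C1_on_curl simp: C2_on_def)
  obtain R where R: "\<And>x. x \<in> B \<Longrightarrow> norm x \<le> R" using B(2) bounded_iff by blast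
  obtain M where M: "\<And>x. x \<in> ?\<Omega> \<Longrightarrow> norm x \<le> R \<Longrightarrow> norm (\<theta> x) \<le> M"
    using traces_bounded[OF B(1) C1_onD(3)[OF C(1)] P(3)] by metis
  have MB: "norm (\<theta> x) \<le> M" if "x \<in> B" for x using M[of x] R that by auto
  then show "\<exists>M. \<forall>x\<in>B. norm (\<theta> x) \<le> M" by blast
  have "norm (curl (curl \<theta>) x) \<le> \<bar>\<nu>\<bar> * (M + M0)" if "x \<in> B" for x
    using norm_triangle_ineq[of "\<theta> x" "\<theta>0 x"] MB[OF that] \<theta>0[OF that]
    unfolding eq[OF that] norm_vector_scalar_mult by (auto simp: norm_mult intro!: mult_left_mono)
  moreover obtain C where "\<And>x. x \<in> ?\<Omega> \<Longrightarrow> norm (\<theta> x) \<le> C / (1 + norm x)"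
    using eddy_decay[OF B(1) C1_onD(3)[OF C(1)] P(3,9)] by blast
  ultimately show "eddy_field B n \<theta>"
    unfolding eddy_field_def transmitted_def using C P by blast
qed

lemma set_integrable_bounded_continuous:
  fixes f :: "real^3 \<Rightarrow> 'a::{banach, second_countable_topology}"
  assumes "open B" "bounded B" "continuous_on B f" "\<And>x. x \<in> B \<Longrightarrow> norm (f x) \<le> M"
  shows "set_integrable lborel B f"
  by (rule set_integrable_continuous_bound[OF assms(1,3)
        set_integrable_indicator_bounded[OF assms(1,2,1), of M]]) (use assms(4) in auto)

lemma set_integrable_cdot:
  fixes a b :: vec_field
  assumes "open B" "bounded B" "continuous_on B a" "continuous_on B b"
    "\<forall>x\<in>B. norm (a x) \<le> Ma" "\<forall>x\<in>B. norm (b x) \<le> Mb"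
  shows "set_integrable lborel B (\<lambda>x. cdot (a x) (b x))"
proof (rule set_integrable_bounded_continuous[OF assms(1,2) continuous_on_cdot[OF assms(3,4)]])
  show "norm (cdot (a x) (b x)) \<le> \<bar>Ma\<bar> * \<bar>Mb\<bar>" if "x \<in> B" for x
    by (rule order_trans[OF norm_cdot_le]) (use assms(5,6) that in \<open>force intro!: mult_mono intro: order_trans\<close>)
qed

lemma cdot_add_right: "cdot a (b + c) = cdot a b + cdot a c"
  and cdot_add_left: "cdot (b + c) a = cdot b a + cdot c a"
  and cdot_smult_right: "cdot a (z *s b) = z * cdot a b"
  and cdot_smult_left: "cdot (z *s b) a = z * cdot b a"
  by (simp_all add: cdot_3 algebra_simps)

lemma cnj_cdot: "cnj (cdot a b) = cdot (cnj_vec a) (cnj_vec b)"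
  by (simp add: cdot_3)

lemma cnj_vec_involution [simp]: "cnj_vec (cnj_vec a) = a"
  by (simp add: vec_eq_iff)

lemma cnj_set_integral: "cnj (LINT x:A|M. f x) = (LINT x:A|M. cnj (f x))"
proof -
  have "(LINT x|M. cnj (indicator A x *\<^sub>R f x)) = cnj (LINT x|M. indicator A x *\<^sub>R f x)"
    by (rule Bochner_Integration.integral_cnj)
  then show ?thesis by (simp add: set_lebesgue_integral_def)
qed

lemma bounded_linear_cdot: "bounded_linear (cdot a)"
  by (rule linear_conv_bounded_linear[THEN iffD1], rule linearI)
    (simp_all add: cdot_3 algebra_simps)

text \<open>Cyclic invariance of the triple product. For \<open>m = monomial \<beta> x\<close> the
  vector on the right is the source \<open>\<theta>0 \<beta> k x\<close>, so moments become
  integrals against that source.\<close>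

lemma moment_triple_product:
  "cdot (cvec (axis k 1)) (ccross (cvec x) (m *\<^sub>R w)) = cdot (cvec (m *\<^sub>R cross3 (axis k 1) x)) w"
  using exhaust_3[of k]
  by (auto simp: cdot_3 cvec_def cross3_def axis_def) (simp_all add: scaleR_conv_of_real algebra_simps)

lemma continuous_on_moment:
  "continuous_on S (\<lambda>x. cvec (monomial d x *\<^sub>R cross3 (axis i 1) x))"
  unfolding monomial_def[abs_def]
  by (intro continuous_on_cvec continuous_on_scaleR continuous_on_prod continuous_on_cross continuous_intros)

theorem lemma5p5:
  fixes B :: "(real^3) set" and n :: "real^3 \<Rightarrow> real^3"
    and \<omega> \<sigma>\<^sub>s \<mu>\<^sub>0 \<mu>\<^sub>s \<mu>\<^sub>r \<nu> \<alpha> :: real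
    and \<theta>0 \<theta>1 :: "nat^3 \<Rightarrow> 3 \<Rightarrow> real^3 \<Rightarrow> complex^3"
    and \<beta> \<delta> :: "nat^3" and k j :: 3
  assumes B: "open B" "bounded B" "C1_boundary_with_normal B n"
    and \<alpha>: "\<alpha> > 0"
    and \<nu>: "\<nu> = \<omega> * \<sigma>\<^sub>s * \<mu>\<^sub>0 * \<alpha>\<^sup>2" "\<nu> > 0"
    and \<mu>\<^sub>r: "\<mu>\<^sub>r = \<mu>\<^sub>s / \<mu>\<^sub>0" "\<mu>\<^sub>s = \<mu>\<^sub>0"
    and \<theta>0: "\<And>d i x. \<theta>0 d i x = cvec (monomial d x *\<^sub>R cross3 (axis i 1) x)"
    and \<theta>1: "theta1_problem B n \<mu>\<^sub>r \<nu> (\<theta>0 \<beta> k) (\<theta>1 \<beta> k)"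
            "theta1_problem B n \<mu>\<^sub>r \<nu> (\<theta>0 \<delta> j) (\<theta>1 \<delta> j)"
  shows "let
      D = D_coeff B \<nu> \<alpha> \<theta>0 \<theta>1 \<beta> \<delta> k j;
      a = complex_of_real (\<alpha> ^ (3 + mi_order \<beta> + mi_order \<delta>));
      f = (\<lambda>x. cdot (curl (\<lambda>y. inverse \<mu>\<^sub>r *\<^sub>R curl (\<theta>1 \<beta> k) y) x)
                    (curl (\<lambda>y. inverse \<mu>\<^sub>r *\<^sub>R curl (\<lambda>z. cnj_vec (\<theta>1 \<delta> j z)) y) x));
      g = (\<lambda>x. cdot (inverse (mu_tilde B \<mu>\<^sub>r x) *\<^sub>R curl (\<theta>1 \<beta> k) x)
                    (curl (\<lambda>z. cnj_vec (\<theta>1 \<delta> j z)) x));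
      R = a * (LINT x:B \<union> exterior B|lborel. g x);
      I = - a * (LINT x:B|lborel. complex_of_real (1 / \<nu>) * f x)
    in set_integrable lborel B
         (\<lambda>x. ccross (cvec x) (monomial \<beta> x *\<^sub>R (\<theta>0 \<delta> j x + \<theta>1 \<delta> j x))) \<and>
       set_integrable lborel B f \<and> set_integrable lborel (B \<union> exterior B) g \<and>
       D = - a * ((LINT x:B|lborel. (\<i> / complex_of_real \<nu>) * f x)
                   - (LINT x:B \<union> exterior B|lborel. g x)) \<and>
       D = R + \<i> * I \<and>
       R = complex_of_real (Re D) \<and>
       I = complex_of_real (Im D)"
proof -
  have "\<mu>\<^sub>0 \<noteq> 0" using \<nu> by auto
  then have \<mu>1: "\<mu>\<^sub>r = 1" using \<mu>\<^sub>r by simp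
  have mu: "mu_tilde B 1 x = 1" for x by (simp add: mu_tilde_def)
  let ?\<Omega> = "B \<union> exterior B"
  define u where "u = \<theta>1 \<beta> k"
  define v where "v = \<theta>1 \<delta> j"
  define u0 where "u0 = \<theta>0 \<beta> k"
  define v0 where "v0 = \<theta>0 \<delta> j"
  define u' where "u' = (\<lambda>x. cnj_vec (u x))"
  define v' where "v' = (\<lambda>x. cnj_vec (v x))"
  \<comment> \<open>The coefficient in \<open>curl curl u = z (u + u0)\<close>; \<i>/\<nu> inverts
    it up to sign, which is how this factor enters the result.\<close>
  define z where "z = \<i> * complex_of_real \<nu>"
  have z: "z \<noteq> 0" "\<i> / complex_of_real \<nu> * z = -1" using \<nu>(2) by (auto simp: z_def)
  have cont0: "continuous_on S u0" "continuous_on S v0" for S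
    using continuous_on_moment[of S \<beta> k] continuous_on_moment[of S \<delta> j] unfolding u0_def v0_def
    by (simp_all flip: \<theta>0)
  have cB: "compact (closure B)" using B(2) by simp
  obtain Mu0 where Mu0: "\<And>x. x \<in> B \<Longrightarrow> norm (u0 x) \<le> Mu0"
    using bounded_on_compact_continuous[OF cB cont0(1)] closure_subset by (metis subsetD)
  obtain Mv0 where Mv0: "\<And>x. x \<in> B \<Longrightarrow> norm (v0 x) \<le> Mv0"
    using bounded_on_compact_continuous[OF cB cont0(2)] closure_subset by (metis subsetD)
  note Pu = theta1_problem_eddy_field[OF B(1,2) \<theta>1(1)[folded u_def u0_def, unfolded \<mu>1] Mu0]
  note Pv = theta1_problem_eddy_field[OF B(1,2) \<theta>1(2)[folded v_def v0_def, unfolded \<mu>1] Mv0]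
  have eu: "eddy_field B n u" and ev: "eddy_field B n v" using Pu(1) Pv(1) by auto
  have eu': "eddy_field B n u'" and ev': "eddy_field B n v'"
    unfolding u'_def v'_def using eddy_field_cnj_vec[OF B] eu ev by auto
  have ccu: "curl (curl u) x = z *s (u x + u0 x)" and ccv: "curl (curl v) x = z *s (v x + v0 x)" if "x \<in> B" for x
    using Pu(2) Pv(2) that by (auto simp: z_def)
  have C: "C1_on ?\<Omega> u" "C1_on ?\<Omega> (curl u)" "C1_on ?\<Omega> v" "C1_on ?\<Omega> (curl v)"
    using eu ev by (auto simp: eddy_field_def)
  have curl': "curl u' x = cnj_vec (curl u x)" "curl v' x = cnj_vec (curl v x)"
    "curl (curl u') x = cnj_vec (curl (curl u) x)" "curl (curl v') x = cnj_vec (curl (curl v) x)"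
    if "x \<in> ?\<Omega>" for x
    unfolding u'_def v'_def
    using curl_cnj_vec[OF C1_onD(1)[OF C(1) that]] curl_cnj_vec[OF C1_onD(1)[OF C(3) that]]
      curl_curl_cnj_vec[OF B C(1,2) that] curl_curl_cnj_vec[OF B C(3,4) that] by auto
  have real0: "cnj_vec (u0 x) = u0 x" "cnj_vec (v0 x) = v0 x" for x
    by (simp_all add: u0_def v0_def \<theta>0 cvec_def vec_eq_iff)
  \<comment> \<open>Conjugation changes the sign of \<open>z\<close> but leaves the real sources
    alone.\<close>
  have ccu': "curl (curl u') x = (- z) *s (u' x + u0 x)" and ccv': "curl (curl v') x = (- z) *s (v' x + v0 x)"
    if "x \<in> B" for x
    using curl'(3,4)[of x] that real0[of x]
    by (auto simp: ccu ccv vec_eq_iff u'_def v'_def z_def)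

  obtain Mu Mv where Mu: "\<forall>x\<in>B. norm (u x) \<le> Mu" and Mv: "\<forall>x\<in>B. norm (v x) \<le> Mv"
    using Pu(3) Pv(3) by blast
  have contB: "continuous_on B v" "continuous_on B (curl (curl u))" "continuous_on B (curl (curl v))"
    "continuous_on B (curl (curl v'))" "continuous_on B (curl (curl u'))"
    using eu ev eu' ev' unfolding eddy_field_def
    by (auto intro: continuous_on_subset[OF C1_onD(3)] continuous_on_subset[OF continuous_on_curl])
  obtain Nu Nv Nu' Nv' where N: "\<forall>x\<in>B. norm (curl (curl u) x) \<le> Nu" "\<forall>x\<in>B. norm (curl (curl v) x) \<le> Nv"
     "\<forall>x\<in>B. norm (curl (curl u') x) \<le> Nu'" "\<forall>x\<in>B. norm (curl (curl v') x) \<le> Nv'"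
    using eu ev eu' ev' unfolding eddy_field_def by blast
  note ic = set_integrable_cdot[OF B(1,2)]
  have i0: "set_integrable lborel B (\<lambda>x. cdot (u0 x) (curl (curl v) x))"
    "set_integrable lborel B (\<lambda>x. cdot (v0 x) (curl (curl u) x))"
    "set_integrable lborel B (\<lambda>x. cdot (curl (curl u) x) (curl (curl v') x))"
    "set_integrable lborel B (\<lambda>x. cdot (curl (curl u') x) (curl (curl v) x))"
    using ic[OF cont0(1) contB(3) _ N(2), of Mu0] ic[OF cont0(2) contB(2) _ N(1), of Mv0]
      ic[OF contB(2,4) N(1,4)] ic[OF contB(5,3) N(3,2)] Mu0 Mv0 by auto

  \<comment> \<open>\<open>P\<close> and \<open>Q\<close> are the integrals of the claimed formula;
    \<open>S\<close> is the coefficient up to sign and the power of \<alpha>.\<close>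
  define P where "P = (LINT x:?\<Omega>|lborel. cdot (curl u x) (curl v' x))"
  define Q where "Q = (LINT x:B|lborel. cdot (curl (curl u) x) (curl (curl v') x))"
  define S where "S = (LINT x:B|lborel. cdot (u0 x) (curl (curl v) x))"
  \<comment> \<open>\<open>G1\<close> and \<open>G2\<close> involve a conjugate field and give
    \<open>P\<close> and \<open>cnj P\<close>; \<open>G3\<close> and \<open>G4\<close> involve none,
    and their left sides agree, which yields reciprocity.\<close>
  note G1 = green_identity[OF B ev' eu] and G2 = green_identity[OF B eu' ev]
    and G3 = green_identity[OF B eu ev] and G4 = green_identity[OF B ev eu]
  have m: "?\<Omega> \<in> sets lborel" "B \<in> sets lborel" using open_domain[OF B] B(1) by auto
  have P1: "(LINT x:B|lborel. cdot (v' x) (curl (curl u) x)) = P"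
    unfolding P_def G1(3)[symmetric] by (simp add: cdot_commute)
  have "cnj P = (LINT x:?\<Omega>|lborel. cdot (curl u' x) (curl v x))"
    unfolding P_def cnj_set_integral
    by (intro set_lebesgue_integral_cong m) (auto simp: cnj_cdot curl')
  then have P2: "(LINT x:B|lborel. cdot (u' x) (curl (curl v) x)) = cnj P"
    using G2(3) by simp
  have Q2: "(LINT x:B|lborel. cdot (curl (curl u') x) (curl (curl v) x)) = cnj Q"
    unfolding Q_def cnj_set_integral
    by (intro set_lebesgue_integral_cong m) (auto simp: cnj_cdot curl')
  \<comment> \<open>The source \<open>u0\<close> is eliminated through the conjugate field
    \<open>u'\<close>, so conjugates of \<open>P\<close> and \<open>Q\<close> appear.\<close>
  have S1: "S = - cnj P + \<i> / complex_of_real \<nu> * cnj Q"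
  proof -
    have "cdot (u0 x) (curl (curl v) x) = \<i> / complex_of_real \<nu> * cdot (curl (curl u') x) (curl (curl v) x)
        - cdot (u' x) (curl (curl v) x)" if "x \<in> B" for x
    proof -
      have "\<i> / complex_of_real \<nu> * cdot (curl (curl u') x) (curl (curl v) x) =
        - (\<i> / complex_of_real \<nu> * z) * cdot (u' x + u0 x) (curl (curl v) x)"
        unfolding ccu'[OF that] cdot_smult_left by simp
      then show ?thesis unfolding z(2) by (simp add: cdot_add_left)
    qed
    then have "S = (LINT x:B|lborel. \<i> / complex_of_real \<nu> * cdot (curl (curl u') x) (curl (curl v) x)
        - cdot (u' x) (curl (curl v) x))"
      unfolding S_def by (intro set_lebesgue_integral_cong m) auto
    also have "\<dots> = \<i> / complex_of_real \<nu> * cnj Q - cnj P"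
      using i0(4) G2(2) by (subst set_integral_diff(2)) (simp_all add: P2 Q2 set_integral_mult_right)
    finally show ?thesis by simp
  qed
  have S2: "S = - P + \<i> / complex_of_real \<nu> * Q"
  proof -
    have "cdot (v0 x) (curl (curl u) x) = \<i> / complex_of_real \<nu> * cdot (curl (curl u) x) (curl (curl v') x)
        - cdot (v' x) (curl (curl u) x)" if "x \<in> B" for x
    proof -
      have "\<i> / complex_of_real \<nu> * cdot (curl (curl u) x) (curl (curl v') x) =
        - (\<i> / complex_of_real \<nu> * z) * cdot (curl (curl u) x) (v' x + v0 x)"
        unfolding ccv'[OF that] cdot_smult_right by simp
      then show ?thesis unfolding z(2) by (simp add: cdot_add_right cdot_commute)
    qed
    then have "(LINT x:B|lborel. cdot (v0 x) (curl (curl u) x)) =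
        (LINT x:B|lborel. \<i> / complex_of_real \<nu> * cdot (curl (curl u) x) (curl (curl v') x)
        - cdot (v' x) (curl (curl u) x))"
      by (intro set_lebesgue_integral_cong m) auto
    also have "\<dots> = \<i> / complex_of_real \<nu> * Q - P"
      using i0(3) G1(2) by (subst set_integral_diff(2)) (simp_all add: P1 Q_def set_integral_mult_right)
    finally have 1: "(LINT x:B|lborel. cdot (v0 x) (curl (curl u) x)) = - P + \<i> / complex_of_real \<nu> * Q" by simp
    \<comment> \<open>Reciprocity: after inserting the equations, z u0 \<cdot> v0 cancels on the
      left and z u \<cdot> v on the right, leaving the same expression. By Green's identity the
      right side has integral zero, so \<open>u0\<close> may be traded for
      \<open>v0\<close>.\<close>
    have "cdot (u0 x) (curl (curl v) x) - cdot (v0 x) (curl (curl u) x) =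
        cdot (v x) (curl (curl u) x) - cdot (u x) (curl (curl v) x)" if "x \<in> B" for x
      unfolding ccu[OF that] ccv[OF that] cdot_smult_right cdot_add_right
      by (simp add: algebra_simps cdot_commute)
    then have "(LINT x:B|lborel. cdot (u0 x) (curl (curl v) x) - cdot (v0 x) (curl (curl u) x)) =
        (LINT x:B|lborel. cdot (v x) (curl (curl u) x) - cdot (u x) (curl (curl v) x))"
      by (intro set_lebesgue_integral_cong m) auto
    also have "\<dots> = (LINT x:B|lborel. cdot (v x) (curl (curl u) x)) - (LINT x:B|lborel. cdot (u x) (curl (curl v) x))"
      by (rule set_integral_diff(2)[OF G4(2) G3(2)])
    also have "\<dots> = 0"
      using G3(3) G4(3) by (simp add: cdot_commute)
    finally show ?thesis
      using 1 set_integral_diff(2)[OF i0(1,2)] by (simp add: S_def)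
  qed
  \<comment> \<open>In the imaginary part of the equation the terms with Re Q agree and leave Im P =
    0; in the real part those with Re P agree and leave Im Q = 0.\<close>
  have PQ: "Im P = 0" "Im Q = 0"
  proof -
    have E: "- cnj P + \<i> / complex_of_real \<nu> * cnj Q = - P + \<i> / complex_of_real \<nu> * Q" using S1 S2 by simp
    have i: "\<i> / complex_of_real \<nu> = Complex 0 (1 / \<nu>)" by (simp add: complex_eq_iff)
    show "Im P = 0" using arg_cong[OF E, of Im] unfolding i by simp
    show "Im Q = 0" using arg_cong[OF E, of Re] \<nu>(2) unfolding i by simp
  qed

  \<comment> \<open>The coefficient expressed by \<open>S\<close>\<close>
  define A where "A = complex_of_real (\<alpha> ^ (3 + mi_order \<beta> + mi_order \<delta>))"
  have im: "set_integrable lborel B (\<lambda>x. ccross (cvec x) (monomial \<beta> x *\<^sub>R (v0 x + v x)))"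
  proof -
    have cw: "continuous_on S (\<lambda>x. cvec (monomial \<beta> x *\<^sub>R x))" for S
      unfolding monomial_def[abs_def]
      by (intro continuous_on_cvec continuous_on_scaleR continuous_on_prod continuous_intros)
    obtain N1 where N1: "\<And>x. x \<in> B \<Longrightarrow> norm (cvec (monomial \<beta> x *\<^sub>R x)) \<le> N1"
      using bounded_on_compact_continuous[OF cB cw] closure_subset by (metis subsetD)
    have eq: "ccross (cvec x) (monomial \<beta> x *\<^sub>R (v0 x + v x)) = ccross (cvec (monomial \<beta> x *\<^sub>R x)) (v0 x + v x)" for x
      by (simp add: vec_eq_iff forall_3 cvec_def) (simp add: scaleR_conv_of_real algebra_simps)
    have vb: "norm (v0 x + v x) \<le> \<bar>Mv0 + Mv\<bar>" if "x \<in> B" for x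
      using norm_triangle_ineq[of "v0 x" "v x"] Mv0[OF that] Mv that by fastforce
    have "norm (ccross (cvec (monomial \<beta> x *\<^sub>R x)) (v0 x + v x)) \<le> 6 * (\<bar>N1\<bar> * \<bar>Mv0 + Mv\<bar>)" if "x \<in> B" for x
      using N1[OF that] vb[OF that]
      by (intro order_trans[OF norm_ccross_le] mult_left_mono mult_mono) auto
    then show ?thesis
      unfolding eq by (intro set_integrable_bounded_continuous[OF B(1,2)] continuous_on_ccross cw
          continuous_on_add cont0 contB)
  qed
  have "cdot (cvec (axis k 1)) (LINT x:B|lborel. ccross (cvec x) (monomial \<beta> x *\<^sub>R (v0 x + v x))) =
      (LINT x:B|lborel. cdot (u0 x) (v0 x + v x))"
  proof -
    have "cdot (cvec (axis k 1)) (LINT x:B|lborel. ccross (cvec x) (monomial \<beta> x *\<^sub>R (v0 x + v x))) =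
       (LINT x|lborel. cdot (cvec (axis k 1)) (indicator B x *\<^sub>R ccross (cvec x) (monomial \<beta> x *\<^sub>R (v0 x + v x))))"
      unfolding set_lebesgue_integral_def
      by (rule integral_bounded_linear[OF bounded_linear_cdot im[unfolded set_integrable_def], symmetric])
    also have "\<dots> = (LINT x:B|lborel. cdot (u0 x) (v0 x + v x))"
      unfolding set_lebesgue_integral_def
      by (simp only: linear_scale[OF bounded_linear.linear[OF bounded_linear_cdot]] moment_triple_product u0_def \<theta>0)
    finally show ?thesis .
  qed
  \<comment> \<open>The equation for \<open>v\<close> turns z (v + v0) into
    \<open>curl curl v\<close>; the factor z is already present in the prefactor of the
    coefficient.\<close>
  also have "z * \<dots> = S"
    unfolding S_def set_integral_mult_right[symmetric]
    by (intro set_lebesgue_integral_cong m allI impI)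
      (simp only: ccv cdot_smult_right, simp only: add.commute)
  finally have DS: "D_coeff B \<nu> \<alpha> \<theta>0 \<theta>1 \<beta> \<delta> k j = - A * S"
    unfolding D_coeff_def A_def z_def v_def v0_def by (auto simp: mult.assoc)
  have f: "cdot (curl (\<lambda>y. inverse \<mu>\<^sub>r *\<^sub>R curl (\<theta>1 \<beta> k) y) x)
             (curl (\<lambda>y. inverse \<mu>\<^sub>r *\<^sub>R curl (\<lambda>z. cnj_vec (\<theta>1 \<delta> j z)) y) x)
      = cdot (curl (curl u) x) (curl (curl v') x)"
    and g: "cdot (inverse (mu_tilde B \<mu>\<^sub>r x) *\<^sub>R curl (\<theta>1 \<beta> k) x) (curl (\<lambda>z. cnj_vec (\<theta>1 \<delta> j z)) x)
      = cdot (curl u x) (curl v' x)" for x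
    by (simp_all add: \<mu>1 mu u_def v'_def v_def)
  have gi: "set_integrable lborel ?\<Omega> (\<lambda>x. cdot (curl u x) (curl v' x))"
    using G1(1) by (simp add: cdot_commute)
  have Pr: "P = complex_of_real (Re P)" and Qr: "Q = complex_of_real (Re Q)"
    using PQ by (simp_all add: complex_eq_iff)
  have D: "- A * S = A * P + \<i> * (- A * (complex_of_real (1 / \<nu>) * Q))"
    unfolding S2 by (simp add: algebra_simps)
  have AR: "A = complex_of_real (Re A)" by (simp add: A_def)
  \<comment> \<open>\<open>A\<close>, \<open>P\<close> and \<open>Q\<close> are real, so
    \<open>D\<close> is already the splitting into real and imaginary parts.\<close>
  have ReIm: "A * P = complex_of_real (Re (- A * S))" "- A * (complex_of_real (1 / \<nu>) * Q) = complex_of_real (Im (- A * S))"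
    unfolding D using PQ AR by (simp_all add: complex_eq_iff A_def)
  have fi: "(LINT x:B|lborel. c * cdot (curl (curl u) x) (curl (curl v') x)) = c * Q" for c
    by (simp add: Q_def)
  have D': "- A * S = - A * (\<i> / complex_of_real \<nu> * Q - P)"
    unfolding S2 by simp
  show ?thesis
    unfolding Let_def f g
    unfolding v_def[symmetric] v0_def[symmetric] A_def[symmetric] DS P_def[symmetric] fi
    by (intro conjI im i0(3) gi D D' ReIm)
qed

end
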